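(* Let $m,n\ge1$ and let $\lambda_1,\dots,\lambda_m\in\mathbb{R}^n$ be linearly independent over $\mathbb{Z}$. Let $\Lambda$ be the $m\times n$ matrix with rows $\lambda_1,\dots,\lambda_m$, and assume that for each $d>0$ the set $\{k\in\mathbb{Z}^m:|\Lambda^Tk|\le d\}$ is finite. Consider on the torus $\mathbb{T}^m$ (with normalized Haar measure $\mu$) the dynamical system $\tau(x)\omega:=\omega+\Lambda x \pmod{\mathbb{Z}^m}$, $x\in\mathbb{R}^n$, and for $k\in\mathbb{Z}^m$ let $\gamma(\xi_k)=2\pi|\Lambda^Tk|$, where $\xi_k(\omega)=e^{2\pi i\,k\cdot\omega}$. Then $H^1_\gamma(\mathbb{T}^m)$ is compactly embedded in $L^2(\mathbb{T}^m)$. Moreover, for every stochastic deformation $\Phi:\mathbb{R}^n\times\mathbb{T}^m\to\mathbb{R}^n$ (with respect to $\tau$), the space $\mathcal{H}_\Phi$ is compactly embedded in $\mathcal{L}_\Phi$.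
   Context: The dual group of $\mathbb{T}^m$ is $\{\xi_k:k\in\mathbb{Z}^m\}$. $H^1_\gamma(\mathbb{T}^m)$ is the set of $h\in L^2(\mathbb{T}^m)$ with $\|h\|^2_{H^1_\gamma}:=\sum_{k\in\mathbb{Z}^m}(1+\gamma(\xi_k)^2)|\widehat h(\xi_k)|^2<\infty$, where $\widehat h(\xi_k)=\int_{\mathbb{T}^m}h\,\overline{\xi_k}\,d\mu$. Write $\Omega=\mathbb{T}^m$, $\mathbb{P}=\mu$. A measurable function $f$ on $\mathbb{R}^n\times\Omega$ is stationary if for all $x,k\in\mathbb{R}^n$, $f(x+k,\omega)=f(x,\tau(k)\omega)$ for a.e. $\omega\in\Omega$. A stochastic deformation is a map $\Phi:\mathbb{R}^n\times\Omega\to\mathbb{R}^n$ such that: (i) for a.e. $\omega$, $\Phi(\cdot,\omega)$ is a bi-Lipschitz diffeomorphism of $\mathbb{R}^n$; (ii) there is $\nu_0>0$ with $\operatorname{ess\,inf}_{\omega,y}\det\nabla\Phi(y,\omega)\ge\nu_0$; (iii) there is $M>0$ with $\operatorname{ess\,sup}_{\omega,y}|\nabla\Phi(y,\omega)|\le M<\infty$; (iv) $\nabla\Phi$ is stationary. $\Phi^{-1}(\cdot,\omega)$ denotes the inverse of $\Phi(\cdot,\omega)$. $\mathcal{L}_\Phi$ is the space of functions $F(z,\omega)=f(\Phi^{-1}(z,\omega),\omega)$ with $f\in L^2_{\rm loc}(\mathbb{R}^n;L^2(\Omega))$ stationary, with norm $\|F\|_{\mathcal{L}_\Phi}^2=\int_\Omega\int_{\Phi([0,1)^n,\omega)}|F(z,\omega)|^2\,dz\,d\mathbb{P}(\omega)$.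 $\mathcal{H}_\Phi$ is the space of functions $F(z,\omega)=f(\Phi^{-1}(z,\omega),\omega)$ with $f\in H^1_{\rm loc}(\mathbb{R}^n;L^2(\Omega))$ stationary, with norm $\|F\|_{\mathcal{H}_\Phi}^2=\int_\Omega\int_{\Phi([0,1)^n,\omega)}\big(|F|^2+|\nabla_zF|^2\big)\,dz\,d\mathbb{P}(\omega)$. A normed space $X\subset Y$ is compactly embedded in $Y$ if every sequence bounded in $X$ has a subsequence converging in $Y$. *)

theory Defs
  imports "HOL-Analysis.Analysis"
begin

section \<open>Compact embeddings\<close>

text \<open>
  Spaces of functions modulo null sets are represented by their sets of representatives, with
  (semi)norms valued in \<^typ>\<open>ennreal\<close>, so that an infinite norm is never confused with a finite one.
\<close>

definition ennreal_sqrt :: "ennreal \<Rightarrow> ennreal" where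
  "ennreal_sqrt x = (if x = \<infinity> then \<infinity> else ennreal (sqrt (enn2real x)))"

definition compactly_embedded ::
    "('a::minus) set \<Rightarrow> ('a \<Rightarrow> ennreal) \<Rightarrow> 'a set \<Rightarrow> ('a \<Rightarrow> ennreal) \<Rightarrow> bool" where
  "compactly_embedded X normX Y normY \<longleftrightarrow>
     X \<subseteq> Y \<and>
     (\<forall>u :: nat \<Rightarrow> 'a.
        (\<forall>j. u j \<in> X) \<and> (\<exists>C::real. \<forall>j. normX (u j) \<le> ennreal C) \<longrightarrow>
        (\<exists>r l. strict_mono (r :: nat \<Rightarrow> nat) \<and> l \<in> Y \<and>
               (\<lambda>j. normY (u (r j) - l)) \<longlonglongrightarrow> 0))"


section \<open>The torus and the linear flow on it\<close>

text \<open>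
  The torus \<open>\<real>\<^sup>m / \<int>\<^sup>m\<close> is identified with the fundamental domain \<open>[0,1)\<^sup>m\<close>. Its normalized
  (completed) Haar measure is then Lebesgue measure, and reduction modulo \<open>\<int>\<^sup>m\<close> takes
  fractional parts of the coordinates.
\<close>

definition unit_cell :: "(real ^ 'd::finite) set" where
  "unit_cell = {x. \<forall>i. 0 \<le> x $ i \<and> x $ i < 1}"

definition torus :: "(real ^ 'm::finite) measure" where
  "torus = lebesgue_on unit_cell"

definition torus_flow ::
    "real ^ 'n ^ 'm \<Rightarrow> real ^ 'n::finite \<Rightarrow> real ^ 'm::finite \<Rightarrow> real ^ 'm" where
  "torus_flow \<Lambda> x \<omega> = (\<chi> i. frac ((\<omega> + \<Lambda> *v x) $ i))"

definition real_vec :: "int ^ 'm::finite \<Rightarrow> real ^ 'm" where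
  "real_vec k = (\<chi> i. of_int (k $ i))"

definition torus_char :: "int ^ 'm::finite \<Rightarrow> real ^ 'm \<Rightarrow> complex" where
  "torus_char k \<omega> = exp (2 * of_real pi * \<i> * of_real (real_vec k \<bullet> \<omega>))"

definition fourier_coeff :: "(real ^ 'm::finite \<Rightarrow> complex) \<Rightarrow> int ^ 'm \<Rightarrow> complex" where
  "fourier_coeff h k = (LINT \<omega>|torus. h \<omega> * cnj (torus_char k \<omega>))"

text \<open>The weight \<open>\<gamma>\<close> on the dual group, whose elements \<open>torus_char k\<close> are indexed by \<open>k\<close>.\<close>

definition dual_weight :: "real ^ 'n::finite ^ 'm::finite \<Rightarrow> int ^ 'm \<Rightarrow> real" where
  "dual_weight \<Lambda> k = 2 * pi * norm (transpose \<Lambda> *v real_vec k)"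

definition L2_norm :: "(real ^ 'm::finite \<Rightarrow> complex) \<Rightarrow> ennreal" where
  "L2_norm h = ennreal_sqrt (\<integral>\<^sup>+\<omega>. ennreal ((cmod (h \<omega>))\<^sup>2) \<partial>torus)"

definition L2_torus :: "(real ^ 'm::finite \<Rightarrow> complex) set" where
  "L2_torus = {h \<in> borel_measurable torus. L2_norm h < \<infinity>}"

definition H1_norm ::
    "(int ^ 'm \<Rightarrow> real) \<Rightarrow> (real ^ 'm::finite \<Rightarrow> complex) \<Rightarrow> ennreal" where
  "H1_norm \<gamma> h =
     ennreal_sqrt (\<Sum>\<^sub>\<infinity>k. ennreal ((1 + (\<gamma> k)\<^sup>2) * (cmod (fourier_coeff h k))\<^sup>2))"

definition H1_torus :: "(int ^ 'm \<Rightarrow> real) \<Rightarrow> (real ^ 'm::finite \<Rightarrow> complex) set" where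
  "H1_torus \<gamma> = {h \<in> L2_torus. H1_norm \<gamma> h < \<infinity>}"


section \<open>Weak gradients\<close>

definition partial_deriv :: "'n::finite \<Rightarrow> (real ^ 'n \<Rightarrow> real) \<Rightarrow> real ^ 'n \<Rightarrow> real" where
  "partial_deriv i \<phi> x = frechet_derivative \<phi> (at x) (axis i 1)"

primrec Ck :: "nat \<Rightarrow> (real ^ 'n::finite \<Rightarrow> real) \<Rightarrow> bool" where
  "Ck 0 \<phi> \<longleftrightarrow> continuous_on UNIV \<phi>"
| "Ck (Suc k) \<phi> \<longleftrightarrow> \<phi> differentiable_on UNIV \<and> (\<forall>i. Ck k (partial_deriv i \<phi>))"

definition test_function :: "(real ^ 'n::finite \<Rightarrow> real) \<Rightarrow> bool" where
  "test_function \<phi> \<longleftrightarrow> (\<forall>k. Ck k \<phi>) \<and> compact (closure {x. \<phi> x \<noteq> 0})"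

definition has_weak_gradient ::
    "(real ^ 'n::finite \<Rightarrow> complex) \<Rightarrow> (real ^ 'n \<Rightarrow> complex ^ 'n) \<Rightarrow> bool" where
  "has_weak_gradient u U \<longleftrightarrow>
     (\<forall>K. compact K \<longrightarrow> u absolutely_integrable_on K \<and> U absolutely_integrable_on K) \<and>
     (\<forall>\<phi>. test_function \<phi> \<longrightarrow>
        (\<forall>i. (LINT x|lebesgue. partial_deriv i \<phi> x *\<^sub>R u x) = - (LINT x|lebesgue. \<phi> x *\<^sub>R U x $ i)))"

text \<open>Unique up to a null set whenever a weak gradient exists.\<close>

definition weak_gradient ::
    "(real ^ 'n::finite \<Rightarrow> complex) \<Rightarrow> real ^ 'n \<Rightarrow> complex ^ 'n" where
  "weak_gradient u = (SOME U. has_weak_gradient u U)"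


section \<open>Stationary random fields over the torus\<close>

text \<open>Lebesgue measure on \<open>\<real>\<^sup>n \<times> [0,1)\<^sup>m\<close>, i.e. the completed product measure.\<close>

definition field_measure :: "((real ^ 'n::finite) \<times> (real ^ 'm::finite)) measure" where
  "field_measure = lebesgue_on (UNIV \<times> unit_cell)"

definition stationary ::
    "(real ^ 'n::finite \<Rightarrow> real ^ 'm::finite \<Rightarrow> real ^ 'm) \<Rightarrow>
     (real ^ 'n \<Rightarrow> real ^ 'm \<Rightarrow> 'v::topological_space) \<Rightarrow> bool" where
  "stationary \<tau> f \<longleftrightarrow>
     case_prod f \<in> borel_measurable field_measure \<and>
     (\<forall>x k. AE \<omega> in torus. f (x + k) \<omega> = f x (\<tau> k \<omega>))"

text \<open>
  \<open>L\<^sup>2\<^sub>l\<^sub>o\<^sub>c(\<real>\<^sup>n; L\<^sup>2(\<Omega>))\<close> and \<open>H\<^sup>1\<^sub>l\<^sub>o\<^sub>c(\<real>\<^sup>n; L\<^sup>2(\<Omega>))\<close>, with jointly measurable functions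
  as representatives. The \<open>L\<^sup>2(\<Omega>)\<close>-valued integrals defining the weak derivative are evaluated at
  almost every \<open>\<omega>\<close>; the exceptional set may depend on the test function.
\<close>

definition L2_loc ::
    "(real ^ 'n::finite \<Rightarrow> real ^ 'm::finite \<Rightarrow> 'v::real_normed_vector) set" where
  "L2_loc = {f. case_prod f \<in> borel_measurable field_measure \<and>
     (\<forall>K. compact K \<longrightarrow>
        (\<integral>\<^sup>+x\<in>K. (\<integral>\<^sup>+\<omega>. ennreal ((norm (f x \<omega>))\<^sup>2) \<partial>torus) \<partial>lebesgue) < \<infinity>)}"

definition H1_loc :: "(real ^ 'n::finite \<Rightarrow> real ^ 'm::finite \<Rightarrow> complex) set" where
  "H1_loc = {f \<in> L2_loc. \<exists>g :: real ^ 'n \<Rightarrow> real ^ 'm \<Rightarrow> complex ^ 'n. g \<in> L2_loc \<and>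
     (\<forall>\<phi>. test_function \<phi> \<longrightarrow> (\<forall>i. AE \<omega> in torus.
        (LINT x|lebesgue. partial_deriv i \<phi> x *\<^sub>R f x \<omega>) = - (LINT x|lebesgue. \<phi> x *\<^sub>R g x \<omega> $ i)))}"


section \<open>Stochastic deformations and the deformed spaces\<close>

definition bilipschitz_diffeo :: "(real ^ 'n::finite \<Rightarrow> real ^ 'n) \<Rightarrow> bool" where
  "bilipschitz_diffeo \<psi> \<longleftrightarrow>
     bij \<psi> \<and> \<psi> differentiable_on UNIV \<and> inv \<psi> differentiable_on UNIV \<and>
     (\<exists>L. lipschitz_on L UNIV \<psi>) \<and> (\<exists>L. lipschitz_on L UNIV (inv \<psi>))"

definition field_jacobian ::
    "(real ^ 'n::finite \<Rightarrow> real ^ 'm::finite \<Rightarrow> real ^ 'n) \<Rightarrow> real ^ 'n \<Rightarrow> real ^ 'm \<Rightarrow> real ^ 'n ^ 'n" where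
  "field_jacobian \<Phi> y \<omega> = jacobian (\<lambda>y. \<Phi> y \<omega>) (at y)"

definition stochastic_deformation ::
    "(real ^ 'n::finite \<Rightarrow> real ^ 'm::finite \<Rightarrow> real ^ 'm) \<Rightarrow>
     (real ^ 'n \<Rightarrow> real ^ 'm \<Rightarrow> real ^ 'n) \<Rightarrow> bool" where
  "stochastic_deformation \<tau> \<Phi> \<longleftrightarrow>
     (AE \<omega> in torus. bilipschitz_diffeo (\<lambda>y. \<Phi> y \<omega>)) \<and>
     (\<exists>\<nu>>0. AE (y, \<omega>) in field_measure. \<nu> \<le> det (field_jacobian \<Phi> y \<omega>)) \<and>
     (\<exists>M>0. AE (y, \<omega>) in field_measure. norm (field_jacobian \<Phi> y \<omega>) \<le> M) \<and>
     stationary \<tau> (field_jacobian \<Phi>)"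

definition deformed ::
    "(real ^ 'n::finite \<Rightarrow> real ^ 'm::finite \<Rightarrow> real ^ 'n) \<Rightarrow>
     (real ^ 'n \<Rightarrow> real ^ 'm \<Rightarrow> complex) \<Rightarrow> real ^ 'n \<Rightarrow> real ^ 'm \<Rightarrow> complex" where
  "deformed \<Phi> f = (\<lambda>z \<omega>. f (inv (\<lambda>y. \<Phi> y \<omega>) z) \<omega>)"

definition deformed_L2 ::
    "(real ^ 'n::finite \<Rightarrow> real ^ 'm::finite \<Rightarrow> real ^ 'm) \<Rightarrow>
     (real ^ 'n \<Rightarrow> real ^ 'm \<Rightarrow> real ^ 'n) \<Rightarrow> (real ^ 'n \<Rightarrow> real ^ 'm \<Rightarrow> complex) set" where
  "deformed_L2 \<tau> \<Phi> = deformed \<Phi> ` {f \<in> L2_loc. stationary \<tau> f}"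

definition deformed_L2_norm ::
    "(real ^ 'n::finite \<Rightarrow> real ^ 'm::finite \<Rightarrow> real ^ 'n) \<Rightarrow>
     (real ^ 'n \<Rightarrow> real ^ 'm \<Rightarrow> complex) \<Rightarrow> ennreal" where
  "deformed_L2_norm \<Phi> F = ennreal_sqrt
     (\<integral>\<^sup>+\<omega>. (\<integral>\<^sup>+z\<in>(\<lambda>y. \<Phi> y \<omega>) ` unit_cell. ennreal ((cmod (F z \<omega>))\<^sup>2) \<partial>lebesgue) \<partial>torus)"

definition deformed_H1 ::
    "(real ^ 'n::finite \<Rightarrow> real ^ 'm::finite \<Rightarrow> real ^ 'm) \<Rightarrow>
     (real ^ 'n \<Rightarrow> real ^ 'm \<Rightarrow> real ^ 'n) \<Rightarrow> (real ^ 'n \<Rightarrow> real ^ 'm \<Rightarrow> complex) set" where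
  "deformed_H1 \<tau> \<Phi> = deformed \<Phi> ` {f \<in> H1_loc. stationary \<tau> f}"

definition deformed_H1_norm ::
    "(real ^ 'n::finite \<Rightarrow> real ^ 'm::finite \<Rightarrow> real ^ 'n) \<Rightarrow>
     (real ^ 'n \<Rightarrow> real ^ 'm \<Rightarrow> complex) \<Rightarrow> ennreal" where
  "deformed_H1_norm \<Phi> F = ennreal_sqrt
     (\<integral>\<^sup>+\<omega>. (\<integral>\<^sup>+z\<in>(\<lambda>y. \<Phi> y \<omega>) ` unit_cell.
        ennreal ((cmod (F z \<omega>))\<^sup>2 + (norm (weak_gradient (\<lambda>z. F z \<omega>) z))\<^sup>2) \<partial>lebesgue) \<partial>torus)"

end

theory Submission
  imports Defs "HOL-Complex_Analysis.Great_Picard"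
begin

text \<open>
  In Fourier coordinates the first embedding is a statement about weighted sequence spaces. Only
  finitely many frequencies \<open>\<Lambda>\<^sup>T k\<close> lie in a given ball, so the weights
  \<open>1 + \<gamma>(k)\<^sup>2\<close> exceed every bound outside a finite set. A sequence
  bounded in the weighted space therefore has uniformly small tails, and a diagonal subsequence
  along which every coefficient converges is convergent in the mean
  (\<open>H1_compact_sequence\<close>). The translation back to functions is Parseval's identity.
  It is derived from the theorem of Riesz and Fischer together with the uniqueness of Fourier
  coefficients: a function with vanishing coefficients is orthogonal to all polynomials in the
  coordinates \<open>exp (2\<pi>\<i>\<omega>\<^sub>j)\<close> and their conjugates, hence by
  Stone--Weierstrass to all continuous functions, hence to the indicators of compact sets.

  The second embedding is reduced to the first. A stationary field \<open>f\<close> is determined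
  by one function \<open>h\<close> on the torus: \<open>f(x, \<omega>) = h(\<omega> +
  \<Lambda>x)\<close> for almost every \<open>\<omega>\<close> and almost every \<open>x\<close>
  (\<open>stationary_representation\<close>). Taking Fourier coefficients in
  \<open>\<omega>\<close> of the weak derivative of \<open>f\<close> shows that its components
  have coefficients of modulus \<open>2\<pi>\<bar>(\<Lambda>\<^sup>T k)\<^sub>i\<bar>
  \<bar>h\<^sub>k\<bar>\<close>, so \<open>h\<close> lies in the weighted space
  (\<open>weak_derivative_coeffs_summable\<close>), and by Parseval its squared norm there is the
  mean over \<open>\<omega>\<close> and over the unit cell of \<open>\<bar>f\<bar>\<^sup>2 +
  \<bar>\<nabla>f\<bar>\<^sup>2\<close> (\<open>energy_identity\<close>). It remains to compare
  this quantity with the norm of the deformed function \<open>F(z, \<omega>) =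
  f(\<Phi>\<^sup>-\<^sup>1(z, \<omega>), \<omega>)\<close>.

  For this the weak gradient of \<open>F(\<cdot>, \<omega>)\<close> has to be identified for
  almost every \<open>\<omega>\<close>. The Fourier partial sums of \<open>h\<close>, evaluated
  along the flow, are smooth, and along a sufficiently fast subsequence they and their gradients
  converge in \<open>L\<^sup>1\<close> on every ball for almost every \<open>\<omega>\<close>;
  this replaces mollification and gives one exceptional null set for all test functions at once.
  Composed with the inverse deformation they are Lipschitz and differentiable everywhere, so
  integration by parts holds for them, and the change of variables formula carries the limit
  through the composition (\<open>weak_gradient_composition\<close>). Uniqueness of weak gradients
  then says that \<open>weak_gradient\<close> is the push-forward of \<open>\<nabla>f\<close>. The
  bounds \<open>det \<nabla>\<Phi> \<ge> \<nu>\<close> and \<open>\<bar>\<nabla>\<Phi>\<bar> \<le>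
  M\<close> control the weighted norm of \<open>h\<close> by the norm of \<open>F\<close>
  (\<open>deformed_energy_estimate\<close>) and the norm of a difference of deformed functions by
  that of the torus functions (\<open>deformed_L2_estimate\<close>), so that the convergent
  subsequence found on the torus also converges after deformation.
\<close>

section \<open>Translations and characters of the torus\<close>

lemma sets_unit_cell [measurable]: "(unit_cell :: (real ^ 'm::finite) set) \<in> sets borel"
proof -
  have "(unit_cell :: (real ^ 'm) set) = (\<Inter>i. {x. 0 \<le> x $ i} \<inter> {x. x $ i < 1})"
    by (auto simp: unit_cell_def)
  also have "\<dots> \<in> sets borel"
    by (intro sets.finite_INT sets.Int borel_closed borel_open closed_halfspace_component_ge_cart
        open_halfspace_component_lt_cart) auto
  finally show ?thesis .
qed

lemma sets_lebesgue_unit_cell [simp]: "(unit_cell :: (real ^ 'm::finite) set) \<in> sets lebesgue"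
  by (metis sets_unit_cell sets_completionI_sets sets_lborel)

lemma space_torus [simp]: "space (torus :: (real ^ 'm::finite) measure) = unit_cell"
  by (simp add: torus_def)

lemma nn_integral_torus:
  "(\<integral>\<^sup>+\<omega>. g \<omega> \<partial>torus) = (\<integral>\<^sup>+\<omega>. g \<omega> * indicator unit_cell \<omega> \<partial>lborel)"
  by (simp add: torus_def nn_integral_restrict_space nn_integral_completion)

lemma AE_torus_iff:
  "(AE \<omega> in torus. P \<omega>) \<longleftrightarrow> (AE \<omega> in lborel. \<omega> \<in> unit_cell \<longrightarrow> P \<omega>)"
  unfolding torus_def by (subst AE_restrict_space_iff) (simp_all add: AE_completion_iff)

lemma measurable_torusI: "g \<in> measurable borel N \<Longrightarrow> g \<in> measurable torus N"
  unfolding torus_def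
  by (intro measurable_restrict_space1) (simp add: measurable_completion)

lemma emeasure_torus_space: "emeasure (torus :: (real ^ 'm::finite) measure) unit_cell = 1"
proof -
  have sub: "box 0 (vec 1) \<subseteq> (unit_cell :: (real ^ 'm) set)" "(unit_cell :: (real ^ 'm) set) \<subseteq> cbox 0 (vec 1)"
    by (auto simp: unit_cell_def mem_box_cart less_imp_le)
  have "vec 1 \<bullet> b = 1" if "b \<in> Basis" for b :: "real ^ 'm"
    using that by (auto simp: Basis_vec_def inner_axis)
  then have "emeasure lborel (box 0 (vec 1 :: real ^ 'm)) = 1"
       "emeasure lborel (cbox 0 (vec 1 :: real ^ 'm)) = 1"
    by (simp_all add: emeasure_lborel_box_eq emeasure_lborel_cbox_eq)
  then have "emeasure lborel (unit_cell :: (real ^ 'm) set) = 1"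
    using emeasure_mono[OF sub(1), of lborel] emeasure_mono[OF sub(2), of lborel] by auto
  then show ?thesis
    by (simp add: torus_def emeasure_restrict_space)
qed

lemma finite_measure_torus: "finite_measure (torus :: (real ^ 'm::finite) measure)"
  by standard (simp add: emeasure_torus_space)

definition wrap :: "real ^ 'm::finite \<Rightarrow> real ^ 'm \<Rightarrow> real ^ 'm" where
  "wrap a \<omega> = (\<chi> i. frac ((\<omega> + a) $ i))"

lemma torus_flow_eq_wrap: "torus_flow \<Lambda> x \<omega> = wrap (\<Lambda> *v x) \<omega>"
  by (simp add: torus_flow_def wrap_def)

lemma wrap_in_cell [simp]: "wrap a \<omega> \<in> unit_cell"
  by (simp add: wrap_def unit_cell_def frac_lt_1)

lemma wrap_cell: "\<omega> \<in> unit_cell \<Longrightarrow> wrap 0 \<omega> = \<omega>"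
  by (auto simp: wrap_def unit_cell_def vec_eq_iff frac_eq)

lemma borel_measurable_vec_nth [measurable (raw)]:
  fixes f :: "'a \<Rightarrow> ('b::topological_space) ^ 'n::finite"
  assumes "f \<in> borel_measurable M"
  shows "(\<lambda>x. f x $ i) \<in> borel_measurable M"
  using assms
  by (rule measurable_compose) (intro borel_measurable_continuous_onI continuous_intros)

lemma borel_measurable_vec_lambda:
  fixes f :: "'n::finite \<Rightarrow> 'a \<Rightarrow> 'b::euclidean_space"
  assumes "\<And>i. f i \<in> borel_measurable M"
  shows "(\<lambda>x. \<chi> i. f i x) \<in> borel_measurable M"
proof (subst borel_measurable_euclidean_space, intro ballI)
  fix b :: "'b ^ 'n" assume "b \<in> Basis"
  then obtain i u where "b = axis i u" by (auto simp: Basis_vec_def)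
  then have "(\<lambda>x. (\<chi> i. f i x) \<bullet> b) = (\<lambda>x. f i x \<bullet> u)" by (simp add: inner_axis)
  then show "(\<lambda>x. (\<chi> i. f i x) \<bullet> b) \<in> borel_measurable M"
    using assms by simp
qed

lemma measurable_wrap [measurable]: "wrap a \<in> borel_measurable borel"
proof -
  have "(\<lambda>\<omega>. frac ((\<omega> + a) $ i)) \<in> borel_measurable borel" for i
  proof -
    have [measurable]: "(\<lambda>x. (x + a) $ i) \<in> borel_measurable borel"
      by (intro borel_measurable_continuous_onI continuous_intros)
    show ?thesis unfolding frac_def by measurable
  qed
  then show ?thesis
    unfolding wrap_def [abs_def] by (intro borel_measurable_vec_lambda)
qed
lemma wrap_eq: "\<exists>k. wrap a \<omega> = \<omega> + a + real_vec k"
  by (rule exI[of _ "\<chi> i. - \<lfloor>(\<omega> + a) $ i\<rfloor>"]) (simp add: wrap_def real_vec_def vec_eq_iff frac_def)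

lemma wrap_add_real_vec: "wrap a (\<omega> + real_vec k) = wrap a \<omega>"
proof -
  have "frac (\<omega> $ i + of_int (k $ i) + a $ i) = frac (\<omega> $ i + a $ i)" for i
    using frac_add_of_int_right[of "\<omega> $ i + a $ i" "k $ i"] by (simp add: algebra_simps)
  then show ?thesis by (simp add: wrap_def real_vec_def vec_eq_iff)
qed

lemma wrap_wrap: "wrap a (wrap b \<omega>) = wrap (a + b) \<omega>"
proof -
  obtain k where "wrap b \<omega> = \<omega> + b + real_vec k" using wrap_eq by blast
  then have "wrap a (wrap b \<omega>) = wrap a (\<omega> + b)" by (simp add: wrap_add_real_vec)
  then show ?thesis by (simp add: wrap_def algebra_simps)
qed

lemma integer_translates_cover:
  fixes y :: "real ^ 'm::finite"
  shows "(\<integral>\<^sup>+k. indicator unit_cell (y + real_vec k) \<partial>count_space UNIV) = (1 :: ennreal)"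
    "(\<integral>\<^sup>+k. indicator unit_cell (y - real_vec k) \<partial>count_space UNIV) = (1 :: ennreal)"
proof -
  have floor: "0 \<le> t + of_int j \<and> t + of_int j < 1 \<longleftrightarrow> j = - \<lfloor>t\<rfloor>"
    "0 \<le> t - of_int j \<and> t - of_int j < 1 \<longleftrightarrow> j = \<lfloor>t\<rfloor>" for t :: real and j
    by (auto simp: floor_unique algebra_simps) linarith+
  have "indicator unit_cell (y + real_vec k) = (indicator {\<chi> i. - \<lfloor>y $ i\<rfloor>} k :: ennreal)" for k
    by (simp add: unit_cell_def real_vec_def indicator_def vec_eq_iff floor)
  moreover have "indicator unit_cell (y - real_vec k) = (indicator {\<chi> i. \<lfloor>y $ i\<rfloor>} k :: ennreal)" for k
    by (simp add: unit_cell_def real_vec_def indicator_def vec_eq_iff floor del: le_diff_eq diff_ge_0_iff_ge)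
  ultimately show "(\<integral>\<^sup>+k. indicator unit_cell (y + real_vec k) \<partial>count_space UNIV) = (1 :: ennreal)"
    "(\<integral>\<^sup>+k. indicator unit_cell (y - real_vec k) \<partial>count_space UNIV) = (1 :: ennreal)"
    by simp_all
qed

lemma nn_integral_lborel_translate:
  fixes g :: "'a::euclidean_space \<Rightarrow> ennreal"
  assumes "g \<in> borel_measurable borel"
  shows "(\<integral>\<^sup>+x. g (c + x) \<partial>lborel) = (\<integral>\<^sup>+x. g x \<partial>lborel)"
  by (subst (2) lborel_distr_plus[of c, symmetric]) (use assms in \<open>simp add: nn_integral_distr\<close>)

text \<open>
  The cell and any translate of it are fundamental domains for the integer lattice: the integral
  over the translated cell is cut along the integer translates of the cell, and the pieces are
  moved back.
\<close>

lemma nn_integral_wrap: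
  fixes g :: "real ^ 'm::finite \<Rightarrow> ennreal"
  assumes [measurable]: "g \<in> borel_measurable borel"
  shows "(\<integral>\<^sup>+\<omega>. g (wrap a \<omega>) \<partial>torus) = (\<integral>\<^sup>+\<omega>. g \<omega> \<partial>torus)"
proof -
  \<comment> \<open>The periodic extension from the cell.\<close>
  define p where "p = (\<lambda>\<omega>. g (wrap 0 \<omega>))"
  have [measurable]: "p \<in> borel_measurable borel" unfolding p_def by measurable
  have p_per: "p (x + real_vec k) = p x" for x k by (simp add: p_def wrap_add_real_vec)
  have p_shift: "p (a + \<omega>) = g (wrap a \<omega>)" for \<omega> by (simp add: p_def wrap_def add.commute)
  have "(\<integral>\<^sup>+\<omega>. g (wrap a \<omega>) \<partial>torus) = (\<integral>\<^sup>+x. p (a + x) * indicator unit_cell ((a + x) - a) \<partial>lborel)"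
    by (simp add: nn_integral_torus p_shift)
  also have "\<dots> = (\<integral>\<^sup>+x. p x * indicator unit_cell (x - a) \<partial>lborel)"
    by (rule nn_integral_lborel_translate) measurable
  also have "\<dots> = (\<integral>\<^sup>+x. \<integral>\<^sup>+k. p x * indicator unit_cell (x - a) * indicator unit_cell (x - real_vec k) \<partial>count_space UNIV \<partial>lborel)"
    by (simp add: nn_integral_cmult integer_translates_cover)
  also have "\<dots> = (\<integral>\<^sup>+k. \<integral>\<^sup>+x. p x * indicator unit_cell (x - a) * indicator unit_cell (x - real_vec k) \<partial>lborel \<partial>count_space UNIV)"
    by (rule nn_integral_count_space_nn_integral) auto
  also have "\<dots> = (\<integral>\<^sup>+k. \<integral>\<^sup>+x. p (real_vec k + x) * indicator unit_cell (real_vec k + x - a) * indicator unit_cell (real_vec k + x - real_vec k) \<partial>lborel \<partial>count_space UNIV)"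
    by (rule nn_integral_cong, rule nn_integral_lborel_translate[symmetric]) measurable
  also have "\<dots> = (\<integral>\<^sup>+k. \<integral>\<^sup>+x. p x * indicator unit_cell x * indicator unit_cell ((x - a) + real_vec k) \<partial>lborel \<partial>count_space UNIV)"
    using p_per by (intro nn_integral_cong) (simp add: algebra_simps)
  also have "\<dots> = (\<integral>\<^sup>+x. \<integral>\<^sup>+k. p x * indicator unit_cell x * indicator unit_cell ((x - a) + real_vec k) \<partial>count_space UNIV \<partial>lborel)"
    by (rule nn_integral_count_space_nn_integral[symmetric]) auto
  also have "\<dots> = (\<integral>\<^sup>+x. p x * indicator unit_cell x \<partial>lborel)"
    by (simp add: nn_integral_cmult integer_translates_cover)
  also have "\<dots> = (\<integral>\<^sup>+x. g x * indicator unit_cell x \<partial>lborel)"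
    by (intro nn_integral_cong) (auto simp: p_def wrap_cell indicator_def)
  finally show ?thesis by (simp add: nn_integral_torus)
qed

lemma distr_wrap: "distr torus borel (wrap a) = distr torus borel (\<lambda>\<omega>. \<omega>)"
proof (rule measure_eqI)
  fix A assume "A \<in> sets (distr torus borel (wrap a))"
  then have [measurable]: "A \<in> sets borel" by simp
  have [measurable]: "wrap a \<in> measurable torus borel" "(\<lambda>\<omega>. \<omega>) \<in> measurable torus borel"
    by (intro measurable_torusI; simp)+
  have "emeasure (distr torus borel (wrap a)) A = (\<integral>\<^sup>+\<omega>. indicator A \<omega> \<partial>distr torus borel (wrap a))"
    by simp
  also have "\<dots> = (\<integral>\<^sup>+\<omega>. indicator A (wrap a \<omega>) \<partial>torus)"
    by (subst nn_integral_distr) simp_all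
  also have "\<dots> = (\<integral>\<^sup>+\<omega>. indicator A \<omega> \<partial>torus)"
    by (rule nn_integral_wrap) measurable
  also have "\<dots> = (\<integral>\<^sup>+\<omega>. indicator A \<omega> \<partial>distr torus borel (\<lambda>\<omega>. \<omega>))"
    by (subst nn_integral_distr) (auto intro!: measurable_torusI)
  also have "\<dots> = emeasure (distr torus borel (\<lambda>\<omega>. \<omega>)) A"
    by simp
  finally show "emeasure (distr torus borel (wrap a)) A = emeasure (distr torus borel (\<lambda>\<omega>. \<omega>)) A" .
qed simp

lemma integral_wrap:
  fixes g :: "real ^ 'm::finite \<Rightarrow> complex"
  assumes [measurable]: "g \<in> borel_measurable borel"
  shows "(LINT \<omega>|torus. g (wrap a \<omega>)) = (LINT \<omega>|torus. g \<omega>)"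
proof -
  have [measurable]: "wrap a \<in> measurable torus borel" "(\<lambda>\<omega>. \<omega>) \<in> measurable torus borel"
    by (intro measurable_torusI; simp)+
  show ?thesis
    using arg_cong[OF distr_wrap, of "\<lambda>M. integral\<^sup>L M g" a] by (simp add: integral_distr)
qed

lemma AE_wrap:
  assumes "AE \<omega> in torus. P \<omega>"
  shows "AE \<omega> in torus. P (wrap a \<omega>)"
proof -
  obtain N where N: "{\<omega> \<in> space lborel. \<not> (\<omega> \<in> unit_cell \<longrightarrow> P \<omega>)} \<subseteq> N" "emeasure lborel N = 0" "N \<in> sets lborel"
    using assms unfolding AE_torus_iff by (rule AE_E)
  have [measurable]: "N \<in> sets borel" using N by simp
  have [measurable]: "wrap a \<in> measurable torus borel" by (intro measurable_torusI; simp)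
  have "(\<integral>\<^sup>+\<omega>. indicator N (wrap a \<omega>) \<partial>torus) = (\<integral>\<^sup>+\<omega>. indicator N \<omega> * indicator unit_cell \<omega> \<partial>lborel)"
    by (simp add: nn_integral_wrap) (simp add: nn_integral_torus)
  also have "\<dots> \<le> (\<integral>\<^sup>+\<omega>. indicator N \<omega> \<partial>lborel)"
    by (intro nn_integral_mono) (auto simp: indicator_def)
  also have "\<dots> = 0" using N by simp
  finally have "AE \<omega> in torus. indicator N (wrap a \<omega>) = (0::ennreal)"
    by (subst (asm) le_zero_eq, subst (asm) nn_integral_0_iff_AE) auto
  then show ?thesis
  proof eventually_elim
    case (elim \<omega>)
    then have "wrap a \<omega> \<notin> N" by (simp add: indicator_def split: if_splits)
    moreover have "wrap a \<omega> \<in> unit_cell" by simp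
    ultimately show ?case using N(1) by fastforce
  qed
qed

lemma continuous_torus_char [continuous_intros]: "continuous_on S (torus_char k)"
  unfolding torus_char_def [abs_def] by (intro continuous_intros)

lemma measurable_torus_char [measurable]: "torus_char k \<in> borel_measurable borel"
  by (intro borel_measurable_continuous_onI continuous_torus_char)

lemma norm_torus_char [simp]: "cmod (torus_char k \<omega>) = 1"
  by (simp add: torus_char_def norm_exp_eq_Re)

lemma torus_char_0 [simp]: "torus_char 0 \<omega> = 1"
  by (simp add: torus_char_def real_vec_def inner_vec_def)

lemma torus_char_add: "torus_char k (x + y) = torus_char k x * torus_char k y"
  by (simp add: torus_char_def inner_add_right algebra_simps exp_add)

lemma real_vec_add: "real_vec (j + k) = real_vec j + real_vec k"
  and real_vec_minus: "real_vec (- k) = - real_vec k"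
  by (simp_all add: real_vec_def vec_eq_iff)

lemma torus_char_add_index: "torus_char (j + k) x = torus_char j x * torus_char k x"
  by (simp add: torus_char_def real_vec_add inner_add_left algebra_simps exp_add)

lemma cnj_torus_char: "cnj (torus_char k x) = torus_char (- k) x"
  by (simp add: torus_char_def real_vec_minus exp_cnj)

lemma torus_char_real_vec [simp]: "torus_char k (real_vec j) = 1"
proof -
  have "real_vec k \<bullet> real_vec j = of_int (\<Sum>i\<in>UNIV. k $ i * j $ i)"
    by (simp add: real_vec_def inner_vec_def)
  moreover have "exp (2 * of_real pi * \<i> * of_real (of_int j)) = 1" for j
    using exp_integer_2pi[of "of_int j"] by (simp add: mult_ac)
  ultimately show ?thesis
    by (simp only: torus_char_def)
qed

lemma torus_char_wrap: "torus_char k (wrap a \<omega>) = torus_char k a * torus_char k \<omega>"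
proof -
  obtain j where "wrap a \<omega> = \<omega> + a + real_vec j" using wrap_eq by blast
  then show ?thesis by (simp add: torus_char_add)
qed

lemma integral_torus_char:
  "(LINT \<omega>|torus. torus_char k \<omega>) = (if k = 0 then 1 else 0)"
proof (cases "k = 0")
  case True
  then show ?thesis
    by (simp add: measure_def emeasure_torus_space)
next
  case False
  then obtain i where i: "k $ i \<noteq> 0" by (auto simp: vec_eq_iff)
  \<comment> \<open>Translation by this half period changes the sign of the character but not its integral.\<close>
  define a :: "real ^ 'a" where "a = axis i (1 / (2 * of_int (k $ i)))"
  have half: "real_vec k \<bullet> a = 1 / 2"
    using i by (simp add: a_def inner_axis real_vec_def)
  have "2 * of_real pi * \<i> * of_real (real_vec k \<bullet> a) = of_real pi * \<i>"
    unfolding half by simp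
  then have a: "torus_char k a = -1"
    by (simp only: torus_char_def exp_pi_i)
  have "(LINT \<omega>|torus. torus_char k \<omega>) = (LINT \<omega>|torus. torus_char k (wrap a \<omega>))"
    by (rule integral_wrap[symmetric]) measurable
  also have "\<dots> = - (LINT \<omega>|torus. torus_char k \<omega>)"
    by (simp add: torus_char_wrap a)
  finally show ?thesis using False by simp
qed

section \<open>Functions with vanishing polynomial moments\<close>

text \<open>
  Inner regularity: up to a null set the set where \<open>v > 0\<close> is a countable union of
  compact sets, and each of them is null because the integral of \<open>v\<close> over it
  vanishes.
\<close>

lemma AE_nonpos_of_compact_integrals:
  fixes v :: "'a::euclidean_space \<Rightarrow> real"
  assumes A: "A \<in> sets lebesgue" and v: "integrable (lebesgue_on A) v"
    and zero: "\<And>K. compact K \<Longrightarrow> K \<subseteq> A \<Longrightarrow> (LINT x|lebesgue_on A. indicator K x * v x) = 0"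
  shows "AE x in lebesgue_on A. v x \<le> 0"
proof -
  have "{x \<in> space (lebesgue_on A). 0 < v x} \<in> sets (lebesgue_on A)"
    using v by measurable
  then have "{x \<in> A. 0 < v x} \<in> sets lebesgue"
    using A by (auto simp: sets_restrict_space_iff)
  then obtain N C where N: "negligible N" and C: "\<And>n::nat. compact (C n)" and eq: "{x \<in> A. 0 < v x} = (\<Union>n. C n) \<union> N"
    using lebesgue_regular_inner by metis
  have "AE x in lebesgue_on A. x \<notin> C n" for n
  proof -
    have sub: "C n \<subseteq> {x \<in> A. 0 < v x}" using eq by auto
    have Cm: "C n \<in> sets (lebesgue_on A)"
      using sub C[of n] A by (auto simp: sets_restrict_space_iff lmeasurable_compact fmeasurableD)
    have int: "integrable (lebesgue_on A) (\<lambda>x. indicator (C n) x * v x)"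
      using integrable_mult_indicator[OF Cm v] by simp
    have nn: "0 \<le> indicator (C n) x * v x" for x
      using sub by (cases "x \<in> C n") (auto simp: less_imp_le)
    have "AE x in lebesgue_on A. indicator (C n) x * v x = 0"
      using zero[of "C n"] C[of n] sub integral_nonneg_eq_0_iff_AE[OF int] nn by fastforce
    then show ?thesis
      by eventually_elim (use sub in \<open>auto simp: indicator_def split: if_splits\<close>)
  qed
  then have "AE x in lebesgue_on A. \<forall>n. x \<notin> C n" by (simp add: AE_all_countable)
  moreover have "AE x in lebesgue_on A. x \<notin> N"
  proof -
    have "AE x in lebesgue. x \<notin> N"
      using N by (simp add: negligible_iff_null_sets AE_not_in)
    then show ?thesis using A by (subst AE_restrict_space_iff) auto
  qed
  moreover have "AE x in lebesgue_on A. x \<in> A" using A by (simp add: AE_restrict_space_iff)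
  ultimately show ?thesis
    by eventually_elim (use eq in \<open>fastforce simp: not_less[symmetric]\<close>)
qed

lemma AE_zero_of_compact_integrals:
  fixes v :: "'a::euclidean_space \<Rightarrow> real"
  assumes A: "A \<in> sets lebesgue" and v: "integrable (lebesgue_on A) v"
    and zero: "\<And>K. compact K \<Longrightarrow> K \<subseteq> A \<Longrightarrow> (LINT x|lebesgue_on A. indicator K x * v x) = 0"
  shows "AE x in lebesgue_on A. v x = 0"
proof -
  have "AE x in lebesgue_on A. v x \<le> 0"
    by (rule AE_nonpos_of_compact_integrals[OF assms])
  moreover have "AE x in lebesgue_on A. - v x \<le> 0"
    by (rule AE_nonpos_of_compact_integrals[OF A]) (use v zero in simp_all)
  ultimately show ?thesis by eventually_elim simp
qed

text \<open>
  The indicator of a closed set is the bounded pointwise limit of continuous functions of the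
  distance to the set.
\<close>

lemma integral_closed_set_eq_0:
  fixes v :: "'a \<Rightarrow> real" and \<pi> :: "'a \<Rightarrow> 'b::metric_space"
  assumes v: "integrable M v" and \<pi> [measurable]: "\<pi> \<in> borel_measurable M"
    and zero: "\<And>f::'b \<Rightarrow> real. continuous_on UNIV f \<Longrightarrow> (LINT x|M. f (\<pi> x) * v x) = 0"
    and C: "closed C"
  shows "(LINT x|M. indicator C (\<pi> x) * v x) = 0"
proof (cases "C = {}")
  case False
  define f where "f = (\<lambda>(n::nat) y. max 0 (1 - of_nat n * infdist y C))"
  have cont: "continuous_on UNIV (f n)" for n
    unfolding f_def by (intro continuous_intros)
  have [measurable]: "f n \<in> borel_measurable borel" for n
    by (intro borel_measurable_continuous_onI cont)
  have [measurable]: "v \<in> borel_measurable M" using v by simp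
  have [measurable]: "C \<in> sets borel" using C by simp
  have f01: "0 \<le> f n y" "f n y \<le> 1" for n y
    by (auto simp: f_def infdist_nonneg)
  have lim: "(\<lambda>n. f n y) \<longlonglongrightarrow> indicator C y" for y
  proof (cases "y \<in> C")
    case True
    then show ?thesis by (simp add: f_def)
  next
    case ny: False
    then have pos: "infdist y C > 0"
      using C False in_closed_iff_infdist_zero infdist_nonneg by (metis less_eq_real_def)
    have "eventually (\<lambda>n. f n y = 0) sequentially"
    proof -
      obtain N :: nat where N: "1 < of_nat N * infdist y C"
        using pos ex_less_of_nat_mult by blast
      show ?thesis
      proof (rule eventually_sequentiallyI)
        fix n assume "N \<le> n"
        then have "of_nat N * infdist y C \<le> of_nat n * infdist y C"
          using pos by (intro mult_right_mono) auto
        then show "f n y = 0" using N by (simp add: f_def)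
      qed
    qed
    then show ?thesis using ny by (simp add: tendsto_eventually)
  qed
  have "(\<lambda>n. LINT x|M. f n (\<pi> x) * v x) \<longlonglongrightarrow> (LINT x|M. indicator C (\<pi> x) * v x)"
  proof (rule integral_dominated_convergence[where w="\<lambda>x. \<bar>v x\<bar>"])
    show "AE x in M. (\<lambda>n. f n (\<pi> x) * v x) \<longlonglongrightarrow> indicator C (\<pi> x) * v x"
      by (intro AE_I2 tendsto_mult lim tendsto_const)
    show "AE x in M. norm (f n (\<pi> x) * v x) \<le> \<bar>v x\<bar>" for n
      using f01 by (intro AE_I2) (simp add: abs_mult mult_left_le_one_le)
  qed (use v in auto)
  then show ?thesis using zero[OF cont] by (simp add: LIMSEQ_const_iff)
qed simp

text \<open>
  By Stone--Weierstrass a continuous function is uniformly within \<open>e\<close> of a polynomial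
  on \<open>S\<close>, so its integral against \<open>v\<close> is at most \<open>e\<close> times
  the integral of \<open>\<bar>v\<bar>\<close>, for every \<open>e > 0\<close>.
\<close>

lemma integral_continuous_eq_0:
  fixes v :: "'a \<Rightarrow> real" and \<pi> :: "'a \<Rightarrow> 'b::euclidean_space"
  assumes v: "integrable M v" and \<pi> [measurable]: "\<pi> \<in> borel_measurable M"
    and S: "compact S" and in_S: "\<And>x. x \<in> space M \<Longrightarrow> \<pi> x \<in> S"
    and zero: "\<And>p. real_polynomial_function p \<Longrightarrow> (LINT x|M. p (\<pi> x) * v x) = 0"
    and f: "continuous_on UNIV f"
  shows "(LINT x|M. f (\<pi> x) * v x) = 0"
proof (rule ccontr)
  have int: "integrable M (\<lambda>x. g (\<pi> x) * v x)" if g: "continuous_on UNIV g" for g :: "'b \<Rightarrow> real"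
  proof -
    have [measurable]: "g \<in> borel_measurable borel" by (intro borel_measurable_continuous_onI g)
    have gS: "continuous_on S g" using g by (rule continuous_on_subset) simp
    obtain B where B: "\<And>z. z \<in> S \<Longrightarrow> \<bar>g z\<bar> \<le> B"
      using compact_imp_bounded[OF compact_continuous_image[OF gS S]] by (auto simp: bounded_iff)
    show ?thesis
    proof (rule Bochner_Integration.integrable_bound)
      show "integrable M (\<lambda>x. B * v x)" using v by simp
      show "(\<lambda>x. g (\<pi> x) * v x) \<in> borel_measurable M" using v by measurable
      show "AE x in M. norm (g (\<pi> x) * v x) \<le> norm (B * v x)"
      proof (rule AE_I2)
        fix x assume "x \<in> space M"
        then have "\<bar>g (\<pi> x)\<bar> \<le> \<bar>B\<bar>" using B[OF in_S, of x] by linarith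
        then show "norm (g (\<pi> x) * v x) \<le> norm (B * v x)" by (simp add: abs_mult mult_right_mono)
      qed
    qed
  qed
  define I where "I = \<bar>LINT x|M. f (\<pi> x) * v x\<bar>"
  define J where "J = (LINT x|M. \<bar>v x\<bar>)"
  assume "\<not> ?thesis"
  then have "I > 0" by (simp add: I_def)
  have "J \<ge> 0" by (simp add: J_def)
  define e where "e = I / (2 * (J + 1))"
  have "e > 0" using \<open>I > 0\<close> \<open>J \<ge> 0\<close> by (simp add: e_def)
  have "continuous_on S f" using f by (rule continuous_on_subset) simp
  then obtain p where p: "real_polynomial_function p" "\<And>z. z \<in> S \<Longrightarrow> \<bar>f z - p z\<bar> < e"
    using Stone_Weierstrass_real_polynomial_function[OF S _ \<open>e > 0\<close>] by blast
  have int_p: "integrable M (\<lambda>x. p (\<pi> x) * v x)"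
    by (intro int continuous_on_polymonial_function) (use p(1) real_polynomial_function_eq in blast)
  have "(LINT x|M. f (\<pi> x) * v x) = (LINT x|M. f (\<pi> x) * v x - p (\<pi> x) * v x)"
    using int[OF f] int_p zero[OF p(1)] by simp
  then have "I \<le> (LINT x|M. \<bar>f (\<pi> x) * v x - p (\<pi> x) * v x\<bar>)"
    by (simp add: I_def integral_abs_bound)
  also have "\<dots> \<le> (LINT x|M. e * \<bar>v x\<bar>)"
  proof (rule Bochner_Integration.integral_mono)
    show "integrable M (\<lambda>x. \<bar>f (\<pi> x) * v x - p (\<pi> x) * v x\<bar>)" using int[OF f] int_p by simp
    show "integrable M (\<lambda>x. e * \<bar>v x\<bar>)" using v by simp
    fix x assume "x \<in> space M"
    have "\<bar>f (\<pi> x) * v x - p (\<pi> x) * v x\<bar> = \<bar>f (\<pi> x) - p (\<pi> x)\<bar> * \<bar>v x\<bar>"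
      by (simp add: abs_mult[symmetric] algebra_simps)
    also have "\<dots> \<le> e * \<bar>v x\<bar>"
      using p(2)[OF in_S[OF \<open>x \<in> space M\<close>]] by (intro mult_right_mono) auto
    finally show "\<bar>f (\<pi> x) * v x - p (\<pi> x) * v x\<bar> \<le> e * \<bar>v x\<bar>" .
  qed
  also have "\<dots> = e * J" by (simp add: J_def)
  also have "\<dots> < I"
  proof -
    have "0 \<le> I * J" using \<open>I > 0\<close> \<open>J \<ge> 0\<close> by simp
    then have "0 < I * J + I * 2" using \<open>I > 0\<close> by linarith
    then show ?thesis using \<open>J \<ge> 0\<close> by (simp add: e_def field_simps)
  qed
  finally show False by simp
qed

text \<open>
  A compact subset of \<open>A\<close> is the preimage of a compact set under the injective map
  \<open>\<pi>\<close>, so the polynomial moments determine the integrals of \<open>v\<close> over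
  all compact sets. The criterion serves twice: with \<open>\<pi>\<close> the embedding of the
  torus into complex space it gives the uniqueness of Fourier coefficients, and with
  \<open>\<pi>\<close> the identity it gives the fundamental lemma of the calculus of variations.
\<close>

lemma AE_zero_of_polynomial_moments:
  fixes v :: "'a::euclidean_space \<Rightarrow> real" and \<pi> :: "'a \<Rightarrow> 'b::euclidean_space"
  assumes A: "A \<in> sets lebesgue" and v: "integrable (lebesgue_on A) v"
    and \<pi>: "continuous_on UNIV \<pi>" "inj_on \<pi> A" "bounded (\<pi> ` A)"
    and zero: "\<And>p. real_polynomial_function p \<Longrightarrow> (LINT x|lebesgue_on A. p (\<pi> x) * v x) = 0"
  shows "AE x in lebesgue_on A. v x = 0"
proof (rule AE_zero_of_compact_integrals[OF A v])
  fix K assume K: "compact K" "K \<subseteq> A"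
  have "\<pi> \<in> borel_measurable borel" by (intro borel_measurable_continuous_onI \<pi>)
  then have \<pi>_meas: "\<pi> \<in> borel_measurable (lebesgue_on A)"
    by (intro measurable_restrict_space1 measurable_completion) simp
  have S: "compact (closure (\<pi> ` A))" using \<pi>(3) by (simp add: compact_closure)
  have in_S: "\<pi> x \<in> closure (\<pi> ` A)" if "x \<in> space (lebesgue_on A)" for x
    using that A closure_subset by fastforce
  have "closed (\<pi> ` K)"
    by (intro compact_imp_closed compact_continuous_image continuous_on_subset[OF \<pi>(1)] K) simp
  moreover have "(LINT x|lebesgue_on A. f (\<pi> x) * v x) = 0" if "continuous_on UNIV f" for f
    using v \<pi>_meas S in_S zero that by (rule integral_continuous_eq_0)
  ultimately have "(LINT x|lebesgue_on A. indicator (\<pi> ` K) (\<pi> x) * v x) = 0"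
    using integral_closed_set_eq_0[OF v \<pi>_meas] by blast
  also have "(LINT x|lebesgue_on A. indicator (\<pi> ` K) (\<pi> x) * v x) = (LINT x|lebesgue_on A. indicator K x * v x)"
    using K(2) A by (intro Bochner_Integration.integral_cong refl)
      (auto simp: indicator_def dest!: inj_onD[OF \<pi>(2)])
  finally show "(LINT x|lebesgue_on A. indicator K x * v x) = 0" .
qed

section \<open>Uniqueness of Fourier coefficients\<close>

text \<open>
  Gluing opposite faces of the cell: continuous functions of \<open>torus_embed \<omega>\<close>
  are continuous periodic functions of \<open>\<omega>\<close>.
\<close>

definition torus_embed :: "real ^ 'm::finite \<Rightarrow> complex ^ 'm" where
  "torus_embed \<omega> = (\<chi> i. torus_char (axis i 1) \<omega>)"

lemma continuous_torus_embed: "continuous_on S torus_embed"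
  unfolding torus_embed_def [abs_def] by (intro continuous_intros)

lemma torus_char_axis: "torus_char (axis i 1) \<omega> = cis (2 * pi * \<omega> $ i)"
proof -
  have "real_vec (axis i 1) \<bullet> \<omega> = \<omega> $ i"
    by (simp add: real_vec_def inner_vec_def axis_def if_distrib[of "\<lambda>x. real_of_int x"] if_distrib[of "\<lambda>x. x * _"] cong: if_cong)
  then show ?thesis by (simp add: torus_char_def cis_conv_exp mult_ac)
qed

lemma inj_on_torus_embed: "inj_on torus_embed (unit_cell :: (real ^ 'm::finite) set)"
proof (rule inj_onI)
  fix x y :: "real ^ 'm" assume xy: "x \<in> unit_cell" "y \<in> unit_cell" "torus_embed x = torus_embed y"
  have "x $ i = y $ i" for i
  proof -
    have "cis (2 * pi * x $ i) = cis (2 * pi * y $ i)"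
      using xy(3) by (simp add: torus_embed_def vec_eq_iff torus_char_axis)
    then obtain n :: int where "2 * pi * x $ i = 2 * pi * y $ i + 2 * pi * n"
      unfolding cis_conv_exp exp_eq by (auto simp: complex_eq_iff algebra_simps)
    then have "2 * pi * (x $ i) = 2 * pi * (y $ i + n)" by (simp add: algebra_simps)
    then have n: "x $ i = y $ i + n" by simp
    moreover have "0 \<le> x $ i" "x $ i < 1" "0 \<le> y $ i" "y $ i < 1"
      using xy by (auto simp: unit_cell_def)
    ultimately have "of_int n < (1::real)" "of_int n > (-1::real)" by linarith+
    then have "n = 0" by linarith
    then show ?thesis using n by simp
  qed
  then show "x = y" by (simp add: vec_eq_iff)
qed

lemma bounded_range_torus_embed: "bounded (range (torus_embed :: real ^ 'm::finite \<Rightarrow> _))"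
proof (rule boundedI)
  fix z :: "complex ^ 'm" assume "z \<in> range torus_embed"
  then have "norm (z $ i) = 1" for i by (auto simp: torus_embed_def)
  then show "norm z \<le> real CARD('m)"
    unfolding norm_vec_def using L2_set_le_sum[of UNIV "\<lambda>i. norm (z $ i)"] by simp
qed

definition zero_coeffs :: "(real ^ 'm::finite \<Rightarrow> complex) \<Rightarrow> bool" where
  "zero_coeffs h \<longleftrightarrow> integrable torus h \<and> (\<forall>k. fourier_coeff h k = 0)"

lemma integrable_mult_torus_char:
  assumes "integrable torus h"
  shows "integrable torus (\<lambda>\<omega>. h \<omega> * torus_char k \<omega>)"
proof (rule Bochner_Integration.integrable_bound[OF assms])
  have [measurable]: "torus_char k \<in> borel_measurable torus" "h \<in> borel_measurable torus"
    using assms by (auto intro: measurable_torusI)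
  show "(\<lambda>\<omega>. h \<omega> * torus_char k \<omega>) \<in> borel_measurable torus" by measurable
qed (simp add: norm_mult)

lemma integrable_mult_cnj_torus_char:
  assumes "integrable torus h"
  shows "integrable torus (\<lambda>\<omega>. h \<omega> * cnj (torus_char k \<omega>))"
  by (simp only: cnj_torus_char integrable_mult_torus_char[OF assms])

lemma fourier_coeff_add:
  "integrable torus f \<Longrightarrow> integrable torus g \<Longrightarrow>
    fourier_coeff (\<lambda>\<omega>. f \<omega> + g \<omega>) k = fourier_coeff f k + fourier_coeff g k"
  by (simp add: fourier_coeff_def distrib_right integrable_mult_cnj_torus_char)

lemma fourier_coeff_diff:
  "integrable torus f \<Longrightarrow> integrable torus g \<Longrightarrow>
    fourier_coeff (\<lambda>\<omega>. f \<omega> - g \<omega>) k = fourier_coeff f k - fourier_coeff g k"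
  by (simp add: fourier_coeff_def left_diff_distrib integrable_mult_cnj_torus_char)

lemma fourier_coeff_cmult:
  "fourier_coeff (\<lambda>\<omega>. c * f \<omega>) k = c * fourier_coeff f k"
  by (simp add: fourier_coeff_def mult.assoc)

lemma fourier_coeff_mult_torus_char:
  "fourier_coeff (\<lambda>\<omega>. f \<omega> * torus_char j \<omega>) k = fourier_coeff f (k - j)"
proof -
  have "torus_char j \<omega> * cnj (torus_char k \<omega>) = cnj (torus_char (k - j) \<omega>)" for \<omega>
    by (simp add: cnj_torus_char torus_char_add_index[symmetric])
  then show ?thesis by (simp add: fourier_coeff_def mult.assoc)
qed

lemma zero_coeffs_add: "zero_coeffs f \<Longrightarrow> zero_coeffs g \<Longrightarrow> zero_coeffs (\<lambda>\<omega>. f \<omega> + g \<omega>)"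
  by (simp add: zero_coeffs_def fourier_coeff_add)

lemma zero_coeffs_cmult: "zero_coeffs f \<Longrightarrow> zero_coeffs (\<lambda>\<omega>. c * f \<omega>)"
  by (simp add: zero_coeffs_def fourier_coeff_cmult)

lemma zero_coeffs_sum:
  "finite I \<Longrightarrow> (\<And>i. i \<in> I \<Longrightarrow> zero_coeffs (f i)) \<Longrightarrow> zero_coeffs (\<lambda>\<omega>. \<Sum>i\<in>I. f i \<omega>)"
proof (induction I rule: finite_induct)
  case empty
  then show ?case by (simp add: zero_coeffs_def fourier_coeff_def)
next
  case (insert x F)
  then show ?case by (simp add: zero_coeffs_add)
qed

lemma zero_coeffs_mult_torus_char:
  "zero_coeffs f \<Longrightarrow> zero_coeffs (\<lambda>\<omega>. f \<omega> * torus_char k \<omega>)"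
  by (simp add: zero_coeffs_def fourier_coeff_mult_torus_char integrable_mult_torus_char)

text \<open>
  Multiplication by a coordinate of \<open>torus_embed\<close> or by its conjugate shifts the
  Fourier coefficients, so the functions without Fourier coefficients form a module over the real
  polynomials in these coordinates.
\<close>

lemma zero_coeffs_polynomial:
  fixes h :: "real ^ 'm::finite \<Rightarrow> complex"
  assumes "real_polynomial_function p" "zero_coeffs h"
  shows "zero_coeffs (\<lambda>\<omega>. of_real (p (torus_embed \<omega>)) * h \<omega>)"
  using assms
proof (induction arbitrary: h)
  case (linear p)
  note h = \<open>zero_coeffs h\<close>
  interpret bounded_linear p by fact
  define a b where "a = (\<lambda>i. p (axis i 1))" and "b = (\<lambda>i. p (axis i \<i>))"
  have p_eq: "p z = (\<Sum>i\<in>UNIV. Re (z $ i) * a i + Im (z $ i) * b i)" for z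
  proof -
    have "z = (\<Sum>i\<in>UNIV. Re (z $ i) *\<^sub>R axis i 1 + Im (z $ i) *\<^sub>R axis i \<i>)"
      by (simp add: vec_eq_iff axis_def complex_eq_iff if_distrib[of Re] if_distrib[of Im] if_distrib[of "\<lambda>x. _ * x"] sum.distrib cong: if_cong)
    then have "p z = p (\<Sum>i\<in>UNIV. Re (z $ i) *\<^sub>R axis i 1 + Im (z $ i) *\<^sub>R axis i \<i>)" by simp
    also have "\<dots> = (\<Sum>i\<in>UNIV. Re (z $ i) * a i + Im (z $ i) * b i)"
      by (simp add: sum add scale a_def b_def)
    finally show ?thesis .
  qed
  have "of_real (p (torus_embed \<omega>)) * h \<omega> =
      (\<Sum>i\<in>UNIV. (of_real (a i / 2) - \<i> * of_real (b i / 2)) * (h \<omega> * torus_char (axis i 1) \<omega>)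
        + (of_real (a i / 2) + \<i> * of_real (b i / 2)) * (h \<omega> * torus_char (- axis i 1) \<omega>))" for \<omega>
  proof -
    have *: "of_real (Re c * s + Im c * t) = (of_real (s / 2) - \<i> * of_real (t / 2)) * c + (of_real (s / 2) + \<i> * of_real (t / 2)) * cnj c"
      for c s t by (simp add: complex_eq_iff algebra_simps)
    show ?thesis
      unfolding p_eq of_real_sum sum_distrib_right
      by (intro sum.cong refl, subst *) (simp add: torus_embed_def cnj_torus_char algebra_simps)
  qed
  then show ?case
    by (simp only:) (intro zero_coeffs_sum zero_coeffs_add zero_coeffs_cmult zero_coeffs_mult_torus_char h finite)
next
  case (const c)
  then show ?case by (rule zero_coeffs_cmult)
next
  case (add f g)
  then show ?case using zero_coeffs_add[OF add.IH(1)[OF add.prems] add.IH(2)[OF add.prems]]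
    by (simp add: algebra_simps)
next
  case (mult f g)
  then show ?case using mult.IH(1)[OF mult.IH(2)[OF mult.prems]] by (simp add: mult.assoc)
qed

text \<open>
  The polynomial moments of \<open>h\<close> are zeroth Fourier coefficients of the products in
  \<open>zero_coeffs_polynomial\<close>.
\<close>

lemma fourier_uniqueness:
  fixes h :: "real ^ 'm::finite \<Rightarrow> complex"
  assumes h: "zero_coeffs h"
  shows "AE \<omega> in torus. h \<omega> = 0"
proof -
  have int_h: "integrable torus h" using h by (simp add: zero_coeffs_def)
  have moments: "integrable torus (\<lambda>\<omega>. of_real (p (torus_embed \<omega>)) * h \<omega>)"
    "(LINT \<omega>|torus. of_real (p (torus_embed \<omega>)) * h \<omega>) = 0" if "real_polynomial_function p" for p
  proof -
    have "zero_coeffs (\<lambda>\<omega>. of_real (p (torus_embed \<omega>)) * h \<omega>)"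
      by (rule zero_coeffs_polynomial[OF that h])
    then have "integrable torus (\<lambda>\<omega>. of_real (p (torus_embed \<omega>)) * h \<omega>)"
      "fourier_coeff (\<lambda>\<omega>. of_real (p (torus_embed \<omega>)) * h \<omega>) 0 = 0"
      by (simp_all add: zero_coeffs_def)
    then show "integrable torus (\<lambda>\<omega>. of_real (p (torus_embed \<omega>)) * h \<omega>)"
      "(LINT \<omega>|torus. of_real (p (torus_embed \<omega>)) * h \<omega>) = 0"
      by (simp_all add: fourier_coeff_def)
  qed
  have "bounded (torus_embed ` (unit_cell :: (real ^ 'm) set))"
    by (rule bounded_subset[OF bounded_range_torus_embed]) auto
  note AE_zero = AE_zero_of_polynomial_moments[OF sets_lebesgue_unit_cell _ continuous_torus_embed inj_on_torus_embed this, folded torus_def]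
  have "AE \<omega> in torus. Re (h \<omega>) = 0"
  proof (rule AE_zero)
    fix p :: "complex ^ 'm \<Rightarrow> real" assume p: "real_polynomial_function p"
    show "(LINT \<omega>|torus. p (torus_embed \<omega>) * Re (h \<omega>)) = 0"
      using integral_Re[OF moments(1)[OF p]] moments(2)[OF p] by simp
  qed (use int_h in simp)
  moreover have "AE \<omega> in torus. Im (h \<omega>) = 0"
  proof (rule AE_zero)
    fix p :: "complex ^ 'm \<Rightarrow> real" assume p: "real_polynomial_function p"
    show "(LINT \<omega>|torus. p (torus_embed \<omega>) * Im (h \<omega>)) = 0"
      using integral_Im[OF moments(1)[OF p]] moments(2)[OF p] by simp
  qed (use int_h in simp)
  ultimately show ?thesis by eventually_elim (simp add: complex_eq_iff)
qed

section \<open>Square-integrable functions on the torus\<close>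

text \<open>
  The square of \<open>L2_norm\<close>, which unlike the norm itself is an integral.
\<close>

definition sq_norm :: "(real ^ 'm::finite \<Rightarrow> complex) \<Rightarrow> ennreal" where
  "sq_norm h = (\<integral>\<^sup>+\<omega>. ennreal ((cmod (h \<omega>))\<^sup>2) \<partial>torus)"

lemma ennreal_sqrt_less_top: "ennreal_sqrt x < \<infinity> \<longleftrightarrow> x < \<infinity>"
  by (simp add: ennreal_sqrt_def less_top[symmetric])

lemma ennreal_sqrt_le_iff: "0 \<le> C \<Longrightarrow> ennreal_sqrt x \<le> ennreal C \<longleftrightarrow> x \<le> ennreal (C\<^sup>2)"
proof (cases x)
  case (real r)
  assume "0 \<le> C"
  then show ?thesis
    using real real_sqrt_le_iff[of r "C\<^sup>2"] by (simp add: ennreal_sqrt_def)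
qed (simp add: ennreal_sqrt_def top_unique)

lemma tendsto_ennreal_0I:
  fixes x :: "'a \<Rightarrow> ennreal"
  assumes "\<And>e::real. e > 0 \<Longrightarrow> eventually (\<lambda>i. x i < ennreal e) F"
  shows "(x \<longlongrightarrow> 0) F"
proof (rule order_tendstoI)
  fix a :: ennreal assume "0 < a"
  then obtain b where b: "0 < b" "b < a" using dense by blast
  obtain e where "e > 0" "ennreal e < a"
  proof (cases b)
    case (real r)
    then show ?thesis using that[of r] b by (simp add: less_le)
  qed (use b in auto)
  then show "eventually (\<lambda>i. x i < a) F"
    by (intro eventually_mono[OF assms[OF \<open>e > 0\<close>]]) (auto intro: less_trans)
qed simp

lemma tendsto_ennreal_sqrt_0:
  assumes "(x \<longlongrightarrow> 0) F"
  shows "((\<lambda>i. ennreal_sqrt (x i)) \<longlongrightarrow> 0) F"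
proof (rule tendsto_ennreal_0I)
  fix e :: real assume "e > 0"
  then have "eventually (\<lambda>i. x i < ennreal ((e/2)\<^sup>2)) F"
    using assms by (intro order_tendstoD) auto
  then show "eventually (\<lambda>i. ennreal_sqrt (x i) < ennreal e) F"
  proof eventually_elim
    case (elim i)
    then have "ennreal_sqrt (x i) \<le> ennreal (e/2)"
      using \<open>e > 0\<close> by (subst ennreal_sqrt_le_iff) auto
    also have "\<dots> < ennreal e" using \<open>e > 0\<close> by (simp add: ennreal_lessI)
    finally show ?case .
  qed
qed

lemma L2_torus_iff: "h \<in> L2_torus \<longleftrightarrow> h \<in> borel_measurable torus \<and> sq_norm h < \<infinity>"
  unfolding L2_torus_def L2_norm_def sq_norm_def ennreal_sqrt_less_top by simp

lemma L2_torus_measurable [measurable_dest]: "h \<in> L2_torus \<Longrightarrow> h \<in> borel_measurable torus"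
  by (simp add: L2_torus_iff)

lemma L2_torus_integrable_sq:
  assumes "h \<in> L2_torus"
  shows "integrable torus (\<lambda>\<omega>. (cmod (h \<omega>))\<^sup>2)"
  using assms by (intro integrableI_nonneg) (auto simp: L2_torus_iff sq_norm_def)

lemma sq_norm_eq:
  "h \<in> L2_torus \<Longrightarrow> sq_norm h = ennreal (LINT \<omega>|torus. (cmod (h \<omega>))\<^sup>2)"
  unfolding sq_norm_def by (intro nn_integral_eq_integral L2_torus_integrable_sq) auto

lemma L2_torus_integrable_mult:
  assumes "f \<in> L2_torus" "g \<in> L2_torus"
  shows "integrable torus (\<lambda>\<omega>. f \<omega> * g \<omega>)"
proof (rule Bochner_Integration.integrable_bound)
  show "integrable torus (\<lambda>\<omega>. (cmod (f \<omega>))\<^sup>2 + (cmod (g \<omega>))\<^sup>2)"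
    using assms by (simp add: L2_torus_integrable_sq)
  show "(\<lambda>\<omega>. f \<omega> * g \<omega>) \<in> borel_measurable torus" using assms by measurable
  have "a * b \<le> a\<^sup>2 + b\<^sup>2" if "0 \<le> a" "0 \<le> b" for a b :: real
    using sum_squares_bound[of a b] mult_nonneg_nonneg[OF that] by linarith
  then show "AE \<omega> in torus. norm (f \<omega> * g \<omega>) \<le> norm ((cmod (f \<omega>))\<^sup>2 + (cmod (g \<omega>))\<^sup>2)"
    by (intro AE_I2) (simp add: norm_mult)
qed

lemma L2_torus_bounded:
  fixes h :: "real ^ 'm::finite \<Rightarrow> complex"
  assumes [measurable]: "h \<in> borel_measurable torus" and "\<And>\<omega>. cmod (h \<omega>) \<le> B"
  shows "h \<in> L2_torus"
proof -
  have "sq_norm h \<le> (\<integral>\<^sup>+\<omega>. ennreal (B\<^sup>2) \<partial>(torus :: (real ^ 'm) measure))"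
    unfolding sq_norm_def using assms(2) by (intro nn_integral_mono ennreal_leI power_mono) auto
  also have "\<dots> < \<infinity>" by (simp add: emeasure_torus_space)
  finally show ?thesis by (simp add: L2_torus_iff)
qed

lemma L2_torus_const: "(\<lambda>\<omega>. c) \<in> L2_torus"
  by (rule L2_torus_bounded[of _ "cmod c"]) auto

lemma L2_torus_integrable: "h \<in> L2_torus \<Longrightarrow> integrable torus h"
  using L2_torus_integrable_mult[OF _ L2_torus_const[of 1]] by simp

lemma L2_torus_cnj: "h \<in> L2_torus \<Longrightarrow> (\<lambda>\<omega>. cnj (h \<omega>)) \<in> L2_torus"
  using borel_measurable_continuous_onI[OF continuous_on_cnj[OF continuous_on_id]]
  by (auto simp: L2_torus_iff sq_norm_def intro: measurable_compose)

lemma cmod_diff_sq_le: "(cmod (a - b))\<^sup>2 \<le> 2 * (cmod a)\<^sup>2 + 2 * (cmod b)\<^sup>2"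
proof -
  have "(cmod (a - b))\<^sup>2 \<le> (cmod a + cmod b)\<^sup>2"
    by (intro power_mono norm_triangle_ineq4) auto
  also have "\<dots> \<le> 2 * (cmod a)\<^sup>2 + 2 * (cmod b)\<^sup>2"
    using sum_squares_bound[of "cmod a" "cmod b"] by (simp add: power2_sum)
  finally show ?thesis .
qed

lemma nn_integral_cmod_diff_sq_le:
  assumes [measurable]: "f \<in> borel_measurable M" "g \<in> borel_measurable M"
  shows "(\<integral>\<^sup>+x. ennreal ((cmod (f x - g x))\<^sup>2) \<partial>M)
    \<le> 2 * (\<integral>\<^sup>+x. ennreal ((cmod (f x))\<^sup>2) \<partial>M) + 2 * (\<integral>\<^sup>+x. ennreal ((cmod (g x))\<^sup>2) \<partial>M)"
proof -
  have "(\<integral>\<^sup>+x. ennreal ((cmod (f x - g x))\<^sup>2) \<partial>M) \<le> (\<integral>\<^sup>+x. 2 * ennreal ((cmod (f x))\<^sup>2) + 2 * ennreal ((cmod (g x))\<^sup>2) \<partial>M)"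
  proof (rule nn_integral_mono)
    fix x
    have "ennreal ((cmod (f x - g x))\<^sup>2) \<le> ennreal (2 * (cmod (f x))\<^sup>2 + 2 * (cmod (g x))\<^sup>2)"
      by (intro ennreal_leI cmod_diff_sq_le)
    then show "ennreal ((cmod (f x - g x))\<^sup>2) \<le> 2 * ennreal ((cmod (f x))\<^sup>2) + 2 * ennreal ((cmod (g x))\<^sup>2)"
      by (simp add: ennreal_plus ennreal_mult)
  qed
  also have "\<dots> = 2 * (\<integral>\<^sup>+x. ennreal ((cmod (f x))\<^sup>2) \<partial>M) + 2 * (\<integral>\<^sup>+x. ennreal ((cmod (g x))\<^sup>2) \<partial>M)"
    by (simp add: nn_integral_add nn_integral_cmult)
  finally show ?thesis .
qed

lemma L2_torus_diff:
  assumes "f \<in> L2_torus" "g \<in> L2_torus"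
  shows "(\<lambda>\<omega>. f \<omega> - g \<omega>) \<in> L2_torus"
proof -
  have [measurable]: "f \<in> borel_measurable torus" "g \<in> borel_measurable torus" using assms by measurable
  have "sq_norm (\<lambda>\<omega>. f \<omega> - g \<omega>) \<le> 2 * sq_norm f + 2 * sq_norm g"
    unfolding sq_norm_def by (rule nn_integral_cmod_diff_sq_le) measurable
  also have "\<dots> < \<infinity>" using assms by (simp add: L2_torus_iff ennreal_mult_less_top)
  finally show ?thesis by (simp add: L2_torus_iff)
qed

section \<open>Trigonometric polynomials\<close>

definition trig_poly :: "(int ^ 'm::finite) set \<Rightarrow> (int ^ 'm \<Rightarrow> complex) \<Rightarrow> real ^ 'm \<Rightarrow> complex" where
  "trig_poly F c \<omega> = (\<Sum>k\<in>F. c k * torus_char k \<omega>)"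

lemma measurable_trig_poly [measurable]: "trig_poly F c \<in> borel_measurable borel"
  unfolding trig_poly_def [abs_def] by measurable

lemma norm_trig_poly_le: "cmod (trig_poly F c \<omega>) \<le> (\<Sum>k\<in>F. cmod (c k))"
  unfolding trig_poly_def by (rule order_trans[OF norm_sum]) (simp add: norm_mult)

lemma L2_torus_trig_poly: "trig_poly F c \<in> L2_torus"
  by (rule L2_torus_bounded[OF _ norm_trig_poly_le]) (intro measurable_torusI measurable_trig_poly)

lemma L2_torus_torus_char: "torus_char k \<in> L2_torus"
  by (rule L2_torus_bounded[of _ 1]) (auto intro: measurable_torusI)

lemma fourier_coeff_torus_char: "fourier_coeff (torus_char j) k = (if j = k then 1 else 0)"
proof -
  have "fourier_coeff (torus_char j) k = (LINT \<omega>|torus. torus_char (j - k) \<omega>)"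
    by (simp add: fourier_coeff_def cnj_torus_char torus_char_add_index[symmetric])
  then show ?thesis by (simp add: integral_torus_char)
qed

lemma fourier_coeff_trig_poly:
  assumes "finite F"
  shows "fourier_coeff (trig_poly F c) k = (if k \<in> F then c k else 0)"
proof -
  have "fourier_coeff (trig_poly F c) k = (\<Sum>j\<in>F. fourier_coeff (\<lambda>\<omega>. c j * torus_char j \<omega>) k)"
    unfolding fourier_coeff_def trig_poly_def sum_distrib_right
    by (rule Bochner_Integration.integral_sum)
      (intro integrable_mult_cnj_torus_char integrable_mult_right L2_torus_integrable L2_torus_torus_char)
  then show ?thesis
    using assms by (simp add: fourier_coeff_cmult fourier_coeff_torus_char if_distrib[of "\<lambda>x. _ * x"] cong: if_cong)
qed

lemma integral_mult_cnj_trig_poly: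
  assumes "h \<in> L2_torus"
  shows "(LINT \<omega>|torus. h \<omega> * cnj (trig_poly F c \<omega>)) = (\<Sum>k\<in>F. cnj (c k) * fourier_coeff h k)"
proof -
  have "(LINT \<omega>|torus. h \<omega> * cnj (trig_poly F c \<omega>)) = (LINT \<omega>|torus. (\<Sum>k\<in>F. cnj (c k) * (h \<omega> * cnj (torus_char k \<omega>))))"
    by (simp add: trig_poly_def sum_distrib_left mult_ac)
  also have "\<dots> = (\<Sum>k\<in>F. (LINT \<omega>|torus. cnj (c k) * (h \<omega> * cnj (torus_char k \<omega>))))"
    by (rule Bochner_Integration.integral_sum)
      (intro integrable_mult_right integrable_mult_cnj_torus_char L2_torus_integrable assms)
  finally show ?thesis by (simp add: fourier_coeff_def)
qed

lemma integral_cmod_sq: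
  assumes "h \<in> L2_torus"
  shows "of_real (LINT \<omega>|torus. (cmod (h \<omega>))\<^sup>2) = (LINT \<omega>|torus. h \<omega> * cnj (h \<omega>))"
  by (simp add: complex_norm_square[symmetric] flip: integral_complex_of_real)

lemma integral_trig_poly_sq:
  assumes "finite F"
  shows "(LINT \<omega>|torus. (cmod (trig_poly F c \<omega>))\<^sup>2) = (\<Sum>k\<in>F. (cmod (c k))\<^sup>2)"
proof -
  have "complex_of_real (LINT \<omega>|torus. (cmod (trig_poly F c \<omega>))\<^sup>2) = (\<Sum>k\<in>F. cnj (c k) * c k)"
    using assms by (simp add: integral_cmod_sq L2_torus_trig_poly integral_mult_cnj_trig_poly fourier_coeff_trig_poly)
  also have "\<dots> = of_real (\<Sum>k\<in>F. (cmod (c k))\<^sup>2)"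
    by (simp only: of_real_sum complex_norm_square mult.commute)
  finally show ?thesis by (simp only: of_real_eq_iff)
qed

lemma sq_norm_trig_poly:
  assumes "finite F"
  shows "sq_norm (trig_poly F c) = (\<Sum>k\<in>F. ennreal ((cmod (c k))\<^sup>2))"
  using assms by (simp add: sq_norm_eq L2_torus_trig_poly integral_trig_poly_sq)

text \<open>
  Pythagoras: the difference between \<open>h\<close> and its partial sum is orthogonal to the
  partial sum.
\<close>

lemma bessel_defect:
  fixes h :: "real ^ 'm::finite \<Rightarrow> complex"
  assumes h: "h \<in> L2_torus" and F: "finite F"
  shows "sq_norm h = sq_norm (\<lambda>\<omega>. h \<omega> - trig_poly F (fourier_coeff h) \<omega>) + (\<Sum>k\<in>F. ennreal ((cmod (fourier_coeff h k))\<^sup>2))"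
proof -
  define P where "P = trig_poly F (fourier_coeff h)"
  define q where "q = (\<lambda>\<omega>. h \<omega> - P \<omega>)"
  have P: "P \<in> L2_torus" unfolding P_def by (rule L2_torus_trig_poly)
  have q: "q \<in> L2_torus" unfolding q_def by (intro L2_torus_diff h P)
  have "fourier_coeff q k = 0" if "k \<in> F" for k
    using that F unfolding q_def
    by (simp add: fourier_coeff_diff L2_torus_integrable h P) (simp add: P_def fourier_coeff_trig_poly)
  then have orth: "(LINT \<omega>|torus. q \<omega> * cnj (P \<omega>)) = 0"
    unfolding P_def by (subst integral_mult_cnj_trig_poly[OF q]) simp
  define R where "R = (\<lambda>\<omega>. q \<omega> * cnj (P \<omega>))"
  have int_R: "integrable torus R"
    unfolding R_def by (intro L2_torus_integrable_mult q L2_torus_cnj P)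
  have "(cmod (h \<omega>))\<^sup>2 = (cmod (q \<omega>))\<^sup>2 + (cmod (P \<omega>))\<^sup>2 + 2 * Re (R \<omega>)" for \<omega>
    unfolding R_def cmod_power2 by (simp add: q_def power2_eq_square algebra_simps)
  then have "(LINT \<omega>|torus. (cmod (h \<omega>))\<^sup>2) = (LINT \<omega>|torus. (cmod (q \<omega>))\<^sup>2 + (cmod (P \<omega>))\<^sup>2 + 2 * Re (R \<omega>))"
    by simp
  also have "\<dots> = (LINT \<omega>|torus. (cmod (q \<omega>))\<^sup>2) + (LINT \<omega>|torus. (cmod (P \<omega>))\<^sup>2) + 2 * Re (LINT \<omega>|torus. R \<omega>)"
    using int_R L2_torus_integrable_sq[OF q] L2_torus_integrable_sq[OF P] by simp
  finally have "(LINT \<omega>|torus. (cmod (h \<omega>))\<^sup>2) = (LINT \<omega>|torus. (cmod (q \<omega>))\<^sup>2) + (\<Sum>k\<in>F. (cmod (fourier_coeff h k))\<^sup>2)"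
    by (simp add: R_def orth) (simp add: P_def integral_trig_poly_sq F)
  then show ?thesis
    unfolding P_def[symmetric] q_def[symmetric] sq_norm_eq[OF h] sq_norm_eq[OF q]
    by (simp add: ennreal_plus sum_nonneg)
qed

lemma bessel_inequality:
  "h \<in> L2_torus \<Longrightarrow> finite F \<Longrightarrow> (\<Sum>k\<in>F. ennreal ((cmod (fourier_coeff h k))\<^sup>2)) \<le> sq_norm h"
  by (simp add: bessel_defect)

section \<open>Sums over a countable index type\<close>

text \<open>
  A fixed increasing exhaustion of the index type by finite sets, along which partial sums are
  taken.
\<close>

definition block :: "nat \<Rightarrow> 'k::countable set" where
  "block n = {k. to_nat k \<le> n}"

lemma finite_block [simp]: "finite (block n)"
proof -
  have "to_nat ` block n \<subseteq> {..n}" by (auto simp: block_def)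
  then show ?thesis by (meson finite_atMost finite_imageD finite_subset inj_on_subset inj_to_nat top_greatest)
qed

lemma block_mono: "i \<le> j \<Longrightarrow> block i \<subseteq> block j"
  by (auto simp: block_def)

lemma nn_integral_count_space_block:
  fixes f :: "'k::countable \<Rightarrow> ennreal"
  shows "(\<integral>\<^sup>+k. f k \<partial>count_space UNIV) = (SUP n. \<Sum>k\<in>block n. f k)"
proof -
  have lim: "(SUP n. f k * indicator (block n) k) = f k" for k
  proof (rule antisym)
    show "(SUP n. f k * indicator (block n) k) \<le> f k"
      by (rule SUP_least) (auto simp: indicator_def)
    have "f k = f k * indicator (block (to_nat k)) k" by (simp add: block_def)
    also have "\<dots> \<le> (SUP n. f k * indicator (block n) k)" by (rule SUP_upper) simp
    finally show "f k \<le> (SUP n. f k * indicator (block n) k)" .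
  qed
  have "(\<integral>\<^sup>+k. f k \<partial>count_space UNIV) = (\<integral>\<^sup>+k. (SUP n. f k * indicator (block n) k) \<partial>count_space UNIV)"
    by (simp add: lim)
  also have "\<dots> = (SUP n. \<integral>\<^sup>+k. f k * indicator (block n) k \<partial>count_space UNIV)"
    using block_mono by (intro nn_integral_monotone_convergence_SUP)
      (auto simp: incseq_def le_fun_def indicator_def)
  also have "\<dots> = (SUP n. \<Sum>k\<in>block n. f k)"
    by (simp add: nn_integral_count_space_indicator[symmetric] nn_integral_count_space_finite)
  finally show ?thesis .
qed

lemma sum_le_nn_integral_count_space:
  fixes f :: "'k \<Rightarrow> ennreal"
  assumes "finite F"
  shows "sum f F \<le> (\<integral>\<^sup>+k. f k \<partial>count_space UNIV)"
proof -
  have "sum f F = (\<integral>\<^sup>+k. f k * indicator F k \<partial>count_space UNIV)"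
    using assms by (simp add: nn_integral_count_space_indicator[symmetric] nn_integral_count_space_finite)
  also have "\<dots> \<le> (\<integral>\<^sup>+k. f k \<partial>count_space UNIV)"
    by (intro nn_integral_mono) (auto simp: indicator_def)
  finally show ?thesis .
qed

lemma infsum_ennreal_eq_nn_integral:
  fixes f :: "'k::countable \<Rightarrow> ennreal"
  shows "(\<Sum>\<^sub>\<infinity>k. f k) = (\<integral>\<^sup>+k. f k \<partial>count_space UNIV)"
proof -
  have "(\<Sum>\<^sub>\<infinity>k. f k) = (SUP F\<in>{F. finite F \<and> F \<subseteq> UNIV}. sum f F)"
    by (intro infsumI nonneg_has_sum_complete) auto
  also have "\<dots> = (\<integral>\<^sup>+k. f k \<partial>count_space UNIV)"
  proof (rule antisym)
    show "(SUP F\<in>{F. finite F \<and> F \<subseteq> UNIV}. sum f F) \<le> (\<integral>\<^sup>+k. f k \<partial>count_space UNIV)"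
      by (rule SUP_least) (simp add: sum_le_nn_integral_count_space)
    show "(\<integral>\<^sup>+k. f k \<partial>count_space UNIV) \<le> (SUP F\<in>{F. finite F \<and> F \<subseteq> UNIV}. sum f F)"
      unfolding nn_integral_count_space_block by (rule SUP_least, rule SUP_upper) simp
  qed
  finally show ?thesis .
qed

lemma tail_tendsto_0:
  fixes f :: "'k::countable \<Rightarrow> ennreal"
  assumes "(\<integral>\<^sup>+k. f k \<partial>count_space UNIV) < \<infinity>"
  shows "(\<lambda>n. \<integral>\<^sup>+k. f k * indicator (- block n) k \<partial>count_space UNIV) \<longlonglongrightarrow> 0"
proof -
  have "(\<lambda>n. \<integral>\<^sup>+k. f k * indicator (- block n) k \<partial>count_space UNIV) \<longlonglongrightarrow> (\<integral>\<^sup>+k. 0 \<partial>count_space (UNIV :: 'k set))"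
  proof (rule nn_integral_dominated_convergence[where w=f])
    show "AE k in count_space UNIV. (\<lambda>n. f k * indicator (- block n) k) \<longlonglongrightarrow> 0"
    proof (rule AE_I2)
      fix k
      have "eventually (\<lambda>n. f k * indicator (- block n) k = 0) sequentially"
        by (rule eventually_sequentiallyI[of "to_nat k"]) (simp add: block_def)
      then show "(\<lambda>n. f k * indicator (- block n) k) \<longlonglongrightarrow> 0" by (rule tendsto_eventually)
    qed
    show "AE k in count_space UNIV. f k * indicator (- block n) k \<le> f k" for n
      by (intro AE_I2) (auto simp: indicator_def)
  qed (use assms in auto)
  then show ?thesis by simp
qed

lemma fourier_coeff_sq_le:
  assumes "h \<in> L2_torus"
  shows "ennreal ((cmod (fourier_coeff h k))\<^sup>2) \<le> sq_norm h"
  using bessel_inequality[OF assms, of "{k}"] by simp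

lemma trig_poly_diff:
  assumes "finite G" "F \<subseteq> G"
  shows "trig_poly G c \<omega> - trig_poly F c \<omega> = trig_poly (G - F) c \<omega>"
  using assms unfolding trig_poly_def by (simp add: sum_diff)

section \<open>The Riesz--Fischer theorem and Parseval's identity\<close>

text \<open>
  On a space of total mass one the inequality \<open>x \<le> 2\<^sup>-\<^sup>j + 2\<^sup>j
  x\<^sup>2\<close> integrates to an \<open>L\<^sup>1\<close> bound of the order of the square
  root of the given bound, as in the Cauchy--Schwarz inequality.
\<close>

lemma nn_integral_cmod_le_of_sq_norm:
  fixes d :: "real ^ 'm::finite \<Rightarrow> complex"
  assumes [measurable]: "d \<in> borel_measurable torus" and le: "sq_norm d \<le> ennreal ((1/4)^j)"
  shows "(\<integral>\<^sup>+\<omega>. ennreal (cmod (d \<omega>)) \<partial>torus) \<le> ennreal (2 * (1/2)^j)"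
proof -
  have amgm: "x \<le> (1/2)^j + 2^j * x\<^sup>2" for x :: real
  proof -
    have "0 \<le> ((1/2)^j * (1 - 2^j * x)\<^sup>2)" by simp
    also have "\<dots> = (1/2)^j - 2 * x + 2^j * x\<^sup>2"
      by (simp add: power2_eq_square algebra_simps power_one_over)
    finally have "2 * x \<le> (1/2)^j + 2^j * x\<^sup>2" by simp
    moreover have "0 \<le> (1/2)^j + 2^j * x\<^sup>2" by (intro add_nonneg_nonneg mult_nonneg_nonneg) auto
    ultimately show ?thesis by linarith
  qed
  have "(\<integral>\<^sup>+\<omega>. ennreal (cmod (d \<omega>)) \<partial>torus) \<le> (\<integral>\<^sup>+\<omega>. ennreal ((1/2)^j) + ennreal (2^j) * ennreal ((cmod (d \<omega>))\<^sup>2) \<partial>torus)"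
    using amgm by (intro nn_integral_mono) (simp add: ennreal_mult[symmetric] ennreal_plus[symmetric] ennreal_leI del: ennreal_plus)
  also have "\<dots> = ennreal ((1/2)^j) + ennreal (2^j) * sq_norm d"
    by (simp add: nn_integral_add nn_integral_cmult sq_norm_def emeasure_torus_space)
  also have "\<dots> \<le> ennreal ((1/2)^j) + ennreal (2^j) * ennreal ((1/4)^j)"
    using le by (intro add_left_mono mult_left_mono) auto
  also have "ennreal (2^j) * ennreal ((1/4)^j) = ennreal ((1/2)^j)"
    by (simp add: ennreal_mult[symmetric] power_mult_distrib[symmetric])
  finally show ?thesis by (simp add: ennreal_plus[symmetric] del: ennreal_plus)
qed

text \<open>
  Partial sums whose tails are below \<open>4\<^sup>-\<^sup>j\<close> have summable distances in
  \<open>L\<^sup>1\<close> and therefore converge almost everywhere; Fatou's lemma upgrades this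
  to convergence in the mean, which determines the coefficients of the limit. The last conclusion
  records that the partial sums approximate the limit.
\<close>

lemma riesz_fischer:
  fixes c :: "int ^ 'm::finite \<Rightarrow> complex"
  assumes fin: "(\<integral>\<^sup>+k. ennreal ((cmod (c k))\<^sup>2) \<partial>count_space UNIV) < \<infinity>"
  obtains s where "s \<in> borel_measurable borel" "s \<in> L2_torus" "\<And>k. fourier_coeff s k = c k"
    "\<And>e::real. e > 0 \<Longrightarrow> \<exists>n. sq_norm (\<lambda>\<omega>. s \<omega> - trig_poly (block n) c \<omega>) < ennreal e"
proof -
  define T where "T = (\<lambda>n. \<integral>\<^sup>+k. ennreal ((cmod (c k))\<^sup>2) * indicator (- block n) k \<partial>count_space UNIV)"
  have T_lim: "T \<longlonglongrightarrow> 0" unfolding T_def by (rule tail_tendsto_0[OF fin])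
  have ex_N: "\<exists>n>m. T n < ennreal ((1/4)^j)" for m j
  proof -
    have "eventually (\<lambda>n. T n < ennreal ((1/4)^j)) sequentially"
      using T_lim by (rule order_tendstoD) simp
    then show ?thesis
      using eventually_gt_at_top[of m] by (metis (mono_tags, lifting) eventually_conj eventually_happens trivial_limit_sequentially)
  qed
  have "\<exists>N. \<forall>j. T (N j) < ennreal ((1/4)^j) \<and> N j < N (Suc j)"
    by (rule dependent_nat_choice) (use ex_N in blast)+
  then obtain N where N: "\<And>j. T (N j) < ennreal ((1/4)^j)" and "\<And>j. N j < N (Suc j)" by blast
  then have "strict_mono N" by (simp add: strict_mono_Suc_iff)
  then have N_mono: "i \<le> j \<Longrightarrow> N i \<le> N j" for i j by (simp add: strict_mono_less_eq)
  define S where "S = (\<lambda>j. trig_poly (block (N j)) c)"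
  have [measurable]: "S j \<in> borel_measurable borel" for j by (simp add: S_def)
  have [measurable]: "S j \<in> borel_measurable torus" for j by (simp add: measurable_torusI)
  have S_L2: "S j \<in> L2_torus" for j by (simp add: S_def L2_torus_trig_poly)
  have S_diff: "sq_norm (\<lambda>\<omega>. S j \<omega> - S i \<omega>) \<le> ennreal ((1/4)^i)" if "i \<le> j" for i j
  proof -
    have "sq_norm (\<lambda>\<omega>. S j \<omega> - S i \<omega>) = (\<Sum>k\<in>block (N j) - block (N i). ennreal ((cmod (c k))\<^sup>2))"
      unfolding S_def using N_mono[OF that] by (simp add: trig_poly_diff block_mono sq_norm_trig_poly)
    also have "\<dots> = (\<Sum>k\<in>block (N j) - block (N i). ennreal ((cmod (c k))\<^sup>2) * indicator (- block (N i)) k)"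
      by (intro sum.cong) auto
    also have "\<dots> \<le> T (N i)" unfolding T_def by (rule sum_le_nn_integral_count_space) simp
    also have "\<dots> \<le> ennreal ((1/4)^i)" using N[of i] by simp
    finally show ?thesis .
  qed
  \<comment> \<open>The increments of the chosen partial sums; their sum converges absolutely almost everywhere.\<close>
  define d where "d = (\<lambda>j \<omega>. S (Suc j) \<omega> - S j \<omega>)"
  have [measurable]: "d j \<in> borel_measurable torus" for j unfolding d_def by measurable
  have d_le: "(\<integral>\<^sup>+\<omega>. ennreal (cmod (d j \<omega>)) \<partial>torus) \<le> ennreal (2 * (1/2)^j)" for j
    using S_diff[of j "Suc j"] by (intro nn_integral_cmod_le_of_sq_norm) (simp_all add: d_def)
  have "(\<integral>\<^sup>+\<omega>. (\<Sum>j. ennreal (cmod (d j \<omega>))) \<partial>torus) = (\<Sum>j. \<integral>\<^sup>+\<omega>. ennreal (cmod (d j \<omega>)) \<partial>torus)"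
    by (rule nn_integral_suminf) measurable
  also have "\<dots> \<le> (\<Sum>j. ennreal (2 * (1/2)^j))" by (intro suminf_le d_le) auto
  also have "(\<Sum>j. ennreal (2 * (1/2)^j)) = ennreal (2 * (1 / (1 - 1/2)))"
  proof (rule suminf_ennreal_eq)
    show "(\<lambda>j. 2 * (1/2)^j) sums (2 * (1 / (1 - 1/2 :: real)))"
      by (intro sums_mult geometric_sums) simp
  qed simp
  also have "\<dots> < \<infinity>" by simp
  finally have "AE \<omega> in torus. (\<Sum>j. ennreal (cmod (d j \<omega>))) \<noteq> \<infinity>"
    by (intro nn_integral_PInf_AE) auto
  then have conv: "AE \<omega> in torus. convergent (\<lambda>j. S j \<omega>)"
  proof eventually_elim
    case (elim \<omega>)
    then have "summable (\<lambda>j. cmod (d j \<omega>))" by (intro summable_suminf_not_top) auto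
    then have "summable (\<lambda>j. d j \<omega>)" by (rule summable_norm_cancel)
    then have "convergent (\<lambda>n. \<Sum>j<n. d j \<omega>)" by (simp add: summable_iff_convergent)
    then have "convergent (\<lambda>n. S n \<omega> - S 0 \<omega>)" by (simp add: d_def sum_lessThan_telescope[of "\<lambda>n. S n \<omega>"])
    then show ?case using convergent_diff_const_right_iff by blast
  qed
  define s where "s = (\<lambda>\<omega>. lim (\<lambda>j. S j \<omega>))"
  have s_meas [measurable]: "s \<in> borel_measurable borel"
    unfolding s_def by (rule borel_measurable_lim_metric) measurable
  have s_meas_torus [measurable]: "s \<in> borel_measurable torus" by (simp add: measurable_torusI)
  have s_close: "sq_norm (\<lambda>\<omega>. s \<omega> - S i \<omega>) \<le> ennreal ((1/4)^i)" for i
  proof -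
    have "sq_norm (\<lambda>\<omega>. s \<omega> - S i \<omega>) = (\<integral>\<^sup>+\<omega>. liminf (\<lambda>j. ennreal ((cmod (S j \<omega> - S i \<omega>))\<^sup>2)) \<partial>torus)"
      unfolding sq_norm_def
    proof (rule nn_integral_cong_AE, use conv in eventually_elim)
      case (elim \<omega>)
      then have "(\<lambda>j. S j \<omega>) \<longlonglongrightarrow> s \<omega>" by (simp add: s_def convergent_LIMSEQ_iff)
      then have "(\<lambda>j. ennreal ((cmod (S j \<omega> - S i \<omega>))\<^sup>2)) \<longlonglongrightarrow> ennreal ((cmod (s \<omega> - S i \<omega>))\<^sup>2)"
        by (intro tendsto_intros)
      then show ?case by (rule lim_imp_Liminf[OF sequentially_bot, symmetric])
    qed
    also have "\<dots> \<le> liminf (\<lambda>j. sq_norm (\<lambda>\<omega>. S j \<omega> - S i \<omega>))"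
      unfolding sq_norm_def by (rule nn_integral_liminf) measurable
    also have "\<dots> \<le> liminf (\<lambda>j::nat. ennreal ((1/4)^i))"
      using S_diff by (intro Liminf_mono eventually_sequentiallyI[of i])
    also have "\<dots> = ennreal ((1/4)^i)" by (rule Liminf_const) simp
    finally show ?thesis .
  qed
  have diff_L2: "(\<lambda>\<omega>. s \<omega> - S i \<omega>) \<in> L2_torus" for i
    using le_less_trans[OF s_close[of i] ennreal_less_top] by (simp add: L2_torus_iff)
  then have s_L2: "s \<in> L2_torus"
    using L2_torus_diff[OF diff_L2[of 0] L2_torus_diff[OF L2_torus_const[of 0] S_L2[of 0]]] by simp
  have small: "\<exists>j0. \<forall>j\<ge>j0. (1/4 :: real)^j < e" if "e > 0" for e
    using order_tendstoD(2)[OF LIMSEQ_realpow_zero[of "1/4"] that] by (auto simp: eventually_sequentially)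
  have coeff: "fourier_coeff s k = c k" for k
  proof (rule ccontr)
    assume ne: "\<not> ?thesis"
    obtain j0 where j0: "\<And>j. j \<ge> j0 \<Longrightarrow> (1/4::real)^j < (cmod (fourier_coeff s k - c k))\<^sup>2"
      using small[of "(cmod (fourier_coeff s k - c k))\<^sup>2"] ne by auto
    define j where "j = max j0 (to_nat k)"
    have "to_nat k \<le> j" by (simp add: j_def)
    also have "j \<le> N j" using \<open>strict_mono N\<close> by (rule strict_mono_imp_increasing)
    finally have "k \<in> block (N j)" by (simp add: block_def)
    then have "fourier_coeff (\<lambda>\<omega>. s \<omega> - S j \<omega>) k = fourier_coeff s k - c k"
      by (simp add: fourier_coeff_diff L2_torus_integrable s_L2 S_L2) (simp add: S_def fourier_coeff_trig_poly)
    then have "ennreal ((cmod (fourier_coeff s k - c k))\<^sup>2) \<le> ennreal ((1/4)^j)"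
      using order_trans[OF fourier_coeff_sq_le[OF diff_L2[of j], of k] s_close[of j]] by simp
    then have "(cmod (fourier_coeff s k - c k))\<^sup>2 \<le> (1/4)^j" by simp
    then show False using j0[of j] by (simp add: j_def)
  qed
  show ?thesis
  proof (rule that[OF s_meas s_L2 coeff])
    fix e :: real assume "e > 0"
    then obtain j where "(1/4::real)^j < e" using small[of e] by blast
    then have "sq_norm (\<lambda>\<omega>. s \<omega> - S j \<omega>) < ennreal e"
      using s_close[of j] by (auto intro: le_less_trans ennreal_lessI \<open>e > 0\<close>)
    then show "\<exists>n. sq_norm (\<lambda>\<omega>. s \<omega> - trig_poly (block n) c \<omega>) < ennreal e"
      unfolding S_def by blast
  qed
qed

text \<open>
  One inequality is Bessel's. For the other, the function that \<open>riesz_fischer\<close> builds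
  from the coefficients of \<open>h\<close> coincides with \<open>h\<close> by uniqueness, so the
  partial sums of \<open>h\<close> approximate \<open>h\<close>, and their norms are partial sums
  of the series.
\<close>

theorem parseval:
  fixes h :: "real ^ 'm::finite \<Rightarrow> complex"
  assumes h: "h \<in> L2_torus"
  shows "sq_norm h = (\<integral>\<^sup>+k. ennreal ((cmod (fourier_coeff h k))\<^sup>2) \<partial>count_space UNIV)"
proof (rule antisym)
  show le: "(\<integral>\<^sup>+k. ennreal ((cmod (fourier_coeff h k))\<^sup>2) \<partial>count_space UNIV) \<le> sq_norm h"
    unfolding nn_integral_count_space_block by (intro SUP_least bessel_inequality h finite_block)
  also have "sq_norm h < \<infinity>" using h by (simp add: L2_torus_iff)
  finally obtain s where s: "s \<in> L2_torus" "\<And>k. fourier_coeff s k = fourier_coeff h k"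
    "\<And>e::real. e > 0 \<Longrightarrow> \<exists>n. sq_norm (\<lambda>\<omega>. s \<omega> - trig_poly (block n) (fourier_coeff h) \<omega>) < ennreal e"
    by (rule riesz_fischer) auto
  have "zero_coeffs (\<lambda>\<omega>. h \<omega> - s \<omega>)"
    using s h by (simp add: zero_coeffs_def fourier_coeff_diff L2_torus_integrable)
  then have eq: "AE \<omega> in torus. h \<omega> - s \<omega> = 0" by (rule fourier_uniqueness)
  show "sq_norm h \<le> (\<integral>\<^sup>+k. ennreal ((cmod (fourier_coeff h k))\<^sup>2) \<partial>count_space UNIV)"
  proof (rule ennreal_le_epsilon)
    fix e :: real assume "e > 0"
    then obtain n where n: "sq_norm (\<lambda>\<omega>. s \<omega> - trig_poly (block n) (fourier_coeff h) \<omega>) < ennreal e"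
      using s(3) by blast
    have "sq_norm (\<lambda>\<omega>. h \<omega> - trig_poly (block n) (fourier_coeff h) \<omega>) = sq_norm (\<lambda>\<omega>. s \<omega> - trig_poly (block n) (fourier_coeff h) \<omega>)"
      unfolding sq_norm_def by (rule nn_integral_cong_AE) (use eq in eventually_elim, simp)
    then have "sq_norm h \<le> ennreal e + (\<Sum>k\<in>block n. ennreal ((cmod (fourier_coeff h k))\<^sup>2))"
      using n by (subst bessel_defect[OF h finite_block[of n]]) (auto intro!: add_right_mono)
    also have "\<dots> \<le> ennreal e + (\<integral>\<^sup>+k. ennreal ((cmod (fourier_coeff h k))\<^sup>2) \<partial>count_space UNIV)"
      by (intro add_left_mono sum_le_nn_integral_count_space finite_block)
    finally show "sq_norm h \<le> (\<integral>\<^sup>+k. ennreal ((cmod (fourier_coeff h k))\<^sup>2) \<partial>count_space UNIV) + ennreal e"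
      by (simp add: add.commute)
  qed
qed

section \<open>Bounded sequences in the weighted space\<close>

lemma H1_norm_eq:
  "H1_norm \<gamma> h = ennreal_sqrt (\<integral>\<^sup>+k. ennreal ((1 + (\<gamma> k)\<^sup>2) * (cmod (fourier_coeff h k))\<^sup>2) \<partial>count_space UNIV)"
  by (simp add: H1_norm_def infsum_ennreal_eq_nn_integral)

text \<open>
  Each coefficient is bounded along the sequence, so a diagonal subsequence makes all of them
  converge, and by Fatou the limits obey the same weighted bound. Outside the finite set
  \<open>\<bar>\<gamma>\<bar> \<le> d\<close> the weight exceeds \<open>d\<^sup>2\<close>, which
  makes the tails small uniformly in the sequence.
\<close>

lemma H1_compact_sequence:
  fixes \<gamma> :: "int ^ 'm::finite \<Rightarrow> real"
  assumes fin: "\<And>d. d > 0 \<Longrightarrow> finite {k. \<bar>\<gamma> k\<bar> \<le> d}"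
    and u: "\<And>j. u j \<in> L2_torus" and bound: "\<And>j. H1_norm \<gamma> (u j) \<le> ennreal C"
  obtains r l where "strict_mono (r :: nat \<Rightarrow> nat)" "l \<in> borel_measurable borel" "l \<in> L2_torus"
    "(\<lambda>j. sq_norm (\<lambda>\<omega>. u (r j) \<omega> - l \<omega>)) \<longlonglongrightarrow> 0"
proof -
  define w where "w = (\<lambda>k. 1 + (\<gamma> k)\<^sup>2)"
  have w1: "w k \<ge> 1" for k by (simp add: w_def)
  define a where "a = (\<lambda>j. fourier_coeff (u j))"
  define D where "D = max C 0"
  have wa: "(\<integral>\<^sup>+k. ennreal (w k * (cmod (a j k))\<^sup>2) \<partial>count_space UNIV) \<le> ennreal (D\<^sup>2)" for j
  proof -
    have "H1_norm \<gamma> (u j) \<le> ennreal D"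
      using bound[of j] by (simp add: D_def max_def split: if_splits) (metis ennreal_neg linear order_trans ennreal_0 le_zero_eq)
    then show ?thesis unfolding H1_norm_eq w_def a_def by (subst (asm) ennreal_sqrt_le_iff) (auto simp: D_def)
  qed
  have a_le: "cmod (a j k) \<le> D" for j k
  proof -
    have "ennreal ((cmod (a j k))\<^sup>2) \<le> ennreal (w k * (cmod (a j k))\<^sup>2)"
      using w1[of k] by (intro ennreal_leI) (simp add: mult_le_cancel_right1)
    also have "\<dots> \<le> ennreal (D\<^sup>2)"
      using order_trans[OF sum_le_nn_integral_count_space[of "{k}"] wa[of j]] by simp
    finally have "(cmod (a j k))\<^sup>2 \<le> D\<^sup>2" by simp
    then show ?thesis by (rule power2_le_imp_le) (simp add: D_def)
  qed
  obtain r where r: "strict_mono (r :: nat \<Rightarrow> nat)" "\<And>k. k \<in> UNIV \<Longrightarrow> \<exists>l. (\<lambda>n. a (r n) k) \<longlonglongrightarrow> l"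
    by (rule function_convergent_subsequence[of UNIV a D]) (use a_le in auto)
  then obtain c where c: "\<And>k. (\<lambda>n. a (r n) k) \<longlonglongrightarrow> c k" by (metis UNIV_I)
  have wc: "(\<integral>\<^sup>+k. ennreal (w k * (cmod (c k))\<^sup>2) \<partial>count_space UNIV) \<le> ennreal (D\<^sup>2)"
  proof -
    have "(\<integral>\<^sup>+k. ennreal (w k * (cmod (c k))\<^sup>2) \<partial>count_space UNIV)
        = (\<integral>\<^sup>+k. liminf (\<lambda>n. ennreal (w k * (cmod (a (r n) k))\<^sup>2)) \<partial>count_space UNIV)"
    proof (rule nn_integral_cong)
      fix k
      have "(\<lambda>n. ennreal (w k * (cmod (a (r n) k))\<^sup>2)) \<longlonglongrightarrow> ennreal (w k * (cmod (c k))\<^sup>2)"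
        by (intro tendsto_intros c)
      then show "ennreal (w k * (cmod (c k))\<^sup>2) = liminf (\<lambda>n. ennreal (w k * (cmod (a (r n) k))\<^sup>2))"
        by (simp add: lim_imp_Liminf)
    qed
    also have "\<dots> \<le> liminf (\<lambda>n. \<integral>\<^sup>+k. ennreal (w k * (cmod (a (r n) k))\<^sup>2) \<partial>count_space UNIV)"
      by (rule nn_integral_liminf) simp
    also have "\<dots> \<le> liminf (\<lambda>n::nat. ennreal (D\<^sup>2))"
      using wa by (intro Liminf_mono always_eventually) auto
    also have "\<dots> = ennreal (D\<^sup>2)" by (rule Liminf_const) simp
    finally show ?thesis .
  qed
  have "(\<integral>\<^sup>+k. ennreal ((cmod (c k))\<^sup>2) \<partial>count_space UNIV) \<le> (\<integral>\<^sup>+k. ennreal (w k * (cmod (c k))\<^sup>2) \<partial>count_space UNIV)"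
    using w1 by (intro nn_integral_mono ennreal_leI) (simp add: mult_le_cancel_right1)
  also have "\<dots> \<le> ennreal (D\<^sup>2)" by (rule wc)
  finally have "(\<integral>\<^sup>+k. ennreal ((cmod (c k))\<^sup>2) \<partial>count_space UNIV) < \<infinity>"
    by (rule le_less_trans) simp
  then obtain l where l: "l \<in> borel_measurable borel" "l \<in> L2_torus" "\<And>k. fourier_coeff l k = c k"
    using riesz_fischer by metis
  have sq: "sq_norm (\<lambda>\<omega>. u (r j) \<omega> - l \<omega>) = (\<integral>\<^sup>+k. ennreal ((cmod (a (r j) k - c k))\<^sup>2) \<partial>count_space UNIV)" for j
    by (simp add: parseval L2_torus_diff u l fourier_coeff_diff L2_torus_integrable a_def)
  have "(\<lambda>j. sq_norm (\<lambda>\<omega>. u (r j) \<omega> - l \<omega>)) \<longlonglongrightarrow> 0"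
  proof (rule tendsto_ennreal_0I)
    fix e :: real assume e: "e > 0"
    \<comment> \<open>Chosen so that the bound for the tail outside the finite set is at most half of the tolerance.\<close>
    define d where "d = sqrt (8 * (D\<^sup>2 + 1) / e)"
    have d: "d > 0" "d\<^sup>2 = 8 * (D\<^sup>2 + 1) / e" using e by (simp_all add: d_def add_nonneg_pos)
    define F where "F = {k. \<bar>\<gamma> k\<bar> \<le> d}"
    have F: "finite F" unfolding F_def by (rule fin[OF d(1)])
    have tail: "(\<integral>\<^sup>+k. ennreal ((cmod (a (r j) k - c k))\<^sup>2) * indicator (- F) k \<partial>count_space UNIV) \<le> ennreal (e / 2)" for j
    proof -
      have "(\<integral>\<^sup>+k. ennreal ((cmod (a (r j) k - c k))\<^sup>2) * indicator (- F) k \<partial>count_space UNIV)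
         \<le> (\<integral>\<^sup>+k. ennreal (2 / d\<^sup>2) * (ennreal (w k * (cmod (a (r j) k))\<^sup>2) + ennreal (w k * (cmod (c k))\<^sup>2)) \<partial>count_space UNIV)"
      proof (rule nn_integral_mono)
        fix k :: "int ^ 'm"
        show "ennreal ((cmod (a (r j) k - c k))\<^sup>2) * indicator (- F) k
            \<le> ennreal (2 / d\<^sup>2) * (ennreal (w k * (cmod (a (r j) k))\<^sup>2) + ennreal (w k * (cmod (c k))\<^sup>2))"
        proof (cases "k \<in> F")
          case False
          then have "d\<^sup>2 \<le> (\<gamma> k)\<^sup>2" using d(1) by (simp add: F_def abs_le_square_iff[symmetric])
          then have wk: "1 \<le> w k / d\<^sup>2" using d(1) by (simp add: w_def)
          have "(cmod (a (r j) k - c k))\<^sup>2 \<le> 1 * (2 * (cmod (a (r j) k))\<^sup>2 + 2 * (cmod (c k))\<^sup>2)"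
            using cmod_diff_sq_le by simp
          also have "\<dots> \<le> (w k / d\<^sup>2) * (2 * (cmod (a (r j) k))\<^sup>2 + 2 * (cmod (c k))\<^sup>2)"
            using wk by (intro mult_right_mono) auto
          also have "\<dots> = (2 / d\<^sup>2) * (w k * (cmod (a (r j) k))\<^sup>2 + w k * (cmod (c k))\<^sup>2)"
            by (simp add: field_simps)
          finally have "ennreal ((cmod (a (r j) k - c k))\<^sup>2) \<le> ennreal ((2 / d\<^sup>2) * (w k * (cmod (a (r j) k))\<^sup>2 + w k * (cmod (c k))\<^sup>2))"
            by (rule ennreal_leI)
          also have "\<dots> = ennreal (2 / d\<^sup>2) * (ennreal (w k * (cmod (a (r j) k))\<^sup>2) + ennreal (w k * (cmod (c k))\<^sup>2))"
          proof -
            have "0 \<le> w k * x\<^sup>2" for x using w1[of k] by simp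
            then show ?thesis by (simp only: ennreal_mult ennreal_plus zero_le_divide_iff zero_le_power2 zero_le_numeral simp_thms add_nonneg_nonneg)
          qed
          finally show ?thesis using False by simp
        qed simp
      qed
      also have "\<dots> = ennreal (2 / d\<^sup>2) * ((\<integral>\<^sup>+k. ennreal (w k * (cmod (a (r j) k))\<^sup>2) \<partial>count_space UNIV) + (\<integral>\<^sup>+k. ennreal (w k * (cmod (c k))\<^sup>2) \<partial>count_space UNIV))"
        by (simp add: nn_integral_cmult nn_integral_add)
      also have "\<dots> \<le> ennreal (2 / d\<^sup>2) * (ennreal (D\<^sup>2) + ennreal (D\<^sup>2))"
        by (intro mult_left_mono add_mono wa wc) simp
      also have "\<dots> = ennreal (2 / d\<^sup>2 * (2 * D\<^sup>2))"
        by (simp add: ennreal_mult[symmetric] ennreal_plus[symmetric] del: ennreal_plus)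
      also have "\<dots> \<le> ennreal (e / 2)"
      proof (rule ennreal_leI)
        have pos: "D\<^sup>2 + 1 > 0" by (simp add: add_nonneg_pos)
        then have "2 / d\<^sup>2 * (2 * D\<^sup>2) = (e / 2) * (D\<^sup>2 / (D\<^sup>2 + 1))"
          unfolding d(2) using e by (simp add: divide_simps)
        also have "\<dots> \<le> e / 2" using e pos by (intro mult_left_le) auto
        finally show "2 / d\<^sup>2 * (2 * D\<^sup>2) \<le> e / 2" .
      qed
      finally show ?thesis .
    qed
    have "(\<lambda>j. \<Sum>k\<in>F. (cmod (a (r j) k - c k))\<^sup>2) \<longlonglongrightarrow> (\<Sum>k\<in>F. (cmod (c k - c k))\<^sup>2)"
      by (intro tendsto_intros c)
    then have "eventually (\<lambda>j. (\<Sum>k\<in>F. (cmod (a (r j) k - c k))\<^sup>2) < e / 2) sequentially"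
      using e by (intro order_tendstoD) auto
    then show "eventually (\<lambda>j. sq_norm (\<lambda>\<omega>. u (r j) \<omega> - l \<omega>) < ennreal e) sequentially"
    proof eventually_elim
      case (elim j)
      have "sq_norm (\<lambda>\<omega>. u (r j) \<omega> - l \<omega>) =
          (\<integral>\<^sup>+k. ennreal ((cmod (a (r j) k - c k))\<^sup>2) * indicator F k + ennreal ((cmod (a (r j) k - c k))\<^sup>2) * indicator (- F) k \<partial>count_space UNIV)"
        unfolding sq by (rule nn_integral_cong) (auto simp: indicator_def)
      also have "\<dots> = (\<Sum>k\<in>F. ennreal ((cmod (a (r j) k - c k))\<^sup>2)) + (\<integral>\<^sup>+k. ennreal ((cmod (a (r j) k - c k))\<^sup>2) * indicator (- F) k \<partial>count_space UNIV)"
        using F by (simp add: nn_integral_add nn_integral_count_space_indicator[symmetric] nn_integral_count_space_finite)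
      also have "\<dots> \<le> ennreal (\<Sum>k\<in>F. (cmod (a (r j) k - c k))\<^sup>2) + ennreal (e / 2)"
        by (intro add_mono tail) simp
      also have "\<dots> = ennreal ((\<Sum>k\<in>F. (cmod (a (r j) k - c k))\<^sup>2) + e / 2)"
        using e by (simp add: ennreal_plus sum_nonneg)
      also have "\<dots> < ennreal e" using elim e by (intro ennreal_lessI) auto
      finally show ?case .
    qed
  qed
  then show thesis using that r(1) l by blast
qed

section \<open>Smooth functions and test functions\<close>

lemma partial_deriv_eq: "(f has_derivative f') (at x) \<Longrightarrow> partial_deriv i f x = f' (axis i 1)"
  unfolding partial_deriv_def by (simp add: frechet_derivative_at[symmetric])

lemma has_derivative_differentiable_on_UNIV:
  "f differentiable_on UNIV \<Longrightarrow> (f has_derivative frechet_derivative f (at x)) (at x)"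
  by (simp add: differentiable_on_def frechet_derivative_works)

lemma Ck_continuous: "Ck k f \<Longrightarrow> continuous_on UNIV f"
  by (cases k) (auto intro: differentiable_imp_continuous_on)

lemma Ck_Suc_imp: "Ck (Suc k) f \<Longrightarrow> Ck k f"
proof (induction k arbitrary: f)
  case 0
  then show ?case by (simp add: differentiable_imp_continuous_on)
next
  case (Suc k)
  then have "f differentiable_on UNIV" "Ck (Suc k) (partial_deriv i f)" for i by simp_all
  then show ?case using Suc.IH by simp
qed

lemma Ck_const: "Ck k (\<lambda>x. c)"
proof (induction k arbitrary: c)
  case (Suc k)
  have "partial_deriv i (\<lambda>x. c) = (\<lambda>x. 0)" for i :: 'a
    by (rule ext) (rule partial_deriv_eq[OF has_derivative_const])
  then show ?case using Suc by simp
qed simp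

lemma Ck_add:
  assumes "Ck k f" "Ck k g"
  shows "Ck k (\<lambda>x. f x + g x)"
  using assms
proof (induction k arbitrary: f g)
  case 0
  then show ?case by (simp add: continuous_on_add)
next
  case (Suc k)
  have "partial_deriv i (\<lambda>x. f x + g x) = (\<lambda>x. partial_deriv i f x + partial_deriv i g x)" for i
  proof
    fix x
    have "(f has_derivative frechet_derivative f (at x)) (at x)" "(g has_derivative frechet_derivative g (at x)) (at x)"
      using Suc.prems by (auto intro: has_derivative_differentiable_on_UNIV)
    from has_derivative_add[OF this]
    show "partial_deriv i (\<lambda>x. f x + g x) x = partial_deriv i f x + partial_deriv i g x"
      by (subst partial_deriv_eq) (auto simp: partial_deriv_def)
  qed
  then show ?case using Suc by simp
qed

lemma Ck_mult:
  assumes "Ck k f" "Ck k g"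
  shows "Ck k (\<lambda>x. f x * g x)"
  using assms
proof (induction k arbitrary: f g)
  case 0
  then show ?case by (simp add: continuous_on_mult)
next
  case (Suc k)
  have "partial_deriv i (\<lambda>x. f x * g x) = (\<lambda>x. f x * partial_deriv i g x + partial_deriv i f x * g x)" for i
  proof
    fix x
    have "(f has_derivative frechet_derivative f (at x)) (at x)" "(g has_derivative frechet_derivative g (at x)) (at x)"
      using Suc.prems by (auto intro: has_derivative_differentiable_on_UNIV)
    from has_derivative_mult[OF this]
    show "partial_deriv i (\<lambda>x. f x * g x) x = f x * partial_deriv i g x + partial_deriv i f x * g x"
      by (subst partial_deriv_eq) (auto simp: partial_deriv_def)
  qed
  moreover have "Ck k f" "Ck k g" using Suc.prems by (auto intro: Ck_Suc_imp)
  moreover have "Ck k (partial_deriv i f)" "Ck k (partial_deriv i g)" for i using Suc.prems by auto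
  ultimately show ?case
    using Suc.prems by (auto intro!: Ck_add Suc.IH differentiable_on_mult)
qed

lemma Ck_bounded_linear:
  assumes "bounded_linear f"
  shows "Ck k f"
proof (cases k)
  case 0
  then show ?thesis using assms by (simp add: linear_continuous_on)
next
  case (Suc j)
  have "partial_deriv i f = (\<lambda>x. f (axis i 1))" for i
    by (rule ext) (rule partial_deriv_eq[OF bounded_linear_imp_has_derivative[OF assms]])
  moreover have "f differentiable_on UNIV"
    using bounded_linear_imp_differentiable[OF assms] by (simp add: differentiable_on_def)
  ultimately show ?thesis using Suc by (simp add: Ck_const)
qed

text \<open>
  Stated for a sequence in which every function is the derivative of its predecessor: the
  induction on the order of differentiability passes from each function to the next.
\<close>

lemma Ck_compose:
  fixes b :: "nat \<Rightarrow> real \<Rightarrow> real"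
  assumes b: "\<And>j t. (b j has_real_derivative b (Suc j) t) (at t)" and "Ck k f"
  shows "Ck k (\<lambda>x. b j (f x))"
  using assms(2)
proof (induction k arbitrary: j)
  case 0
  have "continuous_on UNIV (b j)"
    using b by (auto intro!: continuous_at_imp_continuous_on DERIV_isCont)
  then show ?case using 0 by (auto intro: continuous_on_compose2)
next
  case (Suc k)
  have der: "((\<lambda>x. b j (f x)) has_derivative (\<lambda>v. frechet_derivative f (at x) v * b (Suc j) (f x))) (at x)" for x
  proof -
    have "(f has_derivative frechet_derivative f (at x)) (at x)"
      using Suc.prems by (auto intro: has_derivative_differentiable_on_UNIV)
    moreover have "(b j has_derivative (\<lambda>s. s * b (Suc j) (f x))) (at (f x))"
      using b[of j "f x"] by (simp add: has_field_derivative_def mult_commute_abs)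
    ultimately show ?thesis by (rule has_derivative_compose)
  qed
  have "partial_deriv i (\<lambda>x. b j (f x)) = (\<lambda>x. partial_deriv i f x * b (Suc j) (f x))" for i
    by (rule ext, subst partial_deriv_eq[OF der]) (simp add: partial_deriv_def)
  moreover have "(\<lambda>x. b j (f x)) differentiable_on UNIV"
    using der by (auto simp: differentiable_on_def differentiable_def)
  moreover have "Ck k (\<lambda>x. partial_deriv i f x * b (Suc j) (f x))" for i
    using Suc.prems by (intro Ck_mult Suc.IH Ck_Suc_imp[OF Suc.prems]) simp
  ultimately show ?case by simp
qed

lemma Ck_real_polynomial_function: "real_polynomial_function p \<Longrightarrow> Ck k p"
  by (induction rule: real_polynomial_function.induct)
    (auto intro: Ck_bounded_linear Ck_const Ck_add Ck_mult)

text \<open>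
  With \<open>p = 1\<close> this is \<open>exp (-1/t)\<close> extended by zero, which is flat at
  the origin; the polynomial factor makes the family closed under differentiation.
\<close>

definition flat :: "real poly \<Rightarrow> real \<Rightarrow> real" where
  "flat p t = (if 0 < t then poly p (1 / t) * exp (- 1 / t) else 0)"

lemma poly_exp_tendsto_0: "((\<lambda>s. poly p s / exp s) \<longlongrightarrow> (0::real)) at_top"
proof -
  have "((\<lambda>s. \<Sum>i\<le>degree p. coeff p i * (s ^ i / exp s)) \<longlongrightarrow> (\<Sum>i\<le>degree p. coeff p i * 0)) at_top"
    by (intro tendsto_intros tendsto_power_div_exp_0)
  then show ?thesis by (simp add: poly_altdef sum_divide_distrib)
qed

text \<open>
  At the origin the difference quotient from the right is \<open>q(1/t) exp (-1/t)\<close> with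
  \<open>q(s) = s p(s)\<close>, and the exponential beats the polynomial.
\<close>

lemma has_derivative_flat:
  "(flat p has_real_derivative flat ((p - pderiv p) * [:0, 0, 1:]) t) (at t)"
proof -
  consider "t > 0" | "t < 0" | "t = 0" by linarith
  then show ?thesis
  proof cases
    case 1
    have "((\<lambda>t. poly p (1 / t) * exp (- 1 / t)) has_real_derivative flat ((p - pderiv p) * [:0, 0, 1:]) t) (at t)"
      using 1 by (auto intro!: derivative_eq_intros simp: flat_def power2_eq_square field_simps)
    moreover have "eventually (\<lambda>s. flat p s = poly p (1 / s) * exp (- 1 / s)) (nhds t)"
      using eventually_nhds_in_open[of "{0<..}" t] 1 by (auto elim!: eventually_mono simp: flat_def)
    ultimately show ?thesis by (subst DERIV_cong_ev[OF refl _ refl]) 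
  next
    case 2
    have "((\<lambda>t. 0) has_real_derivative flat ((p - pderiv p) * [:0, 0, 1:]) t) (at t)"
      using 2 by (simp add: flat_def)
    moreover have "eventually (\<lambda>s. flat p s = 0) (nhds t)"
      using eventually_nhds_in_open[of "{..<0}" t] 2 by (auto elim!: eventually_mono simp: flat_def)
    ultimately show ?thesis by (subst DERIV_cong_ev[OF refl _ refl])
  next
    case 3
    have "((\<lambda>y. flat p y / y) \<longlongrightarrow> 0) (at_right 0)"
    proof -
      have "((\<lambda>y. poly (p * [:0, 1:]) (inverse y) / exp (inverse y)) \<longlongrightarrow> 0) (at_right 0)"
        by (rule filterlim_compose[OF poly_exp_tendsto_0 filterlim_inverse_at_top_right])
      moreover have "eventually (\<lambda>y. poly (p * [:0, 1:]) (inverse y) / exp (inverse y) = flat p y / y) (at_right 0)"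
        using eventually_at_right_less[of 0]
        by eventually_elim (simp add: flat_def exp_minus field_simps)
      ultimately show ?thesis by (rule Lim_transform_eventually)
    qed
    moreover have "((\<lambda>y. flat p y / y) \<longlongrightarrow> 0) (at_left 0)"
      by (rule tendsto_eventually) (auto simp: eventually_at_filter flat_def)
    ultimately have "((\<lambda>y. flat p y / y) \<longlongrightarrow> 0) (at 0)"
      by (simp add: filterlim_split_at)
    then show ?thesis using 3 by (simp add: has_field_derivative_iff flat_def)
  qed
qed

definition bump :: "real \<Rightarrow> real ^ 'n::finite \<Rightarrow> real" where
  "bump R x = flat 1 (R\<^sup>2 - x \<bullet> x)"

lemma Ck_bump: "Ck k (bump R)"
proof -
  \<comment> \<open>The polynomial factors of the successive derivatives.\<close>
  define p where "p = rec_nat (1 :: real poly) (\<lambda>_ q. (q - pderiv q) * [:0, 0, 1:])"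
  have der: "(flat (p j) has_real_derivative flat (p (Suc j)) t) (at t)" for j t
    unfolding p_def by (simp only: nat.rec has_derivative_flat)
  have "real_polynomial_function (\<lambda>x::real ^ 'a. R\<^sup>2 + (\<Sum>i\<in>UNIV. (- (x $ i)) * x $ i))"
    by (intro real_polynomial_function.intros real_polynomial_function_sum bounded_linear_minus bounded_linear_vec_nth finite)
  moreover have "R\<^sup>2 + (\<Sum>i\<in>UNIV. (- (x $ i)) * x $ i) = R\<^sup>2 - x \<bullet> x" for x :: "real ^ 'a"
    by (simp add: inner_vec_def sum_negf)
  ultimately have "Ck k (\<lambda>x::real ^ 'a. R\<^sup>2 - x \<bullet> x)"
    by (simp add: Ck_real_polynomial_function)
  from Ck_compose[where b="\<lambda>j. flat (p j)" and j=0, OF der this]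
  show ?thesis by (simp add: p_def bump_def [abs_def])
qed

lemma bump_pos_iff: "R > 0 \<Longrightarrow> bump R x > 0 \<longleftrightarrow> norm x < R"
  and bump_eq_0: "R > 0 \<Longrightarrow> R \<le> norm x \<Longrightarrow> bump R x = 0"
proof -
  have "R\<^sup>2 - x \<bullet> x > 0 \<longleftrightarrow> norm x < R" if "R > 0"
    using that abs_le_square_iff[of R "norm x"] by (simp add: dot_square_norm not_le[symmetric])
  then show "R > 0 \<Longrightarrow> bump R x > 0 \<longleftrightarrow> norm x < R" "R > 0 \<Longrightarrow> R \<le> norm x \<Longrightarrow> bump R x = 0"
    by (auto simp: bump_def flat_def)
qed

lemma test_function_mult_bump:
  assumes "\<And>k. Ck k f" and R: "R > 0"
  shows "test_function (\<lambda>x. f x * bump R x)"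
proof -
  have "closure {x. f x * bump R x \<noteq> 0} \<subseteq> cball 0 R"
  proof (rule closure_minimal)
    show "{x. f x * bump R x \<noteq> 0} \<subseteq> cball 0 R"
    proof
      fix x assume "x \<in> {x. f x * bump R x \<noteq> 0}"
      then have "\<not> R \<le> norm x" using bump_eq_0[OF R, of x] by auto
      then show "x \<in> cball 0 R" by simp
    qed
  qed simp
  then have "compact (closure {x. f x * bump R x \<noteq> 0})"
    by (meson bounded_cball bounded_subset closed_closure compact_eq_bounded_closed)
  then show ?thesis using assms by (simp add: test_function_def Ck_mult Ck_bump)
qed

lemma test_function_partial_deriv:
  assumes "test_function \<phi>"
  shows "test_function (partial_deriv i \<phi>)"
proof -
  let ?K = "closure {x. \<phi> x \<noteq> 0}"
  have Ck: "Ck (Suc k) \<phi>" for k using assms unfolding test_function_def by blast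
  have zero: "partial_deriv i \<phi> x = 0" if "x \<notin> ?K" for x
  proof -
    have "(\<phi> has_derivative (\<lambda>h. 0)) (at x)"
    proof (rule has_derivative_transform_within_open[OF has_derivative_const[of 0]])
      show "open (- ?K)" by (simp add: open_Compl)
      show "x \<in> - ?K" using that by simp
      show "0 = \<phi> y" if "y \<in> - ?K" for y
        using that closure_subset[of "{x. \<phi> x \<noteq> 0}"] by auto
    qed
    then show ?thesis by (simp add: partial_deriv_eq)
  qed
  have "closure {x. partial_deriv i \<phi> x \<noteq> 0} \<subseteq> ?K"
    using zero by (intro closure_minimal) auto
  then have "compact (closure {x. partial_deriv i \<phi> x \<noteq> 0})"
    using assms unfolding test_function_def compact_eq_bounded_closed
    by (blast intro: bounded_subset closed_closure)
  then show ?thesis using Ck by (simp add: test_function_def)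
qed

lemma test_function_bounded:
  assumes "test_function \<phi>"
  obtains B K where "compact K" "\<And>x. x \<notin> K \<Longrightarrow> \<phi> x = 0" "\<And>x. \<bar>\<phi> x\<bar> \<le> B" "B \<ge> 0"
proof -
  let ?K = "closure {x. \<phi> x \<noteq> 0}"
  have K: "compact ?K" using assms by (simp add: test_function_def)
  have zero: "\<phi> x = 0" if "x \<notin> ?K" for x using that closure_subset[of "{x. \<phi> x \<noteq> 0}"] by auto
  have "continuous_on ?K \<phi>"
    using assms Ck_continuous continuous_on_subset unfolding test_function_def by blast
  then have "bounded (\<phi> ` ?K)"
    by (intro compact_imp_bounded compact_continuous_image K)
  then obtain B where B: "\<And>x. x \<in> ?K \<Longrightarrow> \<bar>\<phi> x\<bar> \<le> B"
    by (auto simp: bounded_iff)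
  show ?thesis
  proof (rule that[OF K zero])
    show "\<bar>\<phi> x\<bar> \<le> max B 0" for x
      using B[of x] zero[of x] by (cases "x \<in> ?K") auto
  qed auto
qed

lemma test_function_measurable: "test_function \<phi> \<Longrightarrow> \<phi> \<in> borel_measurable borel"
  unfolding test_function_def by (intro borel_measurable_continuous_onI Ck_continuous) auto

lemma integrable_test_function_scaleR:
  fixes v :: "real ^ 'n::finite \<Rightarrow> 'b::euclidean_space"
  assumes \<phi>: "test_function \<phi>" and v: "\<And>K. compact K \<Longrightarrow> v absolutely_integrable_on K"
  shows "integrable lebesgue (\<lambda>x. \<phi> x *\<^sub>R v x)"
proof -
  obtain B K where K: "compact K" "\<And>x. x \<notin> K \<Longrightarrow> \<phi> x = 0" "\<And>x. \<bar>\<phi> x\<bar> \<le> B"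
    by (rule test_function_bounded[OF \<phi>]) blast
  have int: "integrable lebesgue (\<lambda>x. indicator K x *\<^sub>R v x)"
    using v[OF K(1)] by (simp add: set_integrable_def)
  have \<phi>m: "\<phi> \<in> borel_measurable lebesgue"
    by (simp add: measurable_completion test_function_measurable[OF \<phi>])
  have eq: "\<phi> x *\<^sub>R v x = \<phi> x *\<^sub>R (indicator K x *\<^sub>R v x)" for x
    using K(2)[of x] by (cases "x \<in> K") auto
  show ?thesis
  proof (rule Bochner_Integration.integrable_bound)
    show "integrable lebesgue (\<lambda>x. B *\<^sub>R (indicator K x *\<^sub>R v x))"
      using int by (rule integrable_scaleR_right)
    show "(\<lambda>x. \<phi> x *\<^sub>R v x) \<in> borel_measurable lebesgue"
      unfolding eq using \<phi>m borel_measurable_integrable[OF int] by (rule borel_measurable_scaleR)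
    show "AE x in lebesgue. norm (\<phi> x *\<^sub>R v x) \<le> norm (B *\<^sub>R (indicator K x *\<^sub>R v x))"
    proof (rule AE_I2)
      fix x
      have "\<bar>\<phi> x\<bar> \<le> \<bar>B\<bar>" using K(3)[of x] by linarith
      then show "norm (\<phi> x *\<^sub>R v x) \<le> norm (B *\<^sub>R (indicator K x *\<^sub>R v x))"
        unfolding eq by (cases "x \<in> K") (simp_all add: mult_right_mono)
    qed
  qed
qed

section \<open>The fundamental lemma and uniqueness of weak gradients\<close>

text \<open>
  A polynomial times a bump is a test function, so \<open>v\<close> times the bump has vanishing
  polynomial moments on the ball, and the bump is positive inside the ball.
\<close>

lemma fundamental_lemma_real:
  fixes v :: "real ^ 'n::finite \<Rightarrow> real"
  assumes v: "\<And>K. compact K \<Longrightarrow> v absolutely_integrable_on K"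
    and zero: "\<And>\<phi>. test_function \<phi> \<Longrightarrow> (LINT x|lebesgue. \<phi> x * v x) = 0"
  shows "AE x in lebesgue. v x = 0"
proof -
  have "AE x in lebesgue. x \<in> cball 0 (real (Suc n)) \<longrightarrow> bump (real (Suc n)) x * v x = 0" for n
  proof -
    define R where "R = real (Suc n)"
    have R: "R > 0" by (simp add: R_def)
    have "test_function (bump R :: real ^ 'n \<Rightarrow> real)"
      using test_function_mult_bump[OF Ck_const[of _ 1] R] by simp
    then have "integrable lebesgue (\<lambda>x. bump R x *\<^sub>R v x)"
      by (rule integrable_test_function_scaleR[OF _ v])
    then have "integrable lebesgue (\<lambda>x. indicator (cball 0 R) x *\<^sub>R (bump R x *\<^sub>R v x))"
      by (intro integrable_mult_indicator) auto
    then have int: "integrable (lebesgue_on (cball 0 R)) (\<lambda>x. bump R x * v x)"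
      by (subst integrable_restrict_space) auto
    have "AE x in lebesgue_on (cball 0 R). bump R x * v x = 0"
    proof (rule AE_zero_of_polynomial_moments[where \<pi>="\<lambda>x. x", OF _ int])
      fix p :: "real ^ 'n \<Rightarrow> real" assume p: "real_polynomial_function p"
      have "(LINT x|lebesgue_on (cball 0 R). p x * (bump R x * v x)) = (LINT x|lebesgue. indicator (cball 0 R) x *\<^sub>R (p x * (bump R x * v x)))"
        by (rule integral_restrict_space) simp
      also have "\<dots> = (LINT x|lebesgue. (p x * bump R x) * v x)"
      proof (intro Bochner_Integration.integral_cong refl)
        fix x
        show "indicator (cball 0 R) x *\<^sub>R (p x * (bump R x * v x)) = (p x * bump R x) * v x"
          using bump_eq_0[OF R, of x] by (cases "norm x \<le> R") auto
      qed
      also have "\<dots> = 0"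
        by (rule zero[OF test_function_mult_bump[OF Ck_real_polynomial_function[OF p] R]])
      finally show "(LINT x|lebesgue_on (cball 0 R). p x * (bump R x * v x)) = 0" .
    qed auto
    then show ?thesis unfolding R_def by (subst (asm) AE_restrict_space_iff) auto
  qed
  then have "AE x in lebesgue. \<forall>n. x \<in> cball 0 (real (Suc n)) \<longrightarrow> bump (real (Suc n)) x * v x = 0"
    by (intro AE_all_countable[THEN iffD2] allI)
  then show ?thesis
  proof eventually_elim
    case (elim x)
    obtain n where n: "norm x < real n" using reals_Archimedean2 by blast
    define R where "R = real (Suc n)"
    have R: "norm x < R" "R > 0" using n by (auto simp: R_def)
    have "bump R x * v x = 0"
      using elim[rule_format, of n] R(1) unfolding R_def[symmetric] by simp
    moreover have "bump R x > 0" using bump_pos_iff[OF R(2)] R(1) by blast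
    ultimately show ?case by simp
  qed
qed

lemma fundamental_lemma:
  fixes v :: "real ^ 'n::finite \<Rightarrow> complex"
  assumes v: "\<And>K. compact K \<Longrightarrow> v absolutely_integrable_on K"
    and zero: "\<And>\<phi>. test_function \<phi> \<Longrightarrow> (LINT x|lebesgue. \<phi> x *\<^sub>R v x) = 0"
  shows "AE x in lebesgue. v x = 0"
proof -
  have *: "AE x in lebesgue. L (v x) = 0" if L: "bounded_linear L" for L :: "complex \<Rightarrow> real"
  proof (rule fundamental_lemma_real)
    show "(\<lambda>x. L (v x)) absolutely_integrable_on K" if "compact K" for K
      using absolutely_integrable_linear[OF v[OF that] L] by (simp add: o_def)
    fix \<phi> :: "real ^ 'n \<Rightarrow> real" assume \<phi>: "test_function \<phi>"
    have "(LINT x|lebesgue. \<phi> x * L (v x)) = (LINT x|lebesgue. L (\<phi> x *\<^sub>R v x))"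
      by (simp add: linear_simps[OF L])
    also have "\<dots> = L (LINT x|lebesgue. \<phi> x *\<^sub>R v x)"
      by (rule integral_bounded_linear[OF L integrable_test_function_scaleR[OF \<phi> v]])
    finally show "(LINT x|lebesgue. \<phi> x * L (v x)) = 0"
      using zero[OF \<phi>] by (simp add: linear_simps[OF L])
  qed
  show ?thesis
    using *[OF bounded_linear_Re] *[OF bounded_linear_Im] by eventually_elim (simp add: complex_eq_iff)
qed

lemma weak_gradient_unique:
  assumes "has_weak_gradient u U" "has_weak_gradient u V"
  shows "AE x in lebesgue. U x = V x"
proof -
  have "AE x in lebesgue. U x $ i - V x $ i = 0" for i
  proof (rule fundamental_lemma)
    have ai: "(\<lambda>x. W x $ i) absolutely_integrable_on K" if "has_weak_gradient u W" "compact K" for W K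
    proof -
      have "W absolutely_integrable_on K" using that by (simp add: has_weak_gradient_def)
      from absolutely_integrable_linear[OF this bounded_linear_vec_nth[of i]] show ?thesis by (simp add: o_def)
    qed
    show "(\<lambda>x. U x $ i - V x $ i) absolutely_integrable_on K" if "compact K" for K
      by (rule set_integral_diff(1)[OF ai[OF assms(1) that] ai[OF assms(2) that]])
    fix \<phi> :: "real ^ 'a \<Rightarrow> real" assume \<phi>: "test_function \<phi>"
    have "(LINT x|lebesgue. partial_deriv i \<phi> x *\<^sub>R u x) = - (LINT x|lebesgue. \<phi> x *\<^sub>R W x $ i)"
      if "has_weak_gradient u W" for W
      using that \<phi> by (simp add: has_weak_gradient_def)
    from this[OF assms(1)] this[OF assms(2)]
    have "(LINT x|lebesgue. \<phi> x *\<^sub>R U x $ i) = (LINT x|lebesgue. \<phi> x *\<^sub>R V x $ i)"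
      by simp
    then show "(LINT x|lebesgue. \<phi> x *\<^sub>R (U x $ i - V x $ i)) = 0"
      using integrable_test_function_scaleR[OF \<phi> ai[OF assms(1)]] integrable_test_function_scaleR[OF \<phi> ai[OF assms(2)]]
      by (simp add: scaleR_diff_right)
  qed
  then have "AE x in lebesgue. \<forall>i. U x $ i - V x $ i = 0"
    by (intro AE_all_countable[THEN iffD2] allI)
  then show ?thesis by eventually_elim (simp add: vec_eq_iff)
qed

section \<open>Integration by parts for Lipschitz functions\<close>

lemma difference_quotient_tendsto:
  assumes f: "(f has_derivative f') (at x)"
  shows "(\<lambda>n. (f ((1 / real (Suc n)) *\<^sub>R e + x) - f x) /\<^sub>R (1 / real (Suc n))) \<longlonglongrightarrow> f' e"
proof (cases "e = 0")
  case True
  then show ?thesis using linear_0[OF bounded_linear.linear[OF has_derivative_bounded_linear[OF f]]] by simp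
next
  case False
  define s where "s = (\<lambda>n. 1 / real (Suc n))"
  have s: "0 < s n" for n by (simp add: s_def)
  have s0: "s \<longlonglongrightarrow> 0"
    unfolding s_def using LIMSEQ_inverse_real_of_nat by (simp add: inverse_eq_divide)
  have "((\<lambda>h. norm (f (x + h) - f x - f' h) / norm h) \<longlongrightarrow> 0) (at 0)"
    using f by (simp add: has_derivative_at)
  moreover have "filterlim (\<lambda>n. s n *\<^sub>R e) (at 0) sequentially"
    unfolding filterlim_at using tendsto_scaleR[OF s0 tendsto_const[of e]] s False
    by (simp add: less_imp_neq[symmetric])
  ultimately have "(\<lambda>n. norm (f (x + s n *\<^sub>R e) - f x - f' (s n *\<^sub>R e)) / norm (s n *\<^sub>R e)) \<longlonglongrightarrow> 0"
    by (rule filterlim_compose)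
  then have "(\<lambda>n. norm e * (norm (f (x + s n *\<^sub>R e) - f x - f' (s n *\<^sub>R e)) / norm (s n *\<^sub>R e))) \<longlonglongrightarrow> norm e * 0"
    by (intro tendsto_intros)
  moreover have "norm e * (norm (f (x + s n *\<^sub>R e) - f x - f' (s n *\<^sub>R e)) / norm (s n *\<^sub>R e))
      = norm ((f (s n *\<^sub>R e + x) - f x) /\<^sub>R s n - f' e)" for n
  proof -
    have "(f (s n *\<^sub>R e + x) - f x) /\<^sub>R s n - f' e = (f (x + s n *\<^sub>R e) - f x - f' (s n *\<^sub>R e)) /\<^sub>R s n"
      using s[of n] linear_scale[OF bounded_linear.linear[OF has_derivative_bounded_linear[OF f]], of "s n" e]
      by (simp add: add.commute scaleR_diff_right)
    then show ?thesis using False s[of n] by (simp add: divide_inverse)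
  qed
  ultimately have "(\<lambda>n. norm ((f (s n *\<^sub>R e + x) - f x) /\<^sub>R s n - f' e)) \<longlonglongrightarrow> 0"
    by (simp only: mult_zero_right)
  then have "(\<lambda>n. (f (s n *\<^sub>R e + x) - f x) /\<^sub>R s n) \<longlonglongrightarrow> f' e"
    by (simp only: tendsto_norm_zero_iff LIM_zero_iff)
  then show ?thesis unfolding s_def .
qed

lemma borel_measurable_derivative:
  fixes f :: "'a::euclidean_space \<Rightarrow> 'b::euclidean_space"
  assumes der: "\<And>x. (f has_derivative f' x) (at x)"
  shows "(\<lambda>x. f' x e) \<in> borel_measurable borel"
proof (rule borel_measurable_LIMSEQ_metric[OF _ difference_quotient_tendsto[OF der]])
  have "continuous_on UNIV f"
    using der by (auto intro!: continuous_at_imp_continuous_on has_derivative_continuous)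
  then have [measurable]: "f \<in> borel_measurable borel" by (intro borel_measurable_continuous_onI)
  show "(\<lambda>x. (f ((1 / real (Suc n)) *\<^sub>R e + x) - f x) /\<^sub>R (1 / real (Suc n))) \<in> borel_measurable borel" for n
    by measurable
qed

text \<open>
  The integral of a difference quotient of \<open>w\<close> vanishes by translation invariance,
  and the Lipschitz constant dominates all these quotients on a fixed ball.
\<close>

lemma integral_derivative_eq_0:
  fixes w :: "'a::euclidean_space \<Rightarrow> complex"
  assumes lip: "L-lipschitz_on UNIV w" and supp: "\<And>x. R < norm x \<Longrightarrow> w x = 0"
    and der: "\<And>x. (w has_derivative w' x) (at x)"
  shows "integrable lborel (\<lambda>x. w' x e)" "(LINT x|lborel. w' x e) = 0"
proof -
  have cont: "continuous_on UNIV w" using lip by (rule lipschitz_on_continuous_on)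
  have [measurable]: "w \<in> borel_measurable borel" by (intro borel_measurable_continuous_onI cont)
  define s where "s = (\<lambda>n::nat. 1 / real (Suc n))"
  have s: "0 < s n" "s n \<le> 1" for n by (auto simp: s_def)
  define h where "h = (\<lambda>n x. (w (s n *\<^sub>R e + x) - w x) /\<^sub>R s n)"
  have [measurable]: "h n \<in> borel_measurable borel" for n unfolding h_def by measurable
  have lim: "(\<lambda>n. h n x) \<longlonglongrightarrow> w' x e" for x
    unfolding h_def s_def by (rule difference_quotient_tendsto[OF der])
  define B where "B = cball (0::'a) (R + norm e)"
  have bound: "norm (h n x) \<le> L * norm e * indicator B x" for n x
  proof (cases "x \<in> B")
    case True
    have "norm (w (s n *\<^sub>R e + x) - w x) \<le> L * norm (s n *\<^sub>R e)"
      using lipschitz_onD[OF lip, of "s n *\<^sub>R e + x" x] by (simp add: dist_norm)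
    also have "\<dots> = L * norm e * s n" using s(1)[of n] by simp
    finally have "norm (w (s n *\<^sub>R e + x) - w x) / s n \<le> L * norm e"
      using s(1)[of n] by (simp add: divide_le_eq)
    moreover have "norm (h n x) = norm (w (s n *\<^sub>R e + x) - w x) / s n"
      using s(1)[of n] by (simp add: h_def divide_inverse mult.commute)
    ultimately show ?thesis using True by simp
  next
    case False
    then have n: "norm x > R + norm e" by (simp add: B_def)
    have "norm (s n *\<^sub>R e) \<le> norm e" using s[of n] by (simp add: mult_left_le_one_le)
    moreover have "norm x \<le> norm (s n *\<^sub>R e + x) + norm (s n *\<^sub>R e)"
      using norm_triangle_ineq4[of "s n *\<^sub>R e + x" "s n *\<^sub>R e"] by simp
    moreover have "0 \<le> norm e" by simp
    ultimately have "norm (s n *\<^sub>R e + x) > R" "norm x > R" using n by linarith+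
    then show ?thesis using supp False by (simp add: h_def)
  qed
  have int_bound: "integrable lborel (\<lambda>x. L * norm e * indicator B x)"
    unfolding B_def by (intro integrable_mult_right integrable_real_indicator emeasure_bounded_finite) auto
  have w'_meas: "(\<lambda>x. w' x e) \<in> borel_measurable lborel"
    using borel_measurable_derivative[OF der] by simp
  show "integrable lborel (\<lambda>x. w' x e)"
    by (rule integrable_dominated_convergence[where s=h, OF w'_meas _ int_bound AE_I2[OF lim] AE_I2[OF bound]]) simp
  have "(\<lambda>n. LINT x|lborel. h n x) \<longlonglongrightarrow> (LINT x|lborel. w' x e)"
    by (rule integral_dominated_convergence[where s=h, OF w'_meas _ int_bound AE_I2[OF lim] AE_I2[OF bound]]) simp
  moreover have "(LINT x|lborel. h n x) = 0" for n
  proof -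
    have "bounded (w ` cball 0 R)"
      by (intro compact_imp_bounded compact_continuous_image continuous_on_subset[OF cont]) auto
    then obtain D where "\<forall>z\<in>w ` cball 0 R. norm z \<le> D"
      unfolding bounded_iff by blast
    then have D: "norm (w x) \<le> D" if "x \<in> cball 0 R" for x
      using that by blast
    have int_w: "integrable lborel w"
    proof (rule Bochner_Integration.integrable_bound)
      show "integrable lborel (\<lambda>x. D * indicator (cball (0::'a) R) x)"
        by (intro integrable_mult_right integrable_real_indicator emeasure_bounded_finite) auto
      show "AE x in lborel. norm (w x) \<le> norm (D * indicator (cball 0 R) x)"
      proof (rule AE_I2)
        fix x
        show "norm (w x) \<le> norm (D * indicator (cball 0 R) x)"
          using D[of x] supp[of x] by (cases "x \<in> cball 0 R") (auto simp: not_le)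
      qed
    qed simp
    have trans: "(LINT x|lborel. w (c + x)) = (LINT x|lborel. w x)" "integrable lborel (\<lambda>x. w (c + x))" for c
    proof -
      have "(LINT x|lborel. w (c + x)) = (LINT x|distr lborel borel ((+) c). w x)"
        by (rule integral_distr[symmetric]) measurable
      then show "(LINT x|lborel. w (c + x)) = (LINT x|lborel. w x)"
        by (simp only: lborel_distr_plus)
      have "integrable (distr lborel borel ((+) c)) w"
        using int_w by (simp only: lborel_distr_plus)
      then show "integrable lborel (\<lambda>x. w (c + x))"
        by (rule integrable_distr[rotated]) measurable
    qed
    show ?thesis unfolding h_def using trans int_w by simp
  qed
  ultimately show "(LINT x|lborel. w' x e) = 0" by (simp add: LIMSEQ_const_iff)
qed

lemma test_function_lipschitz:
  fixes \<phi> :: "real ^ 'n::finite \<Rightarrow> real"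
  assumes "test_function \<phi>"
  obtains L where "L-lipschitz_on UNIV \<phi>"
proof -
  have der: "(\<phi> has_derivative frechet_derivative \<phi> (at x)) (at x)" for x
  proof -
    have "Ck 1 \<phi>" using assms unfolding test_function_def by blast
    then show ?thesis by (auto intro: has_derivative_differentiable_on_UNIV)
  qed
  have "\<exists>B. \<forall>x. \<bar>partial_deriv i \<phi> x\<bar> \<le> B" for i
    by (rule test_function_bounded[OF test_function_partial_deriv[OF assms]]) blast
  then obtain B where B: "\<And>i x. \<bar>partial_deriv i \<phi> x\<bar> \<le> B i" by metis
  have "norm (frechet_derivative \<phi> (at x) v) \<le> (\<Sum>i\<in>UNIV. B i) * norm v" for x v
  proof -
    interpret D: bounded_linear "frechet_derivative \<phi> (at x)" using der by (rule has_derivative_bounded_linear)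
    have "v = (\<Sum>i\<in>UNIV. v $ i *\<^sub>R axis i 1)"
      by (simp add: vec_eq_iff axis_def if_distrib[of "\<lambda>x. _ * x"] cong: if_cong)
    then have "frechet_derivative \<phi> (at x) v = frechet_derivative \<phi> (at x) (\<Sum>i\<in>UNIV. v $ i *\<^sub>R axis i 1)"
      by (rule arg_cong)
    also have "\<dots> = (\<Sum>i\<in>UNIV. v $ i * partial_deriv i \<phi> x)"
      by (simp only: D.sum D.scaleR partial_deriv_def real_scaleR_def)
    finally have "norm (frechet_derivative \<phi> (at x) v) = \<bar>\<Sum>i\<in>UNIV. v $ i * partial_deriv i \<phi> x\<bar>"
      by simp
    also have "\<dots> \<le> (\<Sum>i\<in>UNIV. norm v * B i)"
      by (rule order_trans[OF sum_abs]) (intro sum_mono, auto simp: abs_mult intro!: mult_mono B component_le_norm_cart)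
    finally show ?thesis by (simp add: sum_distrib_left mult.commute)
  qed
  then have "onorm (frechet_derivative \<phi> (at x)) \<le> (\<Sum>i\<in>UNIV. B i)" for x
    by (rule onorm_le)
  then have "norm (\<phi> x - \<phi> y) \<le> (\<Sum>i\<in>UNIV. B i) * norm (x - y)" for x y
    using der by (intro differentiable_bound[where S=UNIV and f'="\<lambda>x. frechet_derivative \<phi> (at x)"]) auto
  moreover have "(\<Sum>i\<in>UNIV. B i) \<ge> 0"
    by (intro sum_nonneg) (meson B abs_ge_zero order_trans)
  ultimately show ?thesis
    by (intro that lipschitz_onI) (auto simp: dist_norm)
qed

lemma absolutely_integrable_continuous_compact:
  fixes f :: "'a::euclidean_space \<Rightarrow> 'b::euclidean_space"
  assumes "compact K" "continuous_on K f"
  shows "f absolutely_integrable_on K"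
proof -
  have "integrable lborel (\<lambda>x. indicator K x *\<^sub>R f x)"
    by (rule borel_integrable_compact[OF assms])
  then show ?thesis
    unfolding set_integrable_def by (subst integrable_completion) auto
qed

text \<open>
  The product of \<open>u\<close> with a test function is again Lipschitz with bounded support.
  Differentiability everywhere together with the Lipschitz bound is what survives composition with
  a bi-Lipschitz diffeomorphism that is not continuously differentiable.
\<close>

lemma integration_by_parts:
  fixes u :: "real ^ 'n::finite \<Rightarrow> complex"
  assumes lip: "L-lipschitz_on UNIV u" and bnd: "\<And>x. cmod (u x) \<le> B"
    and der: "\<And>x. (u has_derivative u' x) (at x)" and \<phi>: "test_function \<phi>"
  shows "(LINT x|lebesgue. partial_deriv i \<phi> x *\<^sub>R u x) = - (LINT x|lebesgue. \<phi> x *\<^sub>R u' x (axis i 1))"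
proof -
  obtain L1 where L1: "L1-lipschitz_on UNIV \<phi>" using test_function_lipschitz[OF \<phi>] .
  obtain C K where K: "compact K" "\<And>x. x \<notin> K \<Longrightarrow> \<phi> x = 0" "\<And>x. \<bar>\<phi> x\<bar> \<le> C" "C \<ge> 0"
    by (rule test_function_bounded[OF \<phi>]) blast
  have B: "B \<ge> 0" using bnd[of 0] norm_ge_zero order_trans by blast
  have L: "L \<ge> 0" "L1 \<ge> 0" using lip L1 lipschitz_on_nonneg by blast+
  obtain R where R: "\<And>x. x \<in> K \<Longrightarrow> norm x \<le> R" using compact_imp_bounded[OF K(1)] by (auto simp: bounded_iff)
  define w where "w = (\<lambda>x. \<phi> x *\<^sub>R u x)"
  have der_\<phi>: "(\<phi> has_derivative frechet_derivative \<phi> (at x)) (at x)" for x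
  proof -
    have "Ck 1 \<phi>" using \<phi> unfolding test_function_def by blast
    then show ?thesis by (auto intro: has_derivative_differentiable_on_UNIV)
  qed
  have w_lip: "(C * L + L1 * B)-lipschitz_on UNIV w"
  proof (rule lipschitz_onI)
    fix x y
    have "w x - w y = \<phi> x *\<^sub>R (u x - u y) + (\<phi> x - \<phi> y) *\<^sub>R u y" by (simp add: w_def algebra_simps)
    then have "norm (w x - w y) \<le> norm (\<phi> x *\<^sub>R (u x - u y)) + norm ((\<phi> x - \<phi> y) *\<^sub>R u y)"
      by (simp only: norm_triangle_ineq)
    also have "\<dots> = \<bar>\<phi> x\<bar> * cmod (u x - u y) + \<bar>\<phi> x - \<phi> y\<bar> * cmod (u y)"
      by simp
    also have "\<dots> \<le> C * (L * dist x y) + (L1 * dist x y) * B"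
    proof (intro add_mono mult_mono)
      show "cmod (u x - u y) \<le> L * dist x y" "\<bar>\<phi> x - \<phi> y\<bar> \<le> L1 * dist x y"
        using lipschitz_onD[OF lip, of x y] lipschitz_onD[OF L1, of x y] by (simp_all add: dist_norm)
    qed (use K(3,4) bnd L in auto)
    finally show "dist (w x) (w y) \<le> (C * L + L1 * B) * dist x y" by (simp add: dist_norm algebra_simps)
  qed (use K(4) L B in auto)
  have w_supp: "w x = 0" if "R < norm x" for x
    using that R[of x] K(2)[of x] by (cases "x \<in> K") (auto simp: w_def)
  have w_der: "(w has_derivative (\<lambda>h. \<phi> x *\<^sub>R u' x h + frechet_derivative \<phi> (at x) h *\<^sub>R u x)) (at x)" for x
    unfolding w_def by (rule has_derivative_scaleR[OF der_\<phi> der])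
  note int = integral_derivative_eq_0[OF w_lip w_supp w_der, where e="axis i 1", folded partial_deriv_def]
  have uc: "continuous_on UNIV u" using lip by (rule lipschitz_on_continuous_on)
  have "u absolutely_integrable_on K'" if "compact K'" for K'
    using that continuous_on_subset[OF uc subset_UNIV] by (rule absolutely_integrable_continuous_compact)
  then have int1: "integrable lebesgue (\<lambda>x. partial_deriv i \<phi> x *\<^sub>R u x)"
    by (rule integrable_test_function_scaleR[OF test_function_partial_deriv[OF \<phi>]])
  have int': "integrable lebesgue (\<lambda>x. \<phi> x *\<^sub>R u' x (axis i 1) + partial_deriv i \<phi> x *\<^sub>R u x)"
    "(LINT x|lebesgue. \<phi> x *\<^sub>R u' x (axis i 1) + partial_deriv i \<phi> x *\<^sub>R u x) = 0"
    using int borel_measurable_integrable[OF int(1)] by (simp_all only: integrable_completion integral_completion)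
  have int2: "integrable lebesgue (\<lambda>x. \<phi> x *\<^sub>R u' x (axis i 1))"
    using Bochner_Integration.integrable_diff[OF int'(1) int1] by simp
  show ?thesis using int'(2) int1 int2 by (simp add: eq_neg_iff_add_eq_0 add.commute)
qed

section \<open>Change of variables over an arbitrary finite index type\<close>

text \<open>
  A well-ordered copy of a finite type. Change of variables is applied over a well-ordered index
  type and carried over to an arbitrary one by renaming coordinates, which preserves Lebesgue
  measure and determinants.
\<close>

typedef ('n::finite) wo = "{i::nat. i < CARD('n)}" morphisms wo_rank wo_of
  by (rule exI[of _ 0]) simp

instantiation wo :: (finite) linorder
begin

definition less_eq_wo :: "'a wo \<Rightarrow> 'a wo \<Rightarrow> bool" where
  "less_eq_wo x y \<longleftrightarrow> wo_rank x \<le> wo_rank y"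

definition less_wo :: "'a wo \<Rightarrow> 'a wo \<Rightarrow> bool" where
  "less_wo x y \<longleftrightarrow> wo_rank x < wo_rank y"

instance
proof
  fix x y z :: "'a wo"
  show "x < y \<longleftrightarrow> x \<le> y \<and> \<not> y \<le> x" "x \<le> x" "x \<le> y \<Longrightarrow> y \<le> z \<Longrightarrow> x \<le> z" "x \<le> y \<or> y \<le> x"
    unfolding less_eq_wo_def less_wo_def by linarith+
  show "x \<le> y \<Longrightarrow> y \<le> x \<Longrightarrow> x = y"
    unfolding less_eq_wo_def by (metis le_antisym wo_rank_inject)
qed

end

instance wo :: (finite) wellorder
proof
  fix P :: "'a wo \<Rightarrow> bool" and a
  assume step: "\<And>x. (\<And>y. y < x \<Longrightarrow> P y) \<Longrightarrow> P x"
  show "P a"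
  proof (rule measure_induct_rule[of wo_rank P a])
    show "P x" if "\<And>y. wo_rank y < wo_rank x \<Longrightarrow> P y" for x
      by (rule step) (use that in \<open>simp only: less_wo_def\<close>)
  qed
qed

lemma wo_UNIV: "wo_rank ` (UNIV :: 'n::finite wo set) = {i. i < CARD('n)}"
  using type_definition.Rep_range[OF type_definition_wo] by simp

instance wo :: (finite) finite
proof
  have "finite (wo_rank ` (UNIV :: 'a wo set))" by (simp add: wo_UNIV)
  then show "finite (UNIV :: 'a wo set)"
    by (rule finite_imageD) (simp add: inj_on_def wo_rank_inject)
qed

lemma ex_bij_wo: "\<exists>\<rho> :: 'n::finite wo \<Rightarrow> 'n. bij \<rho>"
proof -
  have "card (UNIV :: 'n wo set) = card (wo_rank ` (UNIV :: 'n wo set))"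
    by (rule card_image[symmetric]) (simp add: inj_on_def wo_rank_inject)
  also have "\<dots> = card (UNIV :: 'n set)" by (simp add: wo_UNIV)
  finally have "card (UNIV :: 'n wo set) = card (UNIV :: 'n set)" .
  then show ?thesis
    by (intro finite_same_card_bij) auto
qed

lemma swapidseq_conj:
  assumes "swapidseq n p" and \<rho>: "bij \<rho>"
  shows "swapidseq n (\<rho> \<circ> p \<circ> inv \<rho>)"
  using assms(1)
proof induction
  case id
  have "\<rho> \<circ> id \<circ> inv \<rho> = id"
    using bij_is_surj[OF \<rho>] by (simp add: fun_eq_iff surj_f_inv_f)
  then show ?case by (simp only: swapidseq.id)
next
  case (comp_Suc n p a b)
  have "\<rho> \<circ> (Transposition.transpose a b \<circ> p) \<circ> inv \<rho> = Transposition.transpose (\<rho> a) (\<rho> b) \<circ> (\<rho> \<circ> p \<circ> inv \<rho>)"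
    using \<rho> by (auto simp: fun_eq_iff Transposition.transpose_def bij_is_inj inj_eq)
  moreover have "\<rho> a \<noteq> \<rho> b" using \<rho> comp_Suc by (simp add: bij_is_inj inj_eq)
  ultimately show ?case
    using swapidseq.comp_Suc[of n "\<rho> \<circ> p \<circ> inv \<rho>" "\<rho> a" "\<rho> b"] comp_Suc.IH by metis
qed

lemma sign_conj:
  fixes \<rho> :: "'a::finite \<Rightarrow> 'b::finite"
  assumes \<rho>: "bij \<rho>" and p: "p permutes UNIV"
  shows "sign (\<rho> \<circ> p \<circ> inv \<rho>) = sign p"
proof -
  have "permutation p" using p by (auto simp: permutation_permutes)
  then obtain n where n: "swapidseq n p" by (auto simp: permutation_def)
  have "evenperm p \<longleftrightarrow> even n" "evenperm (\<rho> \<circ> p \<circ> inv \<rho>) \<longleftrightarrow> even n"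
    using evenperm_unique[OF n refl] evenperm_unique[OF swapidseq_conj[OF n \<rho>] refl] by simp_all
  then show ?thesis by (simp add: sign_def)
qed

text \<open>
  Conjugation by \<open>\<rho>\<close> matches the permutations of the two index types and
  preserves signs, since it maps transpositions to transpositions.
\<close>

lemma det_reindex:
  fixes A :: "real ^ 'n ^ 'n::finite" and \<rho> :: "'k::finite \<Rightarrow> 'n"
  assumes \<rho>: "bij \<rho>"
  shows "det (\<chi> i j. A $ \<rho> i $ \<rho> j) = det A"
proof -
  define c where "c = (\<lambda>p::'k \<Rightarrow> 'k. \<rho> \<circ> p \<circ> inv \<rho>)"
  have inv_\<rho>: "inv \<rho> (\<rho> x) = x" "\<rho> (inv \<rho> y) = y" for x y
    using \<rho> by (simp_all add: bij_is_inj bij_is_surj surj_f_inv_f)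
  have permutes_UNIV_eq_bij: "p permutes UNIV \<longleftrightarrow> bij p" for p :: "'z \<Rightarrow> 'z"
    by (simp add: permutes_altdef)
  have bij_c: "bij_betw c {p. p permutes UNIV} {p. p permutes UNIV}"
  proof (rule bij_betw_byWitness[where f'="\<lambda>q. inv \<rho> \<circ> q \<circ> \<rho>"])
    show "c ` {p. p permutes UNIV} \<subseteq> {p. p permutes UNIV}"
      using \<rho> by (auto simp: c_def permutes_UNIV_eq_bij bij_imp_bij_inv intro!: bij_comp)
    show "(\<lambda>q. inv \<rho> \<circ> q \<circ> \<rho>) ` {p. p permutes UNIV} \<subseteq> {p. p permutes UNIV}"
      using \<rho> by (auto simp: permutes_UNIV_eq_bij bij_imp_bij_inv intro!: bij_comp)
  qed (auto simp: c_def fun_eq_iff inv_\<rho>)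
  have "det A = (\<Sum>q\<in>{p. p permutes UNIV}. of_int (sign q) * (\<Prod>i\<in>UNIV. A $ i $ q i))"
    by (simp add: det_def)
  also have "\<dots> = (\<Sum>p\<in>{p. p permutes UNIV}. of_int (sign (c p)) * (\<Prod>i\<in>UNIV. A $ i $ c p i))"
    by (rule sum.reindex_bij_betw[OF bij_c, symmetric])
  also have "\<dots> = (\<Sum>p\<in>{p. p permutes UNIV}. of_int (sign p) * (\<Prod>i\<in>UNIV. A $ \<rho> i $ \<rho> (p i)))"
  proof (intro sum.cong refl)
    fix p :: "'k \<Rightarrow> 'k" assume p: "p \<in> {p. p permutes UNIV}"
    have "(\<Prod>i\<in>UNIV. A $ i $ c p i) = (\<Prod>i\<in>UNIV. A $ \<rho> i $ c p (\<rho> i))"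
      by (rule prod.reindex_bij_betw[OF \<rho>, symmetric])
    then show "of_int (sign (c p)) * (\<Prod>i\<in>UNIV. A $ i $ c p i) = of_int (sign p) * (\<Prod>i\<in>UNIV. A $ \<rho> i $ \<rho> (p i))"
      using sign_conj[OF \<rho>] p by (simp add: c_def inv_\<rho>)
  qed
  also have "\<dots> = det (\<chi> i j. A $ \<rho> i $ \<rho> j)"
    by (simp add: det_def)
  finally show ?thesis ..
qed

definition reindex :: "('k \<Rightarrow> 'n) \<Rightarrow> real ^ 'n \<Rightarrow> real ^ 'k" where
  "reindex \<rho> x = (\<chi> i. x $ \<rho> i)"

lemma linear_reindex: "linear (reindex \<rho>)"
  by (rule linearI) (simp_all add: reindex_def vec_eq_iff)

lemma bounded_linear_reindex: "bounded_linear (reindex (\<rho> :: 'k::finite \<Rightarrow> 'n::finite))"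
  using linear_reindex by (rule linear_conv_bounded_linear[THEN iffD1])

lemma continuous_reindex: "continuous_on S (reindex (\<rho> :: 'k::finite \<Rightarrow> 'n::finite))"
  using bounded_linear_reindex by (rule linear_continuous_on)

lemma measurable_reindex [measurable]: "reindex (\<rho> :: 'k::finite \<Rightarrow> 'n::finite) \<in> borel_measurable borel"
  by (intro borel_measurable_continuous_onI continuous_reindex)

lemma distr_reindex:
  fixes \<rho> :: "'k::finite \<Rightarrow> 'n::finite"
  assumes \<rho>: "bij \<rho>"
  shows "distr lborel borel (reindex \<rho>) = lborel"
proof (rule lborel_eqI[symmetric])
  have inv_\<rho>: "inv \<rho> (\<rho> x) = x" "\<rho> (inv \<rho> y) = y" for x y
    using \<rho> by (simp_all add: bij_is_inj bij_is_surj surj_f_inv_f)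
  have Basis_eq: "(Basis :: (real ^ 'j::finite) set) = range (\<lambda>i. axis i 1)"
    by (auto simp: Basis_vec_def)
  have prod_eq: "(\<Prod>b\<in>Basis. x \<bullet> b) = (\<Prod>i\<in>UNIV. x $ i)" for x :: "real ^ 'j::finite"
    unfolding Basis_eq by (subst prod.reindex) (auto simp: inj_on_def axis_eq_axis inner_axis)
  fix l u :: "real ^ 'k"
  assume le: "\<And>b. b \<in> Basis \<Longrightarrow> l \<bullet> b \<le> u \<bullet> b"
  then have le': "l $ i \<le> u $ i" for i
    using le[of "axis i 1"] by (simp add: Basis_eq inner_axis)
  have pre: "reindex \<rho> -` box l u = box (reindex (inv \<rho>) l) (reindex (inv \<rho>) u)"
  proof (rule set_eqI)
    fix x :: "real ^ 'n"
    have "(\<forall>i. l $ i < x $ \<rho> i \<and> x $ \<rho> i < u $ i) \<longleftrightarrow> (\<forall>i. l $ inv \<rho> i < x $ i \<and> x $ i < u $ inv \<rho> i)"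
      by (metis inv_\<rho>)
    then show "x \<in> reindex \<rho> -` box l u \<longleftrightarrow> x \<in> box (reindex (inv \<rho>) l) (reindex (inv \<rho>) u)"
      by (simp add: mem_box_cart reindex_def)
  qed
  have "emeasure (distr lborel borel (reindex \<rho>)) (box l u) = emeasure lborel (reindex \<rho> -` box l u)"
    by (subst emeasure_distr) auto
  also have "\<dots> = ennreal (\<Prod>b\<in>Basis. (reindex (inv \<rho>) u - reindex (inv \<rho>) l) \<bullet> b)"
    unfolding pre by (rule emeasure_lborel_box) (auto simp: Basis_eq inner_axis reindex_def le')
  also have "\<dots> = ennreal (\<Prod>i\<in>UNIV. u $ inv \<rho> i - l $ inv \<rho> i)"
    by (subst prod_eq) (simp add: reindex_def)
  also have "\<dots> = ennreal (\<Prod>i\<in>UNIV. u $ i - l $ i)"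
    using prod.reindex_bij_betw[OF bij_imp_bij_inv[OF \<rho>], of "\<lambda>i. u $ i - l $ i"] by simp
  also have "\<dots> = ennreal (\<Prod>b\<in>Basis. (u - l) \<bullet> b)"
    by (subst prod_eq) simp
  finally show "emeasure (distr lborel borel (reindex \<rho>)) (box l u) = ennreal (\<Prod>b\<in>Basis. (u - l) \<bullet> b)" .
qed simp

lemma nn_integral_reindex:
  fixes \<rho> :: "'k::finite \<Rightarrow> 'n::finite"
  assumes "bij \<rho>" and [measurable]: "f \<in> borel_measurable borel"
  shows "(\<integral>\<^sup>+x. f (reindex \<rho> x) \<partial>lborel) = (\<integral>\<^sup>+x. f x \<partial>lborel)"
proof -
  have "(\<integral>\<^sup>+x. f x \<partial>distr lborel borel (reindex \<rho>)) = (\<integral>\<^sup>+x. f (reindex \<rho> x) \<partial>lborel)"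
    by (rule nn_integral_distr) measurable
  then show ?thesis by (simp only: distr_reindex[OF assms(1)])
qed

lemma borel_measurable_det_derivative:
  fixes \<psi> :: "real ^ 'n::finite \<Rightarrow> real ^ 'n"
  assumes "\<And>x. (\<psi> has_derivative \<psi>' x) (at x)"
  shows "(\<lambda>x. det (matrix (\<psi>' x))) \<in> borel_measurable borel"
proof -
  have [measurable]: "(\<lambda>x. \<psi>' x e) \<in> borel_measurable borel" for e
    by (rule borel_measurable_derivative[OF assms])
  show ?thesis unfolding det_def matrix_def by simp measurable
qed

text \<open>
  If one of the sides is finite, this is change of variables for absolutely integrable functions,
  which includes that both are; otherwise both sides are infinite.
\<close>

lemma nn_integral_change_of_variables_wo:
  fixes \<psi> :: "(real, 'n::{finite,wellorder}) vec \<Rightarrow> (real, 'n) vec" and u :: "(real, 'n) vec \<Rightarrow> real"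
  assumes bij: "bij \<psi>" and der: "\<And>x. (\<psi> has_derivative \<psi>' x) (at x)"
    and cont: "continuous_on UNIV (inv \<psi>)"
    and u [measurable]: "u \<in> borel_measurable borel" and nn: "\<And>x. 0 \<le> u x"
  shows "(\<integral>\<^sup>+z. ennreal (u (inv \<psi> z)) \<partial>lborel) = (\<integral>\<^sup>+y. ennreal (\<bar>det (matrix (\<psi>' y))\<bar> * u y) \<partial>lborel)"
proof -
  have [measurable]: "inv \<psi> \<in> borel_measurable borel" by (intro borel_measurable_continuous_onI cont)
  have [measurable]: "(\<lambda>x. det (matrix (\<psi>' x))) \<in> borel_measurable borel"
    by (rule borel_measurable_det_derivative[OF der])
  define f where "f = (\<lambda>z. u (inv \<psi> z))"
  define g where "g = (\<lambda>y. \<bar>det (matrix (\<psi>' y))\<bar> * u y)"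
  have fg: "\<bar>det (matrix (\<psi>' y))\<bar> *\<^sub>R (vec (f (\<psi> y)) :: real ^ 1) = vec (g y)" for y
    using bij by (simp add: f_def g_def bij_is_inj vec_eq_iff)
  have vec_ai: "(\<lambda>x. vec (w x) :: real ^ 1) absolutely_integrable_on UNIV \<longleftrightarrow> w absolutely_integrable_on UNIV"
    and vec_int: "w absolutely_integrable_on UNIV \<Longrightarrow> integral UNIV (\<lambda>x. vec (w x) :: real ^ 1) = vec (integral UNIV w)"
    for w :: "(real, 'n) vec \<Rightarrow> real"
  proof -
    have bl: "bounded_linear (\<lambda>x::real. vec x :: real ^ 1)"
      by (intro linear_conv_bounded_linear[THEN iffD1] linearI) (simp_all add: vec_eq_iff)
    show "(\<lambda>x. vec (w x) :: real ^ 1) absolutely_integrable_on UNIV \<longleftrightarrow> w absolutely_integrable_on UNIV"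
    proof
      assume "(\<lambda>x. vec (w x) :: real ^ 1) absolutely_integrable_on UNIV"
      from absolutely_integrable_linear[OF this bounded_linear_vec_nth[of 1]]
      show "w absolutely_integrable_on UNIV" by (simp add: o_def)
    next
      assume "w absolutely_integrable_on UNIV"
      from absolutely_integrable_linear[OF this bl]
      show "(\<lambda>x. vec (w x) :: real ^ 1) absolutely_integrable_on UNIV" by (simp add: o_def)
    qed
    assume "w absolutely_integrable_on UNIV"
    then have "w integrable_on UNIV" by (rule set_lebesgue_integral_eq_integral(1))
    from integral_linear[OF this bl] show "integral UNIV (\<lambda>x. vec (w x) :: real ^ 1) = vec (integral UNIV w)"
      by (simp add: o_def)
  qed
  have "g absolutely_integrable_on UNIV \<and> vec (integral UNIV g) = (b :: real ^ 1) \<longleftrightarrow>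
      f absolutely_integrable_on UNIV \<and> vec (integral UNIV f) = b" for b
  proof -
    have "inj_on \<psi> UNIV" "range \<psi> = UNIV" using bij by (simp_all add: bij_is_inj bij_is_surj)
    then show ?thesis
      using has_absolute_integral_change_of_variables[of UNIV \<psi> \<psi>' "\<lambda>z. vec (f z) :: real ^ 1" b] der
      by (simp add: fg vec_ai vec_int cong: conj_cong)
  qed
  from this[of "vec (integral UNIV g)"] this[of "vec (integral UNIV f)"]
  have iff: "g absolutely_integrable_on UNIV \<longleftrightarrow> f absolutely_integrable_on UNIV"
    and eq: "g absolutely_integrable_on UNIV \<Longrightarrow> integral UNIV g = integral UNIV f"
    by (auto simp: vec_eq_iff)
  have fin: "(\<integral>\<^sup>+x. ennreal (w x) \<partial>lborel) < \<infinity> \<longleftrightarrow> w absolutely_integrable_on UNIV"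
    and val: "w absolutely_integrable_on UNIV \<Longrightarrow> (\<integral>\<^sup>+x. ennreal (w x) \<partial>lborel) = ennreal (integral UNIV w)"
    if [measurable]: "w \<in> borel_measurable borel" and "\<And>x. 0 \<le> w x" for w :: "(real, 'n) vec \<Rightarrow> real"
  proof -
    have ai: "w absolutely_integrable_on UNIV \<longleftrightarrow> integrable lborel w"
      by (simp add: set_integrable_def integrable_completion)
    then show "(\<integral>\<^sup>+x. ennreal (w x) \<partial>lborel) < \<infinity> \<longleftrightarrow> w absolutely_integrable_on UNIV"
      using that by (simp add: integrable_iff_bounded)
    assume "w absolutely_integrable_on UNIV"
    then have w: "integrable lborel w" by (simp add: ai)
    then show "(\<integral>\<^sup>+x. ennreal (w x) \<partial>lborel) = ennreal (integral UNIV w)"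
      using that by (simp add: nn_integral_eq_integral integral_lborel)
  qed
  have f: "f \<in> borel_measurable borel" "\<And>x. 0 \<le> f x" and g: "g \<in> borel_measurable borel" "\<And>x. 0 \<le> g x"
    unfolding f_def g_def using nn by (auto intro!: mult_nonneg_nonneg)
  show ?thesis
  proof (cases "g absolutely_integrable_on UNIV")
    case True
    then show ?thesis
      using val[OF f] val[OF g] iff eq unfolding f_def g_def by simp
  next
    case False
    then have "\<not> (\<integral>\<^sup>+x. ennreal (f x) \<partial>lborel) < \<infinity>" "\<not> (\<integral>\<^sup>+x. ennreal (g x) \<partial>lborel) < \<infinity>"
      using iff fin[OF f] fin[OF g] by simp_all
    then show ?thesis unfolding f_def g_def by (simp add: not_less top_unique)
  qed
qed

theorem nn_integral_change_of_variables:
  fixes \<psi> :: "real ^ 'n::finite \<Rightarrow> real ^ 'n" and u :: "real ^ 'n \<Rightarrow> real"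
  assumes bij: "bij \<psi>" and der: "\<And>x. (\<psi> has_derivative \<psi>' x) (at x)"
    and cont: "continuous_on UNIV (inv \<psi>)"
    and u [measurable]: "u \<in> borel_measurable borel" and nn: "\<And>x. 0 \<le> u x"
  shows "(\<integral>\<^sup>+z. ennreal (u (inv \<psi> z)) \<partial>lborel) = (\<integral>\<^sup>+y. ennreal (\<bar>det (matrix (\<psi>' y))\<bar> * u y) \<partial>lborel)"
proof -
  obtain \<rho> :: "'n wo \<Rightarrow> 'n" where \<rho>: "bij \<rho>" using ex_bij_wo by blast
  have inv_\<rho>: "inv \<rho> (\<rho> x) = x" "\<rho> (inv \<rho> y) = y" for x y
    using \<rho> by (simp_all add: bij_is_inj bij_is_surj surj_f_inv_f)
  define P where "P = (reindex \<rho> :: real ^ 'n \<Rightarrow> real ^ 'n wo)"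
  define Q where "Q = (reindex (inv \<rho>) :: real ^ 'n wo \<Rightarrow> real ^ 'n)"
  have PQ: "P (Q y) = y" "Q (P x) = x" for x y
    by (simp_all add: P_def Q_def reindex_def vec_eq_iff inv_\<rho>)
  define \<psi>w where "\<psi>w = (\<lambda>y. P (\<psi> (Q y)))"
  define \<psi>w' where "\<psi>w' = (\<lambda>y e. P (\<psi>' (Q y) (Q e)))"
  have [measurable]: "P \<in> borel_measurable borel" "Q \<in> borel_measurable borel"
    by (simp_all add: P_def Q_def)
  have [measurable]: "inv \<psi> \<in> borel_measurable borel" by (intro borel_measurable_continuous_onI cont)
  have [measurable]: "(\<lambda>x. det (matrix (\<psi>' x))) \<in> borel_measurable borel"
    by (rule borel_measurable_det_derivative[OF der])
  have inv_\<psi>: "inv \<psi> (\<psi> x) = x" "\<psi> (inv \<psi> z) = z" for x z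
    using bij by (simp_all add: bij_is_inj bij_is_surj surj_f_inv_f)
  have bij_w: "bij \<psi>w"
    by (rule bij_betw_byWitness[where f'="\<lambda>z. P (inv \<psi> (Q z))"]) (auto simp: \<psi>w_def PQ inv_\<psi>)
  have inv_w: "inv \<psi>w = (\<lambda>z. P (inv \<psi> (Q z)))"
    by (rule inv_unique_comp) (auto simp: fun_eq_iff \<psi>w_def PQ inv_\<psi>)
  have der_w: "(\<psi>w has_derivative \<psi>w' y) (at y)" for y
    unfolding \<psi>w_def \<psi>w'_def P_def Q_def
    by (intro bounded_linear.has_derivative[OF bounded_linear_reindex]
        has_derivative_compose[OF bounded_linear_imp_has_derivative[OF bounded_linear_reindex] der])
  have cont_w: "continuous_on UNIV (inv \<psi>w)"
    unfolding inv_w P_def Q_def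
    by (intro continuous_on_compose2[OF continuous_reindex[of UNIV]] continuous_on_compose2[OF cont] continuous_reindex) auto
  have det_w: "det (matrix (\<psi>w' y)) = det (matrix (\<psi>' (Q y)))" for y
  proof -
    have Q_axis: "Q (axis j 1) = axis (\<rho> j) 1" for j
      unfolding Q_def reindex_def axis_def by (simp add: vec_eq_iff) (metis inv_\<rho>)
    have "matrix (\<psi>w' y) = (\<chi> i j. matrix (\<psi>' (Q y)) $ \<rho> i $ \<rho> j)"
      unfolding \<psi>w'_def matrix_def P_def reindex_def Q_axis by simp
    then show ?thesis by (simp add: det_reindex[OF \<rho>])
  qed
  have "(\<integral>\<^sup>+z. ennreal (u (inv \<psi> z)) \<partial>lborel) = (\<integral>\<^sup>+z. ennreal (u (inv \<psi> (Q z))) \<partial>lborel)"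
    unfolding Q_def by (rule nn_integral_reindex[symmetric, OF bij_imp_bij_inv[OF \<rho>]]) measurable
  also have "\<dots> = (\<integral>\<^sup>+z. ennreal ((\<lambda>y. u (Q y)) (inv \<psi>w z)) \<partial>lborel)"
    by (simp add: inv_w PQ)
  also have "\<dots> = (\<integral>\<^sup>+y. ennreal (\<bar>det (matrix (\<psi>w' y))\<bar> * u (Q y)) \<partial>lborel)"
    by (rule nn_integral_change_of_variables_wo[OF bij_w der_w cont_w]) (use nn in simp_all)
  also have "\<dots> = (\<integral>\<^sup>+y. ennreal (\<bar>det (matrix (\<psi>' (Q y)))\<bar> * u (Q y)) \<partial>lborel)"
    by (simp add: det_w)
  also have "\<dots> = (\<integral>\<^sup>+y. ennreal (\<bar>det (matrix (\<psi>' y))\<bar> * u y) \<partial>lborel)"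
    unfolding Q_def by (rule nn_integral_reindex[OF bij_imp_bij_inv[OF \<rho>]]) measurable
  finally show ?thesis .
qed

section \<open>Borel representatives and Fubini on the product with the torus\<close>

lemma ex_borel_AE_eq:
  fixes f :: "'a::euclidean_space \<Rightarrow> complex"
  assumes f: "f \<in> borel_measurable (lebesgue_on S)" and S: "S \<in> sets borel"
  obtains f' where "f' \<in> borel_measurable borel" "AE x in lborel. x \<in> S \<longrightarrow> f x = f' x"
proof -
  define g where "g = (\<lambda>x. if x \<in> S then f x else 0)"
  have "S \<in> sets lebesgue" using S by (metis sets_completionI_sets sets_lborel)
  then have g: "g \<in> borel_measurable lebesgue"
    unfolding g_def using f by (intro borel_measurable_if_I) auto
  then have "(\<lambda>x. Re (g x)) \<in> borel_measurable (completion lborel)" "(\<lambda>x. Im (g x)) \<in> borel_measurable (completion lborel)"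
    by (auto intro!: measurable_compose[OF g])
  then obtain a b where ab: "a \<in> borel_measurable lborel" "AE x in lborel. Re (g x) = a x"
    "b \<in> borel_measurable lborel" "AE x in lborel. Im (g x) = b x"
    using completion_ex_borel_measurable_real by metis
  show ?thesis
  proof (rule that)
    show "(\<lambda>x. Complex (a x) (b x)) \<in> borel_measurable borel"
    proof -
      have "(\<lambda>x. of_real (a x) + \<i> * of_real (b x)) \<in> borel_measurable borel"
        using ab(1,3) by simp
      then show ?thesis by (simp add: Complex_eq)
    qed
    show "AE x in lborel. x \<in> S \<longrightarrow> f x = Complex (a x) (b x)"
      using ab(2,4) by eventually_elim (auto simp: g_def complex_eq_iff)
  qed
qed

lemma sets_UNIV_times_unit_cell:
  "(UNIV \<times> unit_cell :: ((real ^ 'n::finite) \<times> (real ^ 'm::finite)) set) \<in> sets borel"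
  by (simp add: borel_prod[symmetric] pair_measureI del: borel_prod)

lemma AE_field_measure_iff:
  "(AE p in field_measure. P p) \<longleftrightarrow> (AE p in lborel. snd p \<in> unit_cell \<longrightarrow> P p)"
proof -
  have "(UNIV \<times> unit_cell :: ((real ^ 'a) \<times> (real ^ 'b)) set) \<in> sets lebesgue"
    by (metis sets_UNIV_times_unit_cell sets_completionI_sets sets_lborel)
  then show ?thesis
    unfolding field_measure_def
    by (subst AE_restrict_space_iff) (simp_all add: AE_completion_iff mem_Times_iff)
qed

lemma AE_lborel_pair:
  fixes P :: "'a::euclidean_space \<times> 'b::euclidean_space \<Rightarrow> bool"
  assumes "AE p in lborel. P p"
  shows "AE x in lborel. AE y in lborel. P (x, y)" "AE y in lborel. AE x in lborel. P (x, y)"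
proof -
  have ae: "AE p in (lborel :: 'a measure) \<Otimes>\<^sub>M (lborel :: 'b measure). P p"
    using assms by (simp only: lborel_prod)
  then show 1: "AE x in lborel. AE y in lborel. P (x, y)"
    by (rule lborel_pair.AE_pair)
  from ae obtain N where N: "{p \<in> space (lborel \<Otimes>\<^sub>M lborel). \<not> P p} \<subseteq> N" "N \<in> null_sets (lborel \<Otimes>\<^sub>M lborel)"
    unfolding eventually_ae_filter by auto
  have "AE p in lborel \<Otimes>\<^sub>M lborel. p \<notin> N" using N(2) by (rule AE_not_in)
  then have "AE x in lborel. AE y in lborel. (x, y) \<notin> N" by (rule lborel_pair.AE_pair)
  moreover have "{p \<in> space (lborel \<Otimes>\<^sub>M lborel). (fst p, snd p) \<notin> N} \<in> sets (lborel \<Otimes>\<^sub>M lborel)"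
  proof -
    have "{p \<in> space (lborel \<Otimes>\<^sub>M lborel). (fst p, snd p) \<notin> N} = space (lborel \<Otimes>\<^sub>M lborel) - N"
      by auto
    then show ?thesis using sets.compl_sets[OF null_setsD2[OF N(2)]] by (simp only:)
  qed
  ultimately have "AE y in lborel. AE x in lborel. (x, y) \<notin> N"
    by (subst (asm) lborel_pair.AE_commute) auto
  moreover have "P p" if "p \<notin> N" for p
    using N(1) that by (auto simp: space_pair_measure)
  ultimately show "AE y in lborel. AE x in lborel. P (x, y)"
    by (simp add: eventually_mono)
qed

lemma AE_field_measure:
  fixes P :: "(real ^ 'n::finite) \<times> (real ^ 'm::finite) \<Rightarrow> bool"
  assumes "AE p in field_measure. P p"
  shows "AE \<omega> in torus. AE x in lborel. P (x, \<omega>)" "AE x in lborel. AE \<omega> in torus. P (x, \<omega>)"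
  using AE_lborel_pair[OF assms[unfolded AE_field_measure_iff]] by (simp_all add: AE_torus_iff)

text \<open>
  The torus measure on Borel sets only: products of it with Lebesgue measure need no completion
  for Fubini's theorem.
\<close>

definition torus_borel :: "(real ^ 'm::finite) measure" where
  "torus_borel = distr torus borel (\<lambda>\<omega>. \<omega>)"

lemma measurable_id_torus: "(\<lambda>\<omega>. \<omega>) \<in> measurable torus borel"
  by (rule measurable_torusI) simp

lemma sets_torus_borel [simp, measurable_cong]: "sets torus_borel = sets borel"
  and space_torus_borel [simp]: "space torus_borel = UNIV"
  by (simp_all add: torus_borel_def)

lemma nn_integral_torus_borel:
  "g \<in> borel_measurable borel \<Longrightarrow> (\<integral>\<^sup>+\<omega>. g \<omega> \<partial>torus_borel) = (\<integral>\<^sup>+\<omega>. g \<omega> \<partial>torus)"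
  unfolding torus_borel_def by (subst nn_integral_distr) (simp_all add: measurable_id_torus)

lemma integral_torus_borel:
  fixes g :: "real ^ 'm::finite \<Rightarrow> complex"
  shows "g \<in> borel_measurable borel \<Longrightarrow> (LINT \<omega>|torus_borel. g \<omega>) = (LINT \<omega>|torus. g \<omega>)"
  unfolding torus_borel_def by (subst integral_distr) (simp_all add: measurable_id_torus)

lemma finite_measure_torus_borel: "finite_measure (torus_borel :: (real ^ 'm::finite) measure)"
  unfolding torus_borel_def
  by (rule finite_measure.finite_measure_distr[OF finite_measure_torus measurable_id_torus])

lemma pair_sigma_finite_torus: "pair_sigma_finite lborel (torus_borel :: (real ^ 'm::finite) measure)"
  unfolding pair_sigma_finite_def
  by (intro conjI sigma_finite_lborel finite_measure.axioms(1) finite_measure_torus_borel)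

lemma nn_integral_torus_swap:
  fixes F :: "(real ^ 'n::finite) \<times> (real ^ 'm::finite) \<Rightarrow> ennreal"
  assumes F [measurable]: "F \<in> borel_measurable borel"
  shows "(\<integral>\<^sup>+\<omega>. \<integral>\<^sup>+x. F (x, \<omega>) \<partial>lborel \<partial>torus) = (\<integral>\<^sup>+x. \<integral>\<^sup>+\<omega>. F (x, \<omega>) \<partial>torus \<partial>lborel)"
    and "(\<lambda>\<omega>. \<integral>\<^sup>+x. F (x, \<omega>) \<partial>lborel) \<in> borel_measurable borel"
    and "(\<lambda>x. \<integral>\<^sup>+\<omega>. F (x, \<omega>) \<partial>torus) \<in> borel_measurable borel"
proof -
  interpret P: pair_sigma_finite "lborel :: (real ^ 'n) measure" "torus_borel :: (real ^ 'm) measure"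
    by (rule pair_sigma_finite_torus)
  have F': "F \<in> borel_measurable (lborel \<Otimes>\<^sub>M torus_borel)"
    using F by (simp cong: measurable_cong_sets add: borel_prod[symmetric] del: borel_prod)
  have [measurable]: "(\<lambda>\<omega>. F (x, \<omega>)) \<in> borel_measurable borel" for x by measurable
  have "(\<lambda>\<omega>. \<integral>\<^sup>+x. F (x, \<omega>) \<partial>lborel) \<in> borel_measurable torus_borel"
    using F' by measurable
  then show m1: "(\<lambda>\<omega>. \<integral>\<^sup>+x. F (x, \<omega>) \<partial>lborel) \<in> borel_measurable borel"
    by (simp cong: measurable_cong_sets)
  have "(\<lambda>x. \<integral>\<^sup>+\<omega>. F (x, \<omega>) \<partial>torus_borel) \<in> borel_measurable lborel"
    using F' by measurable
  then show "(\<lambda>x. \<integral>\<^sup>+\<omega>. F (x, \<omega>) \<partial>torus) \<in> borel_measurable borel"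
    by (simp add: nn_integral_torus_borel)
  show "(\<integral>\<^sup>+\<omega>. \<integral>\<^sup>+x. F (x, \<omega>) \<partial>lborel \<partial>torus) = (\<integral>\<^sup>+x. \<integral>\<^sup>+\<omega>. F (x, \<omega>) \<partial>torus \<partial>lborel)"
    using P.Fubini'[of "\<lambda>x \<omega>. F (x, \<omega>)"] F' m1 by (simp add: nn_integral_torus_borel)
qed

lemma integral_torus_swap:
  fixes F :: "(real ^ 'n::finite) \<times> (real ^ 'm::finite) \<Rightarrow> complex"
  assumes F [measurable]: "F \<in> borel_measurable borel"
    and fin: "(\<integral>\<^sup>+x. \<integral>\<^sup>+\<omega>. ennreal (cmod (F (x, \<omega>))) \<partial>torus \<partial>lborel) < \<infinity>"
  shows "(LINT \<omega>|torus. LINT x|lborel. F (x, \<omega>)) = (LINT x|lborel. LINT \<omega>|torus. F (x, \<omega>))"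
    and "integrable lborel (\<lambda>x. LINT \<omega>|torus. F (x, \<omega>))"
proof -
  interpret P: pair_sigma_finite "lborel :: (real ^ 'n) measure" "torus_borel :: (real ^ 'm) measure"
    by (rule pair_sigma_finite_torus)
  have F': "F \<in> borel_measurable (lborel \<Otimes>\<^sub>M torus_borel)"
    using F by (simp cong: measurable_cong_sets add: borel_prod[symmetric] del: borel_prod)
  have sec [measurable]: "(\<lambda>\<omega>. F (x, \<omega>)) \<in> borel_measurable borel" for x by measurable
  have "(\<integral>\<^sup>+p. ennreal (norm (F p)) \<partial>(lborel \<Otimes>\<^sub>M torus_borel)) = (\<integral>\<^sup>+x. \<integral>\<^sup>+\<omega>. ennreal (cmod (F (x, \<omega>))) \<partial>torus_borel \<partial>lborel)"
    using F' by (subst P.M2.nn_integral_fst[symmetric]) auto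
  also have "\<dots> < \<infinity>" using fin by (simp add: nn_integral_torus_borel)
  finally have int: "integrable (lborel \<Otimes>\<^sub>M torus_borel) F"
    using F' by (simp add: integrable_iff_bounded)
  have m: "(\<lambda>\<omega>. LINT x|lborel. F (x, \<omega>)) \<in> borel_measurable borel"
  proof -
    have "(\<lambda>\<omega>. LINT x|lborel. F (x, \<omega>)) \<in> borel_measurable torus_borel" using F' by measurable
    then show ?thesis by (simp cong: measurable_cong_sets)
  qed
  show "(LINT \<omega>|torus. LINT x|lborel. F (x, \<omega>)) = (LINT x|lborel. LINT \<omega>|torus. F (x, \<omega>))"
    using P.Fubini_integral[of "\<lambda>x \<omega>. F (x, \<omega>)"] int m by (simp add: integral_torus_borel)
  show "integrable lborel (\<lambda>x. LINT \<omega>|torus. F (x, \<omega>))"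
    using P.integrable_fst[of "\<lambda>x \<omega>. F (x, \<omega>)"] int by (simp add: integral_torus_borel)
qed

lemma borel_measurable_fst_snd [measurable]:
  "fst \<in> borel_measurable (borel :: ('a::second_countable_topology \<times> 'b::second_countable_topology) measure)"
  "snd \<in> borel_measurable (borel :: ('a::second_countable_topology \<times> 'b::second_countable_topology) measure)"
  by (intro borel_measurable_continuous_onI continuous_intros)+

lemma AE_lborel_ex:
  assumes "AE x in (lborel :: 'a::euclidean_space measure). P x"
  shows "\<exists>x. P x"
proof (rule ccontr)
  assume "\<not> ?thesis"
  then have "AE x in (lborel :: 'a measure). False" using assms by simp
  then show False by (simp add: AE_iff_null null_sets_def)
qed

section \<open>Stationary fields as functions on the torus\<close>

lemma measurable_flow [measurable]:
  "(\<lambda>p. wrap (\<Lambda> *v fst p) (snd p)) \<in> borel_measurable (borel :: ((real ^ 'n::finite) \<times> (real ^ 'm::finite)) measure)"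
proof -
  have "(\<lambda>p :: (real ^ 'n) \<times> (real ^ 'm). snd p + \<Lambda> *v fst p) \<in> borel_measurable borel"
    by (intro borel_measurable_continuous_onI continuous_intros matrix_vector_mult_linear_continuous_on[THEN continuous_on_compose2]) auto
  moreover have "wrap (\<Lambda> *v x) \<omega> = wrap 0 (\<omega> + \<Lambda> *v x)" for x :: "real ^ 'n" and \<omega> :: "real ^ 'm"
    by (simp add: wrap_def)
  ultimately show ?thesis
    using measurable_compose[OF _ measurable_wrap[of 0]] by simp
qed

lemma measurable_flow_fst [measurable]:
  "(\<lambda>x. wrap (\<Lambda> *v x) \<omega>) \<in> borel_measurable borel"
  using measurable_compose[OF _ measurable_flow[of \<Lambda>], of "\<lambda>x. (x, \<omega>)" borel] by simp

lemma nn_integral_flow: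
  fixes q :: "real ^ 'm::finite \<Rightarrow> ennreal" and \<Lambda> :: "real ^ 'n::finite ^ 'm"
  assumes [measurable]: "q \<in> borel_measurable borel" "B \<in> sets borel"
  shows "(\<integral>\<^sup>+\<omega>. \<integral>\<^sup>+x. q (wrap (\<Lambda> *v x) \<omega>) * indicator B x \<partial>lborel \<partial>torus) = (\<integral>\<^sup>+\<omega>. q \<omega> \<partial>torus) * emeasure lborel B"
proof -
  have "(\<integral>\<^sup>+\<omega>. \<integral>\<^sup>+x. q (wrap (\<Lambda> *v x) \<omega>) * indicator B x \<partial>lborel \<partial>torus)
      = (\<integral>\<^sup>+x. \<integral>\<^sup>+\<omega>. q (wrap (\<Lambda> *v x) \<omega>) * indicator B x \<partial>torus \<partial>lborel)"
  proof -
    have "(\<lambda>p. q (wrap (\<Lambda> *v fst p) (snd p)) * indicator B (fst p)) \<in> borel_measurable borel"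
      by measurable
    from nn_integral_torus_swap(1)[OF this] show ?thesis by simp
  qed
  also have "\<dots> = (\<integral>\<^sup>+x. (\<integral>\<^sup>+\<omega>. q \<omega> \<partial>torus) * indicator B x \<partial>lborel)"
    by (intro nn_integral_cong) (auto simp: indicator_def nn_integral_wrap)
  also have "\<dots> = (\<integral>\<^sup>+\<omega>. q \<omega> \<partial>torus) * emeasure lborel B"
    by (simp add: nn_integral_cmult)
  finally show ?thesis .
qed

text \<open>
  Almost every section \<open>f x\<^sub>0\<close> is measurable and yields a candidate for
  \<open>h\<close>. Stationarity carries the representation from \<open>x\<^sub>0\<close> to every
  \<open>x\<close>, with an exceptional set of \<open>\<omega>\<close> depending on
  \<open>x\<close>, and Fubini exchanges the roles of the two variables.
\<close>

lemma stationary_representation: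
  fixes f :: "real ^ 'n::finite \<Rightarrow> real ^ 'm::finite \<Rightarrow> complex" and \<Lambda> :: "real ^ 'n ^ 'm"
  assumes f: "stationary (torus_flow \<Lambda>) f"
  obtains h where "h \<in> borel_measurable borel" "\<And>x. AE \<omega> in torus. f x \<omega> = h (wrap (\<Lambda> *v x) \<omega>)"
    "AE \<omega> in torus. AE x in lborel. f x \<omega> = h (wrap (\<Lambda> *v x) \<omega>)"
proof -
  have "case_prod f \<in> borel_measurable (lebesgue_on (UNIV \<times> unit_cell))"
    using f by (simp add: stationary_def field_measure_def)
  then obtain f' where f' [measurable]: "f' \<in> borel_measurable borel"
    and "AE p in lborel. p \<in> UNIV \<times> unit_cell \<longrightarrow> case_prod f p = f' p"
    using sets_UNIV_times_unit_cell by (rule ex_borel_AE_eq)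
  then have ae: "AE p in field_measure. case_prod f p = f' p"
    by (simp add: AE_field_measure_iff mem_Times_iff)
  have "AE x in lborel. AE \<omega> in torus. f x \<omega> = f' (x, \<omega>)"
    using AE_field_measure(2)[OF ae] by simp
  from AE_lborel_ex[OF this] obtain x0 where x0: "AE \<omega> in torus. f x0 \<omega> = f' (x0, \<omega>)" ..
  define h where "h = (\<lambda>\<omega>. f' (x0, wrap (- (\<Lambda> *v x0)) \<omega>))"
  have h [measurable]: "h \<in> borel_measurable borel" unfolding h_def by measurable
  have rep: "AE \<omega> in torus. f x \<omega> = h (wrap (\<Lambda> *v x) \<omega>)" for x
  proof -
    have "AE \<omega> in torus. f (x0 + (x - x0)) \<omega> = f x0 (wrap (\<Lambda> *v (x - x0)) \<omega>)"
      using f unfolding stationary_def torus_flow_eq_wrap by blast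
    moreover have "AE \<omega> in torus. f x0 (wrap (\<Lambda> *v (x - x0)) \<omega>) = f' (x0, wrap (\<Lambda> *v (x - x0)) \<omega>)"
      by (rule AE_wrap[OF x0])
    ultimately show ?thesis
      by eventually_elim (simp add: h_def wrap_wrap matrix_vector_mult_diff_distrib)
  qed
  have "AE p in lborel. snd p \<in> unit_cell \<longrightarrow> f' p = h (wrap (\<Lambda> *v fst p) (snd p))"
  proof -
    have "AE x in lborel. AE \<omega> in lborel. \<omega> \<in> unit_cell \<longrightarrow> f' (x, \<omega>) = h (wrap (\<Lambda> *v x) \<omega>)"
    proof -
      have "AE x in lborel. AE \<omega> in torus. f' (x, \<omega>) = h (wrap (\<Lambda> *v x) \<omega>)"
        using AE_field_measure(2)[OF ae]
      proof eventually_elim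
        case (elim x)
        then show ?case using rep[of x] by eventually_elim simp
      qed
      then show ?thesis by (simp add: AE_torus_iff)
    qed
    then have "AE p in lborel \<Otimes>\<^sub>M lborel. snd p \<in> unit_cell \<longrightarrow> f' p = h (wrap (\<Lambda> *v fst p) (snd p))"
    proof (intro lborel_pair.AE_pair_measure)
      have "{p :: (real ^ 'n) \<times> (real ^ 'm). snd p \<in> unit_cell \<longrightarrow> f' p = h (wrap (\<Lambda> *v fst p) (snd p))} \<in> sets borel"
        by measurable
      then show "{p \<in> space (lborel \<Otimes>\<^sub>M lborel). snd p \<in> unit_cell \<longrightarrow> f' p = h (wrap (\<Lambda> *v fst p) (snd p))} \<in> sets (lborel \<Otimes>\<^sub>M lborel)"
        by (simp only: lborel_prod sets_lborel space_lborel space_borel mem_Collect_eq UNIV_I simp_thms)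
    qed simp
    then show ?thesis by (simp only: lborel_prod)
  qed
  then have "AE p in field_measure. f' p = h (wrap (\<Lambda> *v fst p) (snd p))"
    by (simp add: AE_field_measure_iff)
  with ae have "AE p in field_measure. case_prod f p = h (wrap (\<Lambda> *v fst p) (snd p))"
    by eventually_elim simp
  from AE_field_measure(1)[OF this]
  have "AE \<omega> in torus. AE x in lborel. f x \<omega> = h (wrap (\<Lambda> *v x) \<omega>)" by simp
  with h rep show ?thesis by (rule that)
qed

lemma L2_loc_section:
  fixes f :: "real ^ 'n::finite \<Rightarrow> real ^ 'm::finite \<Rightarrow> 'v::real_normed_vector"
  assumes f: "f \<in> L2_loc"
  shows "(\<integral>\<^sup>+x. (\<integral>\<^sup>+\<omega>. ennreal ((norm (f x \<omega>))\<^sup>2) \<partial>torus) * indicator (cball 0 R) x \<partial>lborel) < \<infinity>"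
  using f by (simp add: L2_loc_def nn_integral_completion)

lemma representative_L2:
  fixes f :: "real ^ 'n::finite \<Rightarrow> real ^ 'm::finite \<Rightarrow> complex" and \<Lambda> :: "real ^ 'n ^ 'm"
  assumes f: "f \<in> L2_loc" and h [measurable]: "h \<in> borel_measurable borel"
    and rep: "\<And>x. AE \<omega> in torus. f x \<omega> = h (wrap (\<Lambda> *v x) \<omega>)"
  shows "h \<in> L2_torus"
proof -
  have "(\<integral>\<^sup>+\<omega>. ennreal ((norm (f x \<omega>))\<^sup>2) \<partial>torus) = sq_norm h" for x
  proof -
    have "(\<integral>\<^sup>+\<omega>. ennreal ((norm (f x \<omega>))\<^sup>2) \<partial>torus) = (\<integral>\<^sup>+\<omega>. ennreal ((norm (h (wrap (\<Lambda> *v x) \<omega>)))\<^sup>2) \<partial>torus)"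
      by (rule nn_integral_cong_AE) (use rep[of x] in eventually_elim, simp)
    also have "\<dots> = sq_norm h"
      unfolding sq_norm_def by (rule nn_integral_wrap) measurable
    finally show ?thesis .
  qed
  then have "sq_norm h * emeasure lborel (cball (0 :: real ^ 'n) 1) < \<infinity>"
    using L2_loc_section[OF f, of 1] by (simp add: nn_integral_cmult_indicator)
  moreover have "emeasure lborel (cball (0 :: real ^ 'n) 1) \<noteq> 0"
    using content_cball_pos[of 1 "0 :: real ^ 'n"] by (auto simp: measure_def)
  ultimately have "sq_norm h < \<infinity>"
    by (auto simp: ennreal_mult_less_top less_top)
  then show ?thesis by (simp add: L2_torus_iff measurable_torusI)
qed

lemma fourier_coeff_wrap:
  assumes [measurable]: "h \<in> borel_measurable borel"
  shows "fourier_coeff (\<lambda>\<omega>. h (wrap a \<omega>)) k = torus_char k a * fourier_coeff h k"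
proof -
  have [measurable]: "(\<lambda>\<omega>. cnj (torus_char k \<omega>)) \<in> borel_measurable borel"
    by (simp only: cnj_torus_char measurable_torus_char)
  have "torus_char k a * cnj (torus_char k (wrap a \<omega>)) = cnj (torus_char k \<omega>)" for \<omega>
  proof -
    have "torus_char k a * cnj (torus_char k a) = 1"
      by (simp add: complex_norm_square[symmetric])
    then show ?thesis by (simp add: torus_char_wrap mult.assoc[symmetric])
  qed
  then have "h (wrap a \<omega>) * cnj (torus_char k \<omega>) = torus_char k a * (h (wrap a \<omega>) * cnj (torus_char k (wrap a \<omega>)))" for \<omega>
    by (metis mult.left_commute)
  then have "fourier_coeff (\<lambda>\<omega>. h (wrap a \<omega>)) k
      = (LINT \<omega>|torus. torus_char k a * (h (wrap a \<omega>) * cnj (torus_char k (wrap a \<omega>))))"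
    by (simp only: fourier_coeff_def)
  also have "\<dots> = torus_char k a * (LINT \<omega>|torus. h (wrap a \<omega>) * cnj (torus_char k (wrap a \<omega>)))"
    by simp
  also have "(LINT \<omega>|torus. h (wrap a \<omega>) * cnj (torus_char k (wrap a \<omega>))) = fourier_coeff h k"
    unfolding fourier_coeff_def by (rule integral_wrap) measurable
  finally show ?thesis .
qed

section \<open>The weak derivative of a stationary field in Fourier coordinates\<close>

definition frequency :: "real ^ 'n::finite ^ 'm::finite \<Rightarrow> int ^ 'm \<Rightarrow> real ^ 'n" where
  "frequency \<Lambda> k = transpose \<Lambda> *v real_vec k"

text \<open>
  The Fourier multiplier of differentiation along the flow in direction \<open>i\<close>.
\<close>

definition deriv_coeff :: "real ^ 'n::finite ^ 'm::finite \<Rightarrow> (int ^ 'm \<Rightarrow> complex) \<Rightarrow> 'n \<Rightarrow> int ^ 'm \<Rightarrow> complex" where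
  "deriv_coeff \<Lambda> c i k = 2 * of_real pi * \<i> * of_real (frequency \<Lambda> k $ i) * c k"

lemma torus_char_flow: "torus_char k (\<Lambda> *v x) = exp (2 * of_real pi * \<i> * of_real (frequency \<Lambda> k \<bullet> x))"
  by (simp add: torus_char_def frequency_def dot_lmul_matrix)

lemma has_derivative_torus_char_flow:
  fixes \<Lambda> :: "real ^ 'n::finite ^ 'm::finite"
  shows "((\<lambda>x. torus_char k (\<Lambda> *v x)) has_derivative
    (\<lambda>e. of_real (frequency \<Lambda> k \<bullet> e) * (2 * of_real pi * \<i> * torus_char k (\<Lambda> *v x)))) (at x)"
proof -
  have "((\<lambda>x. of_real (frequency \<Lambda> k \<bullet> x) :: complex) has_derivative (\<lambda>e. of_real (frequency \<Lambda> k \<bullet> e))) (at x)"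
    by (intro bounded_linear_imp_has_derivative bounded_linear_compose[OF bounded_linear_of_real bounded_linear_inner_right])
  then have "((\<lambda>x. 2 * of_real pi * \<i> * of_real (frequency \<Lambda> k \<bullet> x)) has_derivative (\<lambda>e. 2 * of_real pi * \<i> * of_real (frequency \<Lambda> k \<bullet> e))) (at x)"
    by (rule has_derivative_mult_right)
  moreover have "(exp has_derivative (*) (exp z)) (at z)" for z :: complex
    using DERIV_exp[of z] by (simp add: has_field_derivative_def)
  ultimately have "((\<lambda>x. exp (2 * of_real pi * \<i> * of_real (frequency \<Lambda> k \<bullet> x))) has_derivative
      (\<lambda>e. exp (2 * of_real pi * \<i> * of_real (frequency \<Lambda> k \<bullet> x)) * (2 * of_real pi * \<i> * of_real (frequency \<Lambda> k \<bullet> e)))) (at x)"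
    by (rule has_derivative_compose)
  then show ?thesis unfolding torus_char_flow by (simp add: mult_ac)
qed

lemma lipschitz_torus_char_flow:
  fixes \<Lambda> :: "real ^ 'n::finite ^ 'm::finite"
  shows "(2 * pi * norm (frequency \<Lambda> k))-lipschitz_on UNIV (\<lambda>x. torus_char k (\<Lambda> *v x))"
proof (rule lipschitz_onI)
  fix x y :: "real ^ 'n"
  have "norm (torus_char k (\<Lambda> *v x) - torus_char k (\<Lambda> *v y)) \<le> (2 * pi * norm (frequency \<Lambda> k)) * norm (x - y)"
  proof (rule differentiable_bound[OF convex_UNIV has_derivative_torus_char_flow])
    fix z :: "real ^ 'n"
    have "norm (of_real (frequency \<Lambda> k \<bullet> e) * (2 * of_real pi * \<i> * torus_char k (\<Lambda> *v z))) \<le> (2 * pi * norm (frequency \<Lambda> k)) * norm e" for e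
      using Cauchy_Schwarz_ineq2[of "frequency \<Lambda> k" e] by (simp add: norm_mult mult_ac)
    then show "onorm (\<lambda>e. of_real (frequency \<Lambda> k \<bullet> e) * (2 * of_real pi * \<i> * torus_char k (\<Lambda> *v z))) \<le> 2 * pi * norm (frequency \<Lambda> k)"
      by (rule onorm_le)
  qed auto
  then show "dist (torus_char k (\<Lambda> *v x)) (torus_char k (\<Lambda> *v y)) \<le> 2 * pi * norm (frequency \<Lambda> k) * dist x y"
    by (simp add: dist_norm)
qed simp

lemma integral_lebesgue_eq_lborel_AE:
  fixes f :: "'a::euclidean_space \<Rightarrow> complex"
  assumes "AE x in lborel. f x = g x" "g \<in> borel_measurable borel"
  shows "(LINT x|lebesgue. f x) = (LINT x|lborel. g x)"
proof -
  have ae: "AE x in lebesgue. g x = f x" using assms(1) by (simp add: AE_completion_iff eq_commute)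
  have g: "g \<in> borel_measurable lebesgue" using assms(2) by (simp add: measurable_completion)
  then have "f \<in> borel_measurable lebesgue"
    by (rule borel_measurable_AE[OF _ ae])
  then have "(LINT x|lebesgue. f x) = (LINT x|lebesgue. g x)"
    using ae g by (intro integral_cong_AE) (auto simp: eq_commute)
  also have "\<dots> = (LINT x|lborel. g x)" using assms(2) by (intro integral_completion) simp
  finally show ?thesis .
qed

text \<open>
  Fubini; integrability in the torus variable comes from \<open>\<bar>q\<bar> \<le> 1 +
  \<bar>q\<bar>\<^sup>2\<close>.
\<close>

lemma integral_fourier_coeff_swap:
  fixes q :: "(real ^ 'n::finite) \<times> (real ^ 'm::finite) \<Rightarrow> complex" and \<phi> :: "real ^ 'n \<Rightarrow> real"
  assumes \<phi> [measurable]: "\<phi> \<in> borel_measurable borel"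
    and \<phi>_bound: "\<And>x. \<bar>\<phi> x\<bar> \<le> B * indicator (cball 0 R) x" "0 \<le> B"
    and q [measurable]: "q \<in> borel_measurable borel"
    and q_fin: "(\<integral>\<^sup>+x. sq_norm (\<lambda>\<omega>. q (x, \<omega>)) * indicator (cball 0 R) x \<partial>lborel) < \<infinity>"
  shows "(LINT \<omega>|torus. LINT x|lborel. \<phi> x *\<^sub>R q (x, \<omega>) * cnj (torus_char k \<omega>))
      = (LINT x|lborel. \<phi> x *\<^sub>R fourier_coeff (\<lambda>\<omega>. q (x, \<omega>)) k)"
    and "integrable lborel (\<lambda>x. \<phi> x *\<^sub>R fourier_coeff (\<lambda>\<omega>. q (x, \<omega>)) k)"
proof -
  have [measurable]: "(\<lambda>\<omega>. cnj (torus_char k \<omega>)) \<in> borel_measurable borel"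
    by (simp only: cnj_torus_char measurable_torus_char)
  define F where "F = (\<lambda>p. \<phi> (fst p) *\<^sub>R q p * cnj (torus_char k (snd p)))"
  have F [measurable]: "F \<in> borel_measurable borel" unfolding F_def by measurable
  have [measurable]: "(\<lambda>x. sq_norm (\<lambda>\<omega>. q (x, \<omega>))) \<in> borel_measurable borel"
    unfolding sq_norm_def using nn_integral_torus_swap(3)[of "\<lambda>p. ennreal ((cmod (q p))\<^sup>2)"] by simp
  have le: "(\<integral>\<^sup>+\<omega>. ennreal (cmod (F (x, \<omega>))) \<partial>torus) \<le> ennreal B * ((1 + sq_norm (\<lambda>\<omega>. q (x, \<omega>))) * indicator (cball 0 R) x)" for x
  proof -
    have [measurable]: "(\<lambda>\<omega>. q (x, \<omega>)) \<in> borel_measurable torus" by (intro measurable_torusI) measurable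
    have "(\<integral>\<^sup>+\<omega>. ennreal (cmod (F (x, \<omega>))) \<partial>torus) \<le> (\<integral>\<^sup>+\<omega>. ennreal (B * indicator (cball 0 R) x) * (1 + ennreal ((cmod (q (x, \<omega>)))\<^sup>2)) \<partial>torus)"
    proof (rule nn_integral_mono)
      fix \<omega>
      have "cmod (q (x, \<omega>)) \<le> 1 + (cmod (q (x, \<omega>)))\<^sup>2"
        using sum_squares_bound[of 1 "cmod (q (x, \<omega>))"] norm_ge_zero[of "q (x, \<omega>)"] unfolding one_power2 by linarith
      then have "cmod (F (x, \<omega>)) \<le> (B * indicator (cball 0 R) x) * (1 + (cmod (q (x, \<omega>)))\<^sup>2)"
        unfolding F_def using \<phi>_bound by (simp add: norm_mult mult_mono)
      then have "ennreal (cmod (F (x, \<omega>))) \<le> ennreal ((B * indicator (cball 0 R) x) * (1 + (cmod (q (x, \<omega>)))\<^sup>2))"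
        by (rule ennreal_leI)
      then show "ennreal (cmod (F (x, \<omega>))) \<le> ennreal (B * indicator (cball 0 R) x) * (1 + ennreal ((cmod (q (x, \<omega>)))\<^sup>2))"
        using \<phi>_bound(2) by (simp add: ennreal_mult ennreal_plus)
    qed
    also have "\<dots> = ennreal (B * indicator (cball 0 R) x) * (1 + sq_norm (\<lambda>\<omega>. q (x, \<omega>)))"
      by (simp add: nn_integral_cmult nn_integral_add sq_norm_def emeasure_torus_space)
    finally show ?thesis by (auto simp: indicator_def)
  qed
  have "(\<integral>\<^sup>+x. \<integral>\<^sup>+\<omega>. ennreal (cmod (F (x, \<omega>))) \<partial>torus \<partial>lborel)
      \<le> (\<integral>\<^sup>+x. ennreal B * ((1 + sq_norm (\<lambda>\<omega>. q (x, \<omega>))) * indicator (cball 0 R) x) \<partial>lborel)"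
    by (intro nn_integral_mono le)
  also have "\<dots> = ennreal B * (emeasure lborel (cball (0 :: real ^ 'n) R) + (\<integral>\<^sup>+x. sq_norm (\<lambda>\<omega>. q (x, \<omega>)) * indicator (cball 0 R) x \<partial>lborel))"
  proof -
    define W where "W = (\<lambda>x. sq_norm (\<lambda>\<omega>. q (x, \<omega>)) * indicator (cball 0 R) x)"
    have W [measurable]: "W \<in> borel_measurable borel"
      unfolding W_def by (intro borel_measurable_times_ennreal borel_measurable_indicator) simp_all
    have [measurable]: "(indicator (cball 0 R) :: real ^ 'n \<Rightarrow> ennreal) \<in> borel_measurable borel"
      by (intro borel_measurable_indicator) simp
    have "(\<integral>\<^sup>+x. ennreal B * ((1 + sq_norm (\<lambda>\<omega>. q (x, \<omega>))) * indicator (cball 0 R) x) \<partial>lborel)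
        = (\<integral>\<^sup>+x. ennreal B * (indicator (cball 0 R) x + W x) \<partial>lborel)"
      by (simp add: W_def distrib_right)
    also have "\<dots> = ennreal B * ((\<integral>\<^sup>+x. indicator (cball (0 :: real ^ 'n) R) x \<partial>lborel) + (\<integral>\<^sup>+x. W x \<partial>lborel))"
      by (subst nn_integral_cmult, simp, subst nn_integral_add) simp_all
    finally show ?thesis by (simp add: W_def)
  qed
  also have "\<dots> < \<infinity>"
    using q_fin emeasure_bounded_finite[of "cball (0 :: real ^ 'n) R"] by (simp add: ennreal_mult_less_top)
  finally have fin: "(\<integral>\<^sup>+x. \<integral>\<^sup>+\<omega>. ennreal (cmod (F (x, \<omega>))) \<partial>torus \<partial>lborel) < \<infinity>" .
  have F_int: "(LINT \<omega>|torus. F (x, \<omega>)) = \<phi> x *\<^sub>R fourier_coeff (\<lambda>\<omega>. q (x, \<omega>)) k" for x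
    by (simp add: F_def fourier_coeff_def)
  show "(LINT \<omega>|torus. LINT x|lborel. \<phi> x *\<^sub>R q (x, \<omega>) * cnj (torus_char k \<omega>))
      = (LINT x|lborel. \<phi> x *\<^sub>R fourier_coeff (\<lambda>\<omega>. q (x, \<omega>)) k)"
    using integral_torus_swap(1)[OF F fin] unfolding F_int by (simp add: F_def)
  show "integrable lborel (\<lambda>x. \<phi> x *\<^sub>R fourier_coeff (\<lambda>\<omega>. q (x, \<omega>)) k)"
    using integral_torus_swap(2)[OF F fin] unfolding F_int .
qed

lemma test_function_support:
  fixes \<psi> :: "real ^ 'n::finite \<Rightarrow> real"
  assumes \<psi>: "test_function \<psi>"
  obtains B R where "0 \<le> B" "\<And>x. \<bar>\<psi> x\<bar> \<le> B * indicator (cball 0 R) x"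
proof -
  obtain B K where K: "compact K" "\<And>x. x \<notin> K \<Longrightarrow> \<psi> x = 0" "\<And>x. \<bar>\<psi> x\<bar> \<le> B" "B \<ge> 0"
    by (rule test_function_bounded[OF \<psi>]) blast
  obtain R where R: "\<And>x. x \<in> K \<Longrightarrow> norm x \<le> R"
    using compact_imp_bounded[OF K(1)] by (auto simp: bounded_iff)
  have "\<bar>\<psi> x\<bar> \<le> B * indicator (cball 0 R) x" for x
    using K(2,3,4) R by (cases "x \<in> K") (auto simp: indicator_def)
  then show ?thesis using that K(4) by blast
qed

text \<open>
  Integrating the identity for the weak derivative \<open>g\<close> against a character in
  \<open>\<omega>\<close> gives an identity on \<open>\<real>\<^sup>n\<close> in which
  \<open>f\<close> is replaced by a multiple of \<open>exp (2\<pi>\<i> \<Lambda>\<^sup>T k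
  \<bullet> x)\<close>. The fundamental lemma then identifies the coefficients of
  \<open>g\<close>, for almost every \<open>x\<close>, with those given by
  \<open>deriv_coeff\<close> up to a factor of modulus one, and Parseval at a single such
  \<open>x\<close> bounds their sum of squares.
\<close>

lemma weak_derivative_coeffs_summable:
  fixes f :: "real ^ 'n::finite \<Rightarrow> real ^ 'm::finite \<Rightarrow> complex" and \<Lambda> :: "real ^ 'n ^ 'm"
  assumes h [measurable]: "h \<in> borel_measurable borel" and h_L2: "h \<in> L2_torus"
    and rep: "AE \<omega> in torus. AE x in lborel. f x \<omega> = h (wrap (\<Lambda> *v x) \<omega>)"
    and f: "f \<in> H1_loc"
  shows "(\<integral>\<^sup>+k. ennreal ((cmod (deriv_coeff \<Lambda> (fourier_coeff h) i k))\<^sup>2) \<partial>count_space UNIV) < \<infinity>"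
proof -
  obtain g :: "real ^ 'n \<Rightarrow> real ^ 'm \<Rightarrow> complex ^ 'n" where g: "g \<in> L2_loc"
    and weak: "\<And>\<phi> i. test_function \<phi> \<Longrightarrow> AE \<omega> in torus.
        (LINT x|lebesgue. partial_deriv i \<phi> x *\<^sub>R f x \<omega>) = - (LINT x|lebesgue. \<phi> x *\<^sub>R g x \<omega> $ i)"
    using f unfolding H1_loc_def by blast
  have "(\<lambda>p. case_prod g p $ i) \<in> borel_measurable (lebesgue_on (UNIV \<times> unit_cell))"
    using g by (intro borel_measurable_vec_nth) (simp add: L2_loc_def field_measure_def)
  then obtain G where G [measurable]: "G \<in> borel_measurable borel"
    and "AE p in lborel. p \<in> UNIV \<times> unit_cell \<longrightarrow> case_prod g p $ i = G p"
    using sets_UNIV_times_unit_cell by (rule ex_borel_AE_eq)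
  then have ae: "AE p in field_measure. case_prod g p $ i = G p"
    by (simp add: AE_field_measure_iff mem_Times_iff)
  have gG1: "AE \<omega> in torus. AE x in lborel. g x \<omega> $ i = G (x, \<omega>)"
    and gG2: "AE x in lborel. AE \<omega> in torus. g x \<omega> $ i = G (x, \<omega>)"
    using AE_field_measure[OF ae] by simp_all
  have [measurable]: "(\<lambda>x. G (x, \<omega>)) \<in> borel_measurable borel" "(\<lambda>\<omega>. G (x, \<omega>)) \<in> borel_measurable borel" for x \<omega>
    by measurable
  have G_fin: "(\<integral>\<^sup>+x. sq_norm (\<lambda>\<omega>. G (x, \<omega>)) * indicator (cball 0 R) x \<partial>lborel) < \<infinity>" for R
  proof -
    have "(\<integral>\<^sup>+x. sq_norm (\<lambda>\<omega>. G (x, \<omega>)) * indicator (cball 0 R) x \<partial>lborel)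
        \<le> (\<integral>\<^sup>+x. (\<integral>\<^sup>+\<omega>. ennreal ((norm (g x \<omega>))\<^sup>2) \<partial>torus) * indicator (cball 0 R) x \<partial>lborel)"
    proof (rule nn_integral_mono_AE, use gG2 in eventually_elim)
      case (elim x)
      have "sq_norm (\<lambda>\<omega>. G (x, \<omega>)) \<le> (\<integral>\<^sup>+\<omega>. ennreal ((norm (g x \<omega>))\<^sup>2) \<partial>torus)"
        unfolding sq_norm_def
      proof (rule nn_integral_mono_AE, use elim in eventually_elim)
        case (elim \<omega>)
        then have "cmod (G (x, \<omega>)) \<le> norm (g x \<omega>)"
          using Finite_Cartesian_Product.norm_nth_le[of "g x \<omega>" i] by simp
        then show ?case by (intro ennreal_leI power_mono) auto
      qed
      then show ?case by (rule mult_right_mono) simp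
    qed
    also have "\<dots> < \<infinity>" by (rule L2_loc_section[OF g])
    finally show ?thesis .
  qed
  have G_sec: "AE x in lborel. \<forall>R::nat. x \<in> cball 0 (real R) \<longrightarrow> sq_norm (\<lambda>\<omega>. G (x, \<omega>)) < \<infinity>"
  proof (intro AE_all_countable[THEN iffD2] allI)
    fix R :: nat
    have [measurable]: "(\<lambda>x. sq_norm (\<lambda>\<omega>. G (x, \<omega>))) \<in> borel_measurable borel"
      unfolding sq_norm_def using nn_integral_torus_swap(3)[of "\<lambda>p. ennreal ((cmod (G p))\<^sup>2)"] by simp
    have "(\<lambda>x. sq_norm (\<lambda>\<omega>. G (x, \<omega>)) * indicator (cball 0 (real R)) x) \<in> borel_measurable lborel"
      by (intro borel_measurable_times_ennreal borel_measurable_indicator) simp_all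
    then
    have "AE x in lborel. sq_norm (\<lambda>\<omega>. G (x, \<omega>)) * indicator (cball 0 (real R)) x \<noteq> \<infinity>"
      using G_fin[of R] by (intro nn_integral_PInf_AE) auto
    then show "AE x in lborel. x \<in> cball 0 (real R) \<longrightarrow> sq_norm (\<lambda>\<omega>. G (x, \<omega>)) < \<infinity>"
      by eventually_elim (auto simp: less_top)
  qed
  then have G_L2: "AE x in lborel. (\<lambda>\<omega>. G (x, \<omega>)) \<in> L2_torus"
  proof eventually_elim
    case (elim x)
    obtain R :: nat where "norm x \<le> real R" using real_arch_simple by blast
    then have "sq_norm (\<lambda>\<omega>. G (x, \<omega>)) < \<infinity>" using elim[rule_format, of R] by simp
    then show ?case by (simp add: L2_torus_iff measurable_torusI)
  qed
  have coeff_eq: "AE x in lborel. fourier_coeff (\<lambda>\<omega>. G (x, \<omega>)) k = deriv_coeff \<Lambda> (fourier_coeff h) i k * torus_char k (\<Lambda> *v x)" for k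
  proof -
    have [measurable]: "(\<lambda>\<omega>. cnj (torus_char k \<omega>)) \<in> borel_measurable borel"
      by (simp only: cnj_torus_char measurable_torus_char)
    define H where "H = (\<lambda>p. h (wrap (\<Lambda> *v fst p) (snd p)))"
    have H [measurable]: "H \<in> borel_measurable borel" unfolding H_def by measurable
    have H_fin: "(\<integral>\<^sup>+x. sq_norm (\<lambda>\<omega>. H (x, \<omega>)) * indicator (cball 0 R) x \<partial>lborel) < \<infinity>" for R
    proof -
      have "sq_norm (\<lambda>\<omega>. H (x, \<omega>)) = sq_norm h" for x
        unfolding sq_norm_def H_def fst_conv snd_conv by (rule nn_integral_wrap) measurable
      then show ?thesis
        using h_L2 emeasure_bounded_finite[of "cball (0 :: real ^ 'n) R"]
        by (simp add: nn_integral_cmult_indicator L2_torus_iff ennreal_mult_less_top)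
    qed
    have H_coeff: "fourier_coeff (\<lambda>\<omega>. H (x, \<omega>)) k = torus_char k (\<Lambda> *v x) * fourier_coeff h k" for x
      by (simp add: H_def fourier_coeff_wrap)
    have char_cont: "continuous_on UNIV (\<lambda>x. torus_char k (\<Lambda> *v x))"
      using lipschitz_torus_char_flow by (rule lipschitz_on_continuous_on)
    define c where "c = deriv_coeff \<Lambda> (fourier_coeff h) i k"
    define v where "v = (\<lambda>x. fourier_coeff (\<lambda>\<omega>. G (x, \<omega>)) k - c * torus_char k (\<Lambda> *v x))"
    have G_coeff_ai: "(\<lambda>x. fourier_coeff (\<lambda>\<omega>. G (x, \<omega>)) k) absolutely_integrable_on K" if K: "compact K" for K
    proof -
      obtain R where R: "\<And>x. x \<in> K \<Longrightarrow> norm x \<le> R" using compact_imp_bounded[OF K] by (auto simp: bounded_iff)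
      have [measurable]: "K \<in> sets borel" using K by (simp add: borel_compact)
      have "integrable lborel (\<lambda>x. indicator K x *\<^sub>R fourier_coeff (\<lambda>\<omega>. G (x, \<omega>)) k)"
        by (rule integral_fourier_coeff_swap(2)[where B=1 and R=R]) (use R G_fin in \<open>auto simp: indicator_def\<close>)
      then show ?thesis
        unfolding set_integrable_def by (subst integrable_completion) (auto dest: borel_measurable_integrable)
    qed
    have char_ai: "(\<lambda>x. c * torus_char k (\<Lambda> *v x)) absolutely_integrable_on K" if K: "compact K" for K
      by (intro absolutely_integrable_continuous_compact K continuous_intros continuous_on_subset[OF char_cont]) simp
    have "AE x in lebesgue. v x = 0"
    proof (rule fundamental_lemma)
      show "v absolutely_integrable_on K" if "compact K" for K
        unfolding v_def by (intro set_integral_diff(1) G_coeff_ai char_ai that)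
      fix \<phi> :: "real ^ 'n \<Rightarrow> real" assume \<phi>: "test_function \<phi>"
      note \<phi>' = test_function_partial_deriv[OF \<phi>, of i]
      have [measurable]: "\<phi> \<in> borel_measurable borel" "partial_deriv i \<phi> \<in> borel_measurable borel"
        using \<phi> \<phi>' by (simp_all add: test_function_measurable)
      obtain B R where B: "0 \<le> B" "\<And>x. \<bar>\<phi> x\<bar> \<le> B * indicator (cball 0 R) x" by (rule test_function_support[OF \<phi>]) blast
      obtain B' R' where B': "0 \<le> B'" "\<And>x. \<bar>partial_deriv i \<phi> x\<bar> \<le> B' * indicator (cball 0 R') x" by (rule test_function_support[OF \<phi>']) blast
      have "(LINT x|lborel. partial_deriv i \<phi> x *\<^sub>R fourier_coeff (\<lambda>\<omega>. H (x, \<omega>)) k)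
          = (LINT \<omega>|torus. LINT x|lborel. partial_deriv i \<phi> x *\<^sub>R H (x, \<omega>) * cnj (torus_char k \<omega>))"
        by (rule integral_fourier_coeff_swap(1)[symmetric, where B=B' and R=R']) (use B' H_fin in auto)
      also have "\<dots> = (LINT \<omega>|torus. - (LINT x|lborel. \<phi> x *\<^sub>R G (x, \<omega>) * cnj (torus_char k \<omega>)))"
      proof (rule integral_cong_AE)
        have "AE \<omega> in torus. (LINT x|lborel. partial_deriv i \<phi> x *\<^sub>R H (x, \<omega>)) = - (LINT x|lborel. \<phi> x *\<^sub>R G (x, \<omega>))"
          using weak[OF \<phi>, of i] rep gG1
        proof eventually_elim
          case (elim \<omega>)
          have "(LINT x|lebesgue. partial_deriv i \<phi> x *\<^sub>R f x \<omega>) = (LINT x|lborel. partial_deriv i \<phi> x *\<^sub>R H (x, \<omega>))"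
            by (rule integral_lebesgue_eq_lborel_AE) (use elim(2) in \<open>auto simp: H_def elim!: eventually_mono\<close>)
          moreover have "(LINT x|lebesgue. \<phi> x *\<^sub>R g x \<omega> $ i) = (LINT x|lborel. \<phi> x *\<^sub>R G (x, \<omega>))"
            by (rule integral_lebesgue_eq_lborel_AE) (use elim(3) in \<open>auto elim!: eventually_mono\<close>)
          ultimately show ?case using elim(1) by simp
        qed
        then show "AE \<omega> in torus. (LINT x|lborel. partial_deriv i \<phi> x *\<^sub>R H (x, \<omega>) * cnj (torus_char k \<omega>))
            = - (LINT x|lborel. \<phi> x *\<^sub>R G (x, \<omega>) * cnj (torus_char k \<omega>))"
          by eventually_elim (simp only: integral_mult_left_zero mult_minus_left)
      qed (intro measurable_torusI borel_measurable_uminus lborel.borel_measurable_lebesgue_integral; measurable)+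
      also have "\<dots> = - (LINT x|lborel. \<phi> x *\<^sub>R fourier_coeff (\<lambda>\<omega>. G (x, \<omega>)) k)"
        by (simp only: Bochner_Integration.integral_minus, subst integral_fourier_coeff_swap(1)[where B=B and R=R]) (use B G_fin in auto)
      finally have eq1: "(LINT x|lborel. partial_deriv i \<phi> x *\<^sub>R (torus_char k (\<Lambda> *v x) * fourier_coeff h k))
          = - (LINT x|lborel. \<phi> x *\<^sub>R fourier_coeff (\<lambda>\<omega>. G (x, \<omega>)) k)"
        unfolding H_coeff .
      have [measurable]: "(\<lambda>x. torus_char k (\<Lambda> *v x)) \<in> borel_measurable borel"
        by (intro borel_measurable_continuous_onI char_cont)
      have "(LINT x|lebesgue. partial_deriv i \<phi> x *\<^sub>R torus_char k (\<Lambda> *v x)) =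
          - (LINT x|lebesgue. \<phi> x *\<^sub>R (of_real (frequency \<Lambda> k \<bullet> axis i 1) * (2 * of_real pi * \<i> * torus_char k (\<Lambda> *v x))))"
        by (rule integration_by_parts[OF lipschitz_torus_char_flow _ has_derivative_torus_char_flow \<phi>, where B=1]) simp
      then have "(LINT x|lborel. partial_deriv i \<phi> x *\<^sub>R torus_char k (\<Lambda> *v x)) * fourier_coeff h k =
          - (LINT x|lborel. \<phi> x *\<^sub>R (of_real (frequency \<Lambda> k \<bullet> axis i 1) * (2 * of_real pi * \<i> * torus_char k (\<Lambda> *v x)))) * fourier_coeff h k"
        by (simp add: integral_completion)
      also have "(LINT x|lborel. partial_deriv i \<phi> x *\<^sub>R torus_char k (\<Lambda> *v x)) * fourier_coeff h k
          = (LINT x|lborel. partial_deriv i \<phi> x *\<^sub>R (torus_char k (\<Lambda> *v x) * fourier_coeff h k))"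
        by (subst integral_mult_left_zero[symmetric]) simp
      also have "- (LINT x|lborel. \<phi> x *\<^sub>R (of_real (frequency \<Lambda> k \<bullet> axis i 1) * (2 * of_real pi * \<i> * torus_char k (\<Lambda> *v x)))) * fourier_coeff h k
          = - (LINT x|lborel. \<phi> x *\<^sub>R (c * torus_char k (\<Lambda> *v x)))"
        unfolding mult_minus_left
        by (subst integral_mult_left_zero[symmetric]) (simp add: c_def deriv_coeff_def inner_axis mult_ac)
      finally have eq2: "(LINT x|lborel. \<phi> x *\<^sub>R fourier_coeff (\<lambda>\<omega>. G (x, \<omega>)) k) = (LINT x|lborel. \<phi> x *\<^sub>R (c * torus_char k (\<Lambda> *v x)))"
        using eq1 by simp
      have int1: "integrable lborel (\<lambda>x. \<phi> x *\<^sub>R fourier_coeff (\<lambda>\<omega>. G (x, \<omega>)) k)"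
        by (rule integral_fourier_coeff_swap(2)[where B=B and R=R]) (use B G_fin in auto)
      have "integrable lebesgue (\<lambda>x. \<phi> x *\<^sub>R (c * torus_char k (\<Lambda> *v x)))"
        by (rule integrable_test_function_scaleR[OF \<phi> char_ai])
      then have int2: "integrable lborel (\<lambda>x. \<phi> x *\<^sub>R (c * torus_char k (\<Lambda> *v x)))"
        by (subst (asm) integrable_completion) measurable
      have int: "integrable lborel (\<lambda>x. \<phi> x *\<^sub>R v x)" "(LINT x|lborel. \<phi> x *\<^sub>R v x) = 0"
        unfolding v_def scaleR_diff_right using int1 int2 eq2 by simp_all
      then show "(LINT x|lebesgue. \<phi> x *\<^sub>R v x) = 0"
        using borel_measurable_integrable[OF int(1)] by (subst integral_completion) simp_all
    qed
    then show ?thesis by (simp add: v_def c_def AE_completion_iff)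
  qed
  have "AE x in lborel. \<forall>k. fourier_coeff (\<lambda>\<omega>. G (x, \<omega>)) k = deriv_coeff \<Lambda> (fourier_coeff h) i k * torus_char k (\<Lambda> *v x)"
    by (intro AE_all_countable[THEN iffD2] allI coeff_eq)
  with G_L2 have "AE x in lborel. (\<lambda>\<omega>. G (x, \<omega>)) \<in> L2_torus \<and>
      (\<forall>k. fourier_coeff (\<lambda>\<omega>. G (x, \<omega>)) k = deriv_coeff \<Lambda> (fourier_coeff h) i k * torus_char k (\<Lambda> *v x))"
    by eventually_elim simp
  then obtain x where x: "(\<lambda>\<omega>. G (x, \<omega>)) \<in> L2_torus"
      "\<And>k. fourier_coeff (\<lambda>\<omega>. G (x, \<omega>)) k = deriv_coeff \<Lambda> (fourier_coeff h) i k * torus_char k (\<Lambda> *v x)"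
    using AE_lborel_ex by blast
  have "(\<integral>\<^sup>+k. ennreal ((cmod (deriv_coeff \<Lambda> (fourier_coeff h) i k))\<^sup>2) \<partial>count_space UNIV) = sq_norm (\<lambda>\<omega>. G (x, \<omega>))"
    using x(2) by (simp add: parseval[OF x(1)] norm_mult)
  then show ?thesis using x(1) by (simp add: L2_torus_iff)
qed

section \<open>Convergence along almost every path\<close>

lemma measurable_nn_integral_flow:
  fixes q :: "real ^ 'm::finite \<Rightarrow> ennreal" and \<Lambda> :: "real ^ 'n::finite ^ 'm"
  assumes [measurable]: "q \<in> borel_measurable borel" "B \<in> sets borel"
  shows "(\<lambda>\<omega>. \<integral>\<^sup>+x. q (wrap (\<Lambda> *v x) \<omega>) * indicator B x \<partial>lborel) \<in> borel_measurable torus"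
proof -
  have "(\<lambda>p. q (wrap (\<Lambda> *v fst p) (snd p)) * indicator B (fst p)) \<in> borel_measurable borel"
    by measurable
  from nn_integral_torus_swap(2)[OF this] show ?thesis by (simp add: measurable_torusI)
qed

lemma emeasure_cball_finite: "emeasure lborel (cball (0 :: 'a::euclidean_space) R) < \<infinity>"
  using emeasure_bounded_finite[of "cball (0 :: 'a) R"] by simp

lemma path_finite:
  fixes q :: "real ^ 'm::finite \<Rightarrow> ennreal" and \<Lambda> :: "real ^ 'n::finite ^ 'm"
  assumes [measurable]: "q \<in> borel_measurable borel" and fin: "(\<integral>\<^sup>+\<omega>. q \<omega> \<partial>torus) < \<infinity>"
  shows "AE \<omega> in torus. \<forall>R::nat. (\<integral>\<^sup>+x. q (wrap (\<Lambda> *v x) \<omega>) * indicator (cball 0 (real R)) x \<partial>lborel) < \<infinity>"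
proof (intro AE_all_countable[THEN iffD2] allI)
  fix R :: nat
  have "(\<integral>\<^sup>+\<omega>. \<integral>\<^sup>+x. q (wrap (\<Lambda> *v x) \<omega>) * indicator (cball 0 (real R)) x \<partial>lborel \<partial>torus) < \<infinity>"
    using fin emeasure_cball_finite[where 'a="real ^ 'n"] by (subst nn_integral_flow) (simp_all add: ennreal_mult_less_top)
  then have "AE \<omega> in torus. (\<integral>\<^sup>+x. q (wrap (\<Lambda> *v x) \<omega>) * indicator (cball 0 (real R)) x \<partial>lborel) \<noteq> \<infinity>"
    by (intro nn_integral_PInf_AE measurable_nn_integral_flow) auto
  then show "AE \<omega> in torus. (\<integral>\<^sup>+x. q (wrap (\<Lambda> *v x) \<omega>) * indicator (cball 0 (real R)) x \<partial>lborel) < \<infinity>"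
    by (simp add: less_top)
qed

lemma ennreal_suminf_tendsto_0:
  fixes f :: "nat \<Rightarrow> ennreal"
  assumes "suminf f \<noteq> \<infinity>"
  shows "f \<longlonglongrightarrow> 0"
proof -
  have fin: "f j \<noteq> \<infinity>" for j
  proof
    assume "f j = \<infinity>"
    moreover have "f j \<le> suminf f"
      using sum_le_suminf[of f "{j}"] by simp
    ultimately show False using assms by (simp add: top_unique)
  qed
  then have f: "f j = ennreal (enn2real (f j))" for j by (simp add: less_top)
  then have "(\<Sum>j. ennreal (enn2real (f j))) \<noteq> \<infinity>" using assms by simp
  then have "summable (\<lambda>j. enn2real (f j))" by (intro summable_suminf_not_top) auto
  then have "(\<lambda>j. enn2real (f j)) \<longlonglongrightarrow> 0" by (rule summable_LIMSEQ_zero)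
  then have "(\<lambda>j. ennreal (enn2real (f j))) \<longlonglongrightarrow> ennreal 0" by (rule tendsto_ennrealI)
  then show ?thesis using f by simp
qed

text \<open>
  The mean over \<open>\<omega>\<close> of the \<open>L\<^sup>1\<close> norms over a ball is
  summable, by invariance of the torus measure under the flow, so the norms tend to zero for
  almost every \<open>\<omega>\<close>.
\<close>

lemma path_converges:
  fixes q :: "nat \<Rightarrow> real ^ 'm::finite \<Rightarrow> complex" and \<Lambda> :: "real ^ 'n::finite ^ 'm"
  assumes [measurable]: "\<And>j. q j \<in> borel_measurable borel" and le: "\<And>j. sq_norm (q j) \<le> ennreal ((1/4)^j)"
  shows "AE \<omega> in torus. \<forall>R::nat. (\<lambda>j. \<integral>\<^sup>+x. ennreal (cmod (q j (wrap (\<Lambda> *v x) \<omega>))) * indicator (cball 0 (real R)) x \<partial>lborel) \<longlonglongrightarrow> 0"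
proof (intro AE_all_countable[THEN iffD2] allI)
  fix R :: nat
  let ?B = "cball (0 :: real ^ 'n) (real R)"
  define I where "I = (\<lambda>j \<omega>. \<integral>\<^sup>+x. ennreal (cmod (q j (wrap (\<Lambda> *v x) \<omega>))) * indicator ?B x \<partial>lborel)"
  have [measurable]: "I j \<in> borel_measurable torus" for j
    unfolding I_def by (rule measurable_nn_integral_flow[where q="\<lambda>\<omega>. ennreal (cmod (q j \<omega>))"]) simp_all
  have I_le: "(\<integral>\<^sup>+\<omega>. I j \<omega> \<partial>torus) \<le> ennreal (2 * (1/2)^j) * emeasure lborel ?B" for j
  proof -
    have "(\<integral>\<^sup>+\<omega>. I j \<omega> \<partial>torus) = (\<integral>\<^sup>+\<omega>. ennreal (cmod (q j \<omega>)) \<partial>torus) * emeasure lborel ?B"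
      unfolding I_def by (rule nn_integral_flow[where q="\<lambda>\<omega>. ennreal (cmod (q j \<omega>))"]) simp_all
    also have "\<dots> \<le> ennreal (2 * (1/2)^j) * emeasure lborel ?B"
      by (intro mult_right_mono nn_integral_cmod_le_of_sq_norm le) (simp_all add: measurable_torusI)
    finally show ?thesis .
  qed
  have "(\<integral>\<^sup>+\<omega>. (\<Sum>j. I j \<omega>) \<partial>torus) = (\<Sum>j. \<integral>\<^sup>+\<omega>. I j \<omega> \<partial>torus)"
    by (rule nn_integral_suminf) measurable
  also have "\<dots> \<le> (\<Sum>j. ennreal (2 * (1/2)^j) * emeasure lborel ?B)" by (intro suminf_le I_le) auto
  also have "\<dots> = (\<Sum>j. ennreal (2 * (1/2)^j)) * emeasure lborel ?B" by simp
  also have "(\<Sum>j. ennreal (2 * (1/2)^j)) = ennreal (2 * (1 / (1 - 1/2)))"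
  proof (rule suminf_ennreal_eq)
    show "(\<lambda>j. 2 * (1/2)^j) sums (2 * (1 / (1 - 1/2 :: real)))"
      by (intro sums_mult geometric_sums) simp
  qed simp
  also have "ennreal (2 * (1 / (1 - 1/2))) * emeasure lborel ?B < \<infinity>"
    using emeasure_cball_finite[where 'a="real ^ 'n"] by (simp add: ennreal_mult_less_top)
  finally have "AE \<omega> in torus. (\<Sum>j. I j \<omega>) \<noteq> \<infinity>"
    by (intro nn_integral_PInf_AE) auto
  then show "AE \<omega> in torus. (\<lambda>j. I j \<omega>) \<longlonglongrightarrow> 0"
    by eventually_elim (rule ennreal_suminf_tendsto_0)
qed

text \<open>
  By Parseval the distance to a partial sum is a tail of the series of squared coefficients.
\<close>

lemma trig_poly_approx:
  assumes h: "h \<in> L2_torus"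
  shows "(\<lambda>n. sq_norm (\<lambda>\<omega>. h \<omega> - trig_poly (block n) (fourier_coeff h) \<omega>)) \<longlonglongrightarrow> 0"
proof -
  have "sq_norm (\<lambda>\<omega>. h \<omega> - trig_poly (block n) (fourier_coeff h) \<omega>)
      = (\<integral>\<^sup>+k. ennreal ((cmod (fourier_coeff h k))\<^sup>2) * indicator (- block n) k \<partial>count_space UNIV)" for n
    by (subst parseval[OF L2_torus_diff[OF h L2_torus_trig_poly]])
      (auto intro!: nn_integral_cong simp: fourier_coeff_diff L2_torus_integrable h L2_torus_trig_poly fourier_coeff_trig_poly indicator_def)
  moreover have "(\<integral>\<^sup>+k. ennreal ((cmod (fourier_coeff h k))\<^sup>2) \<partial>count_space UNIV) < \<infinity>"
    using h by (simp add: parseval[symmetric] L2_torus_iff)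
  ultimately show ?thesis using tail_tendsto_0 by simp
qed

section \<open>Weak gradients under bi-Lipschitz changes of variables\<close>

lemma abs_det_le:
  fixes A :: "real ^ 'n ^ 'n::finite"
  assumes "\<And>i j. \<bar>A $ i $ j\<bar> \<le> M"
  shows "\<bar>det A\<bar> \<le> fact CARD('n) * M ^ CARD('n)"
proof -
  have "\<bar>det A\<bar> \<le> (\<Sum>p\<in>{p. p permutes (UNIV :: 'n set)}. \<bar>of_int (sign p) * (\<Prod>i\<in>UNIV. A $ i $ p i)\<bar>)"
    unfolding det_def by (rule sum_abs)
  also have "\<dots> \<le> (\<Sum>p\<in>{p. p permutes (UNIV :: 'n set)}. M ^ CARD('n))"
  proof (rule sum_mono)
    fix p :: "'n \<Rightarrow> 'n"
    have "\<bar>of_int (sign p) * (\<Prod>i\<in>UNIV. A $ i $ p i)\<bar> = (\<Prod>i\<in>UNIV. \<bar>A $ i $ p i\<bar>)"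
      by (simp add: abs_mult abs_prod sign_def)
    also have "\<dots> \<le> (\<Prod>i\<in>(UNIV :: 'n set). M)"
      by (intro prod_mono) (use assms in auto)
    finally show "\<bar>of_int (sign p) * (\<Prod>i\<in>UNIV. A $ i $ p i)\<bar> \<le> M ^ CARD('n)" by simp
  qed
  also have "\<dots> = fact CARD('n) * M ^ CARD('n)"
    using card_permutations[OF refl finite[of "UNIV :: 'n set"]] by simp
  finally show ?thesis .
qed

lemma lipschitz_derivative_bound:
  assumes lip: "L-lipschitz_on UNIV f" and der: "(f has_derivative f') (at x)"
  shows "norm (f' e) \<le> L * norm e"
proof (rule tendsto_upperbound[OF tendsto_norm[OF difference_quotient_tendsto[OF der]]])
  have "norm ((f ((1 / real (Suc n)) *\<^sub>R e + x) - f x) /\<^sub>R (1 / real (Suc n))) \<le> L * norm e" for n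
  proof -
    define s where "s = 1 / real (Suc n)"
    have s: "s > 0" by (simp add: s_def)
    have "norm (f (s *\<^sub>R e + x) - f x) \<le> L * norm (s *\<^sub>R e)"
      using lipschitz_onD[OF lip, of "s *\<^sub>R e + x" x] by (simp add: dist_norm)
    also have "\<dots> = L * norm e * s" using s by simp
    finally have "norm (f (s *\<^sub>R e + x) - f x) / s \<le> L * norm e"
      using s by (simp add: divide_le_eq)
    then show ?thesis unfolding s_def[symmetric] using s by (simp add: divide_inverse mult.commute)
  qed
  then show "\<forall>\<^sub>F n in sequentially. norm ((f ((1 / real (Suc n)) *\<^sub>R e + x) - f x) /\<^sub>R (1 / real (Suc n))) \<le> L * norm e"
    by simp
qed simp

lemma has_weak_gradient_cong_AE:
  assumes u: "has_weak_gradient u U" and eq: "AE x in lebesgue. u x = u' x"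
  shows "has_weak_gradient u' U"
proof -
  obtain N where N: "N \<in> null_sets lebesgue" "{x \<in> space lebesgue. u x \<noteq> u' x} \<subseteq> N"
    using eq unfolding eventually_ae_filter by auto
  then have N': "negligible N" "\<And>x. x \<notin> N \<Longrightarrow> u' x = u x"
    by (simp_all add: negligible_iff_null_sets subset_iff) metis
  have ai: "u absolutely_integrable_on K" "u' absolutely_integrable_on K" if "compact K" for K
  proof -
    show "u absolutely_integrable_on K" using u that by (simp add: has_weak_gradient_def)
    then show "u' absolutely_integrable_on K"
      by (rule absolutely_integrable_spike[OF _ N'(1)]) (use N'(2) in auto)
  qed
  have int: "(LINT x|lebesgue. \<phi> x *\<^sub>R u x) = (LINT x|lebesgue. \<phi> x *\<^sub>R u' x)" if \<phi>: "test_function \<phi>" for \<phi>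
  proof (rule integral_cong_AE)
    show "(\<lambda>x. \<phi> x *\<^sub>R u x) \<in> borel_measurable lebesgue" "(\<lambda>x. \<phi> x *\<^sub>R u' x) \<in> borel_measurable lebesgue"
      by (intro borel_measurable_integrable integrable_test_function_scaleR \<phi> ai; assumption)+
    show "AE x in lebesgue. \<phi> x *\<^sub>R u x = \<phi> x *\<^sub>R u' x" using eq by eventually_elim simp
  qed
  show ?thesis
    unfolding has_weak_gradient_def
  proof (intro conjI allI impI)
    fix K :: "(real ^ 'a) set" assume "compact K"
    then show "u' absolutely_integrable_on K" "U absolutely_integrable_on K"
      using ai(2) u by (simp_all add: has_weak_gradient_def)
  next
    fix \<phi> :: "real ^ 'a \<Rightarrow> real" and i assume \<phi>: "test_function \<phi>"
    show "(LINT x|lebesgue. partial_deriv i \<phi> x *\<^sub>R u' x) = - (LINT x|lebesgue. \<phi> x *\<^sub>R U x $ i)"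
      using u \<phi> by (simp add: int[OF test_function_partial_deriv[OF \<phi>], symmetric] has_weak_gradient_def)
  qed
qed

lemma bilipschitz_diffeo_facts:
  fixes \<psi> :: "real ^ 'n::finite \<Rightarrow> real ^ 'n"
  assumes "bilipschitz_diffeo \<psi>"
  shows "bij \<psi>" "\<And>y. (\<psi> has_derivative frechet_derivative \<psi> (at y)) (at y)"
    "\<And>z. (inv \<psi> has_derivative frechet_derivative (inv \<psi>) (at z)) (at z)"
    "continuous_on UNIV \<psi>" "continuous_on UNIV (inv \<psi>)"
    "\<exists>L. L-lipschitz_on UNIV \<psi>" "\<exists>L. L-lipschitz_on UNIV (inv \<psi>)"
    "inv \<psi> (\<psi> y) = y" "\<psi> (inv \<psi> z) = z"
proof -
  show *: "bij \<psi>" "\<exists>L. L-lipschitz_on UNIV \<psi>" "\<exists>L. L-lipschitz_on UNIV (inv \<psi>)"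
    using assms by (simp_all add: bilipschitz_diffeo_def)
  show "\<And>y. (\<psi> has_derivative frechet_derivative \<psi> (at y)) (at y)"
    "\<And>z. (inv \<psi> has_derivative frechet_derivative (inv \<psi>) (at z)) (at z)"
    using assms by (auto simp: bilipschitz_diffeo_def intro: has_derivative_differentiable_on_UNIV)
  show "continuous_on UNIV \<psi>" "continuous_on UNIV (inv \<psi>)"
    using assms by (auto simp: bilipschitz_diffeo_def intro: differentiable_imp_continuous_on)
  show "inv \<psi> (\<psi> y) = y" "\<psi> (inv \<psi> z) = z"
    using *(1) by (simp_all add: bij_is_inj bij_is_surj surj_f_inv_f)
qed

lemma nn_integral_inverse_le:
  fixes \<psi> :: "real ^ 'n::finite \<Rightarrow> real ^ 'n"
  assumes \<psi>: "bilipschitz_diffeo \<psi>"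
  obtains C where "0 \<le> C"
    "\<And>w. w \<in> borel_measurable borel \<Longrightarrow> (\<And>y. 0 \<le> w y) \<Longrightarrow>
      (\<integral>\<^sup>+z. ennreal (w (inv \<psi> z)) \<partial>lborel) \<le> ennreal C * (\<integral>\<^sup>+y. ennreal (w y) \<partial>lborel)"
proof -
  note facts = bilipschitz_diffeo_facts[OF \<psi>]
  obtain L where L: "L-lipschitz_on UNIV \<psi>" using facts(6) by blast
  define C where "C = fact CARD('n) * L ^ CARD('n)"
  have det_le: "\<bar>det (matrix (frechet_derivative \<psi> (at y)))\<bar> \<le> C" for y
    unfolding C_def
  proof (rule abs_det_le)
    fix i j
    have "\<bar>frechet_derivative \<psi> (at y) (axis j 1) $ i\<bar> \<le> norm (frechet_derivative \<psi> (at y) (axis j 1))"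
      by (rule component_le_norm_cart)
    also have "\<dots> \<le> L * norm (axis j 1 :: real ^ 'n)" by (rule lipschitz_derivative_bound[OF L facts(2)])
    finally show "\<bar>matrix (frechet_derivative \<psi> (at y)) $ i $ j\<bar> \<le> L" by (simp add: matrix_def)
  qed
  show ?thesis
  proof (rule that)
    show "0 \<le> C" using det_le[of 0] by (meson abs_ge_zero order_trans)
    fix w :: "real ^ 'n \<Rightarrow> real" assume [measurable]: "w \<in> borel_measurable borel" and w: "\<And>y. 0 \<le> w y"
    have "(\<integral>\<^sup>+z. ennreal (w (inv \<psi> z)) \<partial>lborel) = (\<integral>\<^sup>+y. ennreal (\<bar>det (matrix (frechet_derivative \<psi> (at y)))\<bar> * w y) \<partial>lborel)"
      by (rule nn_integral_change_of_variables) (use facts w in auto)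
    also have "\<dots> \<le> (\<integral>\<^sup>+y. ennreal C * ennreal (w y) \<partial>lborel)"
      using det_le w \<open>0 \<le> C\<close> by (intro nn_integral_mono) (simp add: ennreal_mult[symmetric] ennreal_leI mult_right_mono)
    also have "\<dots> = ennreal C * (\<integral>\<^sup>+y. ennreal (w y) \<partial>lborel)" by (rule nn_integral_cmult) simp
    finally show "(\<integral>\<^sup>+z. ennreal (w (inv \<psi> z)) \<partial>lborel) \<le> ennreal C * (\<integral>\<^sup>+y. ennreal (w y) \<partial>lborel)" .
  qed
qed

definition loc_L1 :: "('a::euclidean_space \<Rightarrow> complex) \<Rightarrow> bool" where
  "loc_L1 w \<longleftrightarrow> w \<in> borel_measurable borel \<and>
     (\<forall>R::nat. (\<integral>\<^sup>+y. ennreal (cmod (w y)) * indicator (cball 0 (real R)) y \<partial>lborel) < \<infinity>)"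

definition loc_L1_tendsto :: "(nat \<Rightarrow> 'a::euclidean_space \<Rightarrow> complex) \<Rightarrow> ('a \<Rightarrow> complex) \<Rightarrow> bool" where
  "loc_L1_tendsto w v \<longleftrightarrow>
     (\<forall>R::nat. (\<lambda>j. \<integral>\<^sup>+y. ennreal (cmod (w j y - v y)) * indicator (cball 0 (real R)) y \<partial>lborel) \<longlonglongrightarrow> 0)"

lemma loc_L1_bounded:
  assumes [measurable]: "w \<in> borel_measurable borel" and "\<And>y. cmod (w y) \<le> B"
  shows "loc_L1 w"
  unfolding loc_L1_def
proof (intro conjI allI)
  fix R :: nat
  have "(\<integral>\<^sup>+y. ennreal (cmod (w y)) * indicator (cball 0 (real R)) y \<partial>lborel) \<le> (\<integral>\<^sup>+y. ennreal B * indicator (cball (0::'a) (real R)) y \<partial>lborel)"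
    using assms(2) by (intro nn_integral_mono mult_right_mono ennreal_leI) auto
  also have "\<dots> < \<infinity>"
    using emeasure_cball_finite[where 'a='a] by (simp add: nn_integral_cmult_indicator ennreal_mult_less_top)
  finally show "(\<integral>\<^sup>+y. ennreal (cmod (w y)) * indicator (cball 0 (real R)) y \<partial>lborel) < \<infinity>" .
qed simp

lemma nn_integral_loc_comp_le:
  fixes \<psi> :: "real ^ 'n::finite \<Rightarrow> real ^ 'n" and K :: "(real ^ 'n) set"
  assumes \<psi>: "bilipschitz_diffeo \<psi>" and K: "compact K"
  obtains C and R :: nat where "0 \<le> C" "\<And>w. w \<in> borel_measurable borel \<Longrightarrow>
      (\<integral>\<^sup>+z. ennreal (cmod (w (inv \<psi> z))) * indicator K z \<partial>lborel)
      \<le> ennreal C * (\<integral>\<^sup>+y. ennreal (cmod (w y)) * indicator (cball 0 (real R)) y \<partial>lborel)"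
proof -
  note facts = bilipschitz_diffeo_facts[OF \<psi>]
  obtain C where C: "0 \<le> C" "\<And>w. w \<in> borel_measurable borel \<Longrightarrow> (\<And>y. 0 \<le> w y) \<Longrightarrow>
      (\<integral>\<^sup>+z. ennreal (w (inv \<psi> z)) \<partial>lborel) \<le> ennreal C * (\<integral>\<^sup>+y. ennreal (w y) \<partial>lborel)"
    by (rule nn_integral_inverse_le[OF \<psi>]) blast
  have "bounded (inv \<psi> ` K)"
    by (intro compact_imp_bounded compact_continuous_image continuous_on_subset[OF facts(5)] K) simp
  then obtain R0 where R0: "\<forall>y\<in>inv \<psi> ` K. norm y \<le> R0" unfolding bounded_iff by blast
  obtain R :: nat where "R0 \<le> real R" using real_arch_simple by blast
  then have R: "norm (inv \<psi> z) \<le> real R" if "z \<in> K" for z using R0 that by force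
  show ?thesis
  proof (rule that[OF C(1)])
    fix w :: "real ^ 'n \<Rightarrow> complex" assume [measurable]: "w \<in> borel_measurable borel"
    have "(\<integral>\<^sup>+z. ennreal (cmod (w (inv \<psi> z))) * indicator K z \<partial>lborel)
        \<le> (\<integral>\<^sup>+z. ennreal (cmod (w (inv \<psi> z)) * indicator (cball 0 (real R)) (inv \<psi> z)) \<partial>lborel)"
      using R by (intro nn_integral_mono) (auto simp: indicator_def)
    also have "\<dots> \<le> ennreal C * (\<integral>\<^sup>+y. ennreal (cmod (w y) * indicator (cball 0 (real R)) y) \<partial>lborel)"
    proof (rule C(2))
      have [measurable]: "cball 0 (real R) \<in> sets (borel :: (real ^ 'n) measure)" by simp
      show "(\<lambda>y. cmod (w y) * indicator (cball 0 (real R)) y) \<in> borel_measurable borel" by measurable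
    qed simp
    also have "(\<integral>\<^sup>+y. ennreal (cmod (w y) * indicator (cball 0 (real R)) y) \<partial>lborel)
        = (\<integral>\<^sup>+y. ennreal (cmod (w y)) * indicator (cball 0 (real R)) y \<partial>lborel)"
      by (intro nn_integral_cong) (auto simp: indicator_def)
    finally show "(\<integral>\<^sup>+z. ennreal (cmod (w (inv \<psi> z))) * indicator K z \<partial>lborel)
        \<le> ennreal C * (\<integral>\<^sup>+y. ennreal (cmod (w y)) * indicator (cball 0 (real R)) y \<partial>lborel)" .
  qed
qed

lemma absolutely_integrable_comp:
  fixes \<psi> :: "real ^ 'n::finite \<Rightarrow> real ^ 'n" and a :: "real ^ 'n \<Rightarrow> real"
  assumes \<psi>: "bilipschitz_diffeo \<psi>" and w: "loc_L1 w" and K: "compact K"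
    and a [measurable]: "a \<in> borel_measurable borel" and a_le: "\<And>z. \<bar>a z\<bar> \<le> A"
  shows "integrable lborel (\<lambda>z. indicator K z *\<^sub>R (of_real (a z) * w (inv \<psi> z)))"
proof -
  obtain C R where C: "\<And>w. w \<in> borel_measurable borel \<Longrightarrow>
      (\<integral>\<^sup>+z. ennreal (cmod (w (inv \<psi> z))) * indicator K z \<partial>lborel)
      \<le> ennreal C * (\<integral>\<^sup>+y. ennreal (cmod (w y)) * indicator (cball 0 (real R)) y \<partial>lborel)"
    by (rule nn_integral_loc_comp_le[OF \<psi> K]) blast
  have [measurable]: "w \<in> borel_measurable borel" using w by (simp add: loc_L1_def)
  have [measurable]: "inv \<psi> \<in> borel_measurable borel"
    by (intro borel_measurable_continuous_onI bilipschitz_diffeo_facts(5)[OF \<psi>])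
  have [measurable]: "K \<in> sets borel" using K by (simp add: borel_compact)
  have A: "0 \<le> A" using a_le[of 0] by linarith
  have "(\<integral>\<^sup>+z. ennreal (norm (indicator K z *\<^sub>R (of_real (a z) * w (inv \<psi> z)))) \<partial>lborel)
      \<le> (\<integral>\<^sup>+z. ennreal A * (ennreal (cmod (w (inv \<psi> z))) * indicator K z) \<partial>lborel)"
    using a_le A by (intro nn_integral_mono)
      (auto simp: indicator_def norm_mult ennreal_mult[symmetric] intro!: ennreal_leI mult_right_mono)
  also have "\<dots> = ennreal A * (\<integral>\<^sup>+z. ennreal (cmod (w (inv \<psi> z))) * indicator K z \<partial>lborel)"
    by (rule nn_integral_cmult) measurable
  also have "\<dots> \<le> ennreal A * (ennreal C * (\<integral>\<^sup>+y. ennreal (cmod (w y)) * indicator (cball 0 (real R)) y \<partial>lborel))"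
    by (intro mult_left_mono C) simp_all
  also have "\<dots> < \<infinity>" using w by (simp add: loc_L1_def ennreal_mult_less_top)
  finally show ?thesis by (simp add: integrable_iff_bounded)
qed

lemma integrable_test_comp:
  fixes \<psi> :: "real ^ 'n::finite \<Rightarrow> real ^ 'n" and a :: "real ^ 'n \<Rightarrow> real"
  assumes \<psi>: "bilipschitz_diffeo \<psi>" and u: "loc_L1 u"
    and \<phi>: "test_function \<phi>" and a [measurable]: "a \<in> borel_measurable borel" and a_le: "\<And>z. \<bar>a z\<bar> \<le> A"
  shows "integrable lborel (\<lambda>z. \<phi> z *\<^sub>R (of_real (a z) * u (inv \<psi> z)))"
proof -
  have [measurable]: "inv \<psi> \<in> borel_measurable borel"
    by (intro borel_measurable_continuous_onI bilipschitz_diffeo_facts(5)[OF \<psi>])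
  have [measurable]: "\<phi> \<in> borel_measurable borel" by (rule test_function_measurable[OF \<phi>])
  obtain B K where K: "compact K" "\<And>x. x \<notin> K \<Longrightarrow> \<phi> x = 0" "\<And>x. \<bar>\<phi> x\<bar> \<le> B" "B \<ge> 0"
    by (rule test_function_bounded[OF \<phi>]) blast
  show ?thesis
  proof (rule Bochner_Integration.integrable_bound)
    have [measurable]: "u \<in> borel_measurable borel" using u by (simp add: loc_L1_def)
    show "integrable lborel (\<lambda>z. B *\<^sub>R (indicator K z *\<^sub>R (of_real (a z) * u (inv \<psi> z))))"
      by (intro integrable_scaleR_right absolutely_integrable_comp[OF \<psi> u K(1) a a_le])
    show "(\<lambda>z. \<phi> z *\<^sub>R (of_real (a z) * u (inv \<psi> z))) \<in> borel_measurable lborel" by measurable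
    show "AE z in lborel. norm (\<phi> z *\<^sub>R (of_real (a z) * u (inv \<psi> z))) \<le> norm (B *\<^sub>R (indicator K z *\<^sub>R (of_real (a z) * u (inv \<psi> z))))"
    proof (rule AE_I2)
      fix z
      show "norm (\<phi> z *\<^sub>R (of_real (a z) * u (inv \<psi> z))) \<le> norm (B *\<^sub>R (indicator K z *\<^sub>R (of_real (a z) * u (inv \<psi> z))))"
        using K(2,3)[of z] K(4) by (cases "z \<in> K") (auto intro!: mult_right_mono)
    qed
  qed
qed

lemma integral_comp_tendsto:
  fixes \<psi> :: "real ^ 'n::finite \<Rightarrow> real ^ 'n" and a :: "real ^ 'n \<Rightarrow> real"
  assumes \<psi>: "bilipschitz_diffeo \<psi>" and v: "loc_L1 v" and w: "\<And>j. loc_L1 (w j)" and conv: "loc_L1_tendsto w v"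
    and \<phi>: "test_function \<phi>" and a [measurable]: "a \<in> borel_measurable borel" and a_le: "\<And>z. \<bar>a z\<bar> \<le> A"
  shows "(\<lambda>j. LINT z|lborel. \<phi> z *\<^sub>R (of_real (a z) * w j (inv \<psi> z))) \<longlonglongrightarrow> (LINT z|lborel. \<phi> z *\<^sub>R (of_real (a z) * v (inv \<psi> z)))"
proof -
  have [measurable]: "v \<in> borel_measurable borel" "\<And>j. w j \<in> borel_measurable borel" using v w by (simp_all add: loc_L1_def)
  have [measurable]: "inv \<psi> \<in> borel_measurable borel"
    by (intro borel_measurable_continuous_onI bilipschitz_diffeo_facts(5)[OF \<psi>])
  have [measurable]: "\<phi> \<in> borel_measurable borel" by (rule test_function_measurable[OF \<phi>])
  obtain B K where K: "compact K" "\<And>x. x \<notin> K \<Longrightarrow> \<phi> x = 0" "\<And>x. \<bar>\<phi> x\<bar> \<le> B" "B \<ge> 0"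
    by (rule test_function_bounded[OF \<phi>]) blast
  have A: "0 \<le> A" using a_le[of 0] by linarith
  note int = integrable_test_comp[OF \<psi> _ \<phi> a a_le]
  obtain C and R :: nat where C: "0 \<le> C" "\<And>w. w \<in> borel_measurable borel \<Longrightarrow>
      (\<integral>\<^sup>+z. ennreal (cmod (w (inv \<psi> z))) * indicator K z \<partial>lborel)
      \<le> ennreal C * (\<integral>\<^sup>+y. ennreal (cmod (w y)) * indicator (cball 0 (real R)) y \<partial>lborel)"
    by (rule nn_integral_loc_comp_le[OF \<psi> K(1)]) blast
  define D where "D = (\<lambda>j. (LINT z|lborel. \<phi> z *\<^sub>R (of_real (a z) * w j (inv \<psi> z))) - (LINT z|lborel. \<phi> z *\<^sub>R (of_real (a z) * v (inv \<psi> z))))"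
  define E where "E = (\<lambda>j. \<integral>\<^sup>+y. ennreal (cmod (w j y - v y)) * indicator (cball 0 (real R)) y \<partial>lborel)"
  have D_le: "ennreal (norm (D j)) \<le> ennreal (B * A * C) * E j" for j
  proof -
    have D_eq: "D j = (LINT z|lborel. \<phi> z *\<^sub>R (of_real (a z) * w j (inv \<psi> z)) - \<phi> z *\<^sub>R (of_real (a z) * v (inv \<psi> z)))"
      unfolding D_def by (rule Bochner_Integration.integral_diff[symmetric]) (intro int v w)+
    have "ennreal (norm (D j)) \<le> (\<integral>\<^sup>+z. ennreal (norm (\<phi> z *\<^sub>R (of_real (a z) * w j (inv \<psi> z)) - \<phi> z *\<^sub>R (of_real (a z) * v (inv \<psi> z)))) \<partial>lborel)"
      unfolding D_eq by (rule integral_norm_bound_ennreal) (intro Bochner_Integration.integrable_diff int v w)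
    also have "\<dots> \<le> (\<integral>\<^sup>+z. ennreal (B * A) * (ennreal (cmod (w j (inv \<psi> z) - v (inv \<psi> z))) * indicator K z) \<partial>lborel)"
    proof (rule nn_integral_mono)
      fix z
      have "\<phi> z *\<^sub>R (of_real (a z) * w j (inv \<psi> z)) - \<phi> z *\<^sub>R (of_real (a z) * v (inv \<psi> z))
          = (\<phi> z * a z) *\<^sub>R (w j (inv \<psi> z) - v (inv \<psi> z))" by (simp add: scaleR_conv_of_real algebra_simps)
      then have "norm (\<phi> z *\<^sub>R (of_real (a z) * w j (inv \<psi> z)) - \<phi> z *\<^sub>R (of_real (a z) * v (inv \<psi> z)))
          = \<bar>\<phi> z\<bar> * \<bar>a z\<bar> * cmod (w j (inv \<psi> z) - v (inv \<psi> z))" by (simp add: abs_mult)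
      also have "\<dots> \<le> (B * A) * (cmod (w j (inv \<psi> z) - v (inv \<psi> z)) * indicator K z)"
      proof (cases "z \<in> K")
        case True
        have "\<bar>\<phi> z\<bar> * \<bar>a z\<bar> \<le> B * A" using K(3)[of z] a_le[of z] K(4) by (intro mult_mono) auto
        then show ?thesis using True by (simp add: mult_right_mono)
      qed (use K(2) in simp)
      finally have "ennreal (norm (\<phi> z *\<^sub>R (of_real (a z) * w j (inv \<psi> z)) - \<phi> z *\<^sub>R (of_real (a z) * v (inv \<psi> z))))
         \<le> ennreal ((B * A) * (cmod (w j (inv \<psi> z) - v (inv \<psi> z)) * indicator K z))" by (rule ennreal_leI)
      also have "\<dots> = ennreal (B * A) * (ennreal (cmod (w j (inv \<psi> z) - v (inv \<psi> z))) * indicator K z)"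
        using A K(4) by (auto simp: ennreal_mult indicator_def)
      finally show "ennreal (norm (\<phi> z *\<^sub>R (of_real (a z) * w j (inv \<psi> z)) - \<phi> z *\<^sub>R (of_real (a z) * v (inv \<psi> z))))
         \<le> ennreal (B * A) * (ennreal (cmod (w j (inv \<psi> z) - v (inv \<psi> z))) * indicator K z)" .
    qed
    also have "\<dots> = ennreal (B * A) * (\<integral>\<^sup>+z. ennreal (cmod (w j (inv \<psi> z) - v (inv \<psi> z))) * indicator K z \<partial>lborel)"
      using borel_compact[OF K(1)] by (intro nn_integral_cmult) simp
    also have "\<dots> \<le> ennreal (B * A) * (ennreal C * E j)"
      unfolding E_def by (intro mult_left_mono C(2)[of "\<lambda>y. w j y - v y"]) simp_all
    also have "\<dots> = ennreal (B * A * C) * E j"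
      using A K(4) C(1) by (simp add: ennreal_mult mult.assoc)
    finally show ?thesis .
  qed
  have "E \<longlonglongrightarrow> 0" using conv unfolding loc_L1_tendsto_def E_def by blast
  then have "(\<lambda>j. ennreal (B * A * C) * E j) \<longlonglongrightarrow> ennreal (B * A * C) * 0"
    by (intro ennreal_tendsto_cmult) simp_all
  then have "(\<lambda>j. ennreal (B * A * C) * E j) \<longlonglongrightarrow> 0" by simp
  then have "(\<lambda>j. ennreal (norm (D j))) \<longlonglongrightarrow> 0"
    by (rule tendsto_sandwich[OF _ _ tendsto_const, rotated 2]) (use D_le in auto)
  then have "(\<lambda>j. ennreal (norm (D j))) \<longlonglongrightarrow> ennreal 0" by simp
  then have "(\<lambda>j. norm (D j)) \<longlonglongrightarrow> 0" by (subst (asm) tendsto_ennreal_iff) auto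
  then have "D \<longlonglongrightarrow> 0" by (simp only: tendsto_norm_zero_iff)
  then show "(\<lambda>j. LINT z|lborel. \<phi> z *\<^sub>R (of_real (a z) * w j (inv \<psi> z))) \<longlonglongrightarrow> (LINT z|lborel. \<phi> z *\<^sub>R (of_real (a z) * v (inv \<psi> z)))"
    unfolding D_def by (simp only: LIM_zero_iff)
qed

text \<open>
  The chain rule for \<open>v \<circ> f\<close> when \<open>V\<close> is the gradient of
  \<open>v\<close>.
\<close>

definition pushed_gradient ::
    "(real ^ 'n::finite \<Rightarrow> real ^ 'n) \<Rightarrow> ('n \<Rightarrow> real ^ 'n \<Rightarrow> complex) \<Rightarrow> real ^ 'n \<Rightarrow> complex ^ 'n" where
  "pushed_gradient f V z =
     (\<chi> i. \<Sum>l\<in>UNIV. of_real (frechet_derivative f (at z) (axis i 1) $ l) * V l (f z))"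

text \<open>
  For the approximations \<open>w j\<close> the composite is Lipschitz and differentiable
  everywhere, with the classical chain rule, so integration by parts applies. Composition with the
  inverse is bounded on \<open>L\<^sup>1\<close> over compact sets, because the Jacobian
  determinant of \<open>\<psi>\<close> is bounded, and this carries both sides of the identity to
  the limit.
\<close>

theorem weak_gradient_composition:
  fixes \<psi> :: "real ^ 'n::finite \<Rightarrow> real ^ 'n" and v :: "real ^ 'n \<Rightarrow> complex" and V :: "'n \<Rightarrow> real ^ 'n \<Rightarrow> complex"
  assumes \<psi>: "bilipschitz_diffeo \<psi>"
    and v: "loc_L1 v" and V: "\<And>l. loc_L1 (V l)"
    and w_der: "\<And>j x. (w j has_derivative (\<lambda>e. \<Sum>l\<in>UNIV. of_real (e $ l) * W j l x)) (at x)"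
    and w_lip: "\<And>j. \<exists>L. L-lipschitz_on UNIV (w j)" and w_bdd: "\<And>j. \<exists>B. \<forall>x. cmod (w j x) \<le> B"
    and W_meas: "\<And>j l. W j l \<in> borel_measurable borel" and W_bdd: "\<And>j l. \<exists>B. \<forall>x. cmod (W j l x) \<le> B"
    and w_conv: "loc_L1_tendsto w v" and W_conv: "\<And>l. loc_L1_tendsto (\<lambda>j. W j l) (V l)"
  shows "has_weak_gradient (\<lambda>z. v (inv \<psi> z)) (pushed_gradient (inv \<psi>) V)"
proof -
  note facts = bilipschitz_diffeo_facts[OF \<psi>]
  obtain L where L: "L-lipschitz_on UNIV (inv \<psi>)" using facts(7) by blast
  define a where "a = (\<lambda>i l z. frechet_derivative (inv \<psi>) (at z) (axis i 1) $ l)"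
  have a_meas [measurable]: "a i l \<in> borel_measurable borel" for i l
    unfolding a_def by (rule borel_measurable_vec_nth[OF borel_measurable_derivative[OF facts(3)]])
  have a_le: "\<bar>a i l z\<bar> \<le> L" for i l z
  proof -
    have "\<bar>a i l z\<bar> \<le> norm (frechet_derivative (inv \<psi>) (at z) (axis i 1))"
      unfolding a_def by (rule component_le_norm_cart)
    also have "\<dots> \<le> L * norm (axis i 1 :: real ^ 'n)" by (rule lipschitz_derivative_bound[OF L facts(3)])
    finally show ?thesis by simp
  qed
  have [measurable]: "inv \<psi> \<in> borel_measurable borel" by (intro borel_measurable_continuous_onI facts(5))
  have [measurable]: "v \<in> borel_measurable borel" "\<And>l. V l \<in> borel_measurable borel" using v V by (simp_all add: loc_L1_def)
  have w_meas [measurable]: "w j \<in> borel_measurable borel" for j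
  proof -
    obtain L' where "L'-lipschitz_on UNIV (w j)" using w_lip by blast
    then show ?thesis by (intro borel_measurable_continuous_onI lipschitz_on_continuous_on)
  qed
  note W_meas [measurable]
  have w_loc: "loc_L1 (w j)" and W_loc: "loc_L1 (W j l)" for j l
    using w_bdd W_bdd loc_L1_bounded w_meas W_meas by metis+
  have one: "\<bar>1 :: real\<bar> \<le> 1" by simp
  have comp_ai: "(\<lambda>z. of_real (b z) * u (inv \<psi> z)) absolutely_integrable_on K"
    if "loc_L1 u" "compact K" "b \<in> borel_measurable borel" "\<And>z. \<bar>b z\<bar> \<le> B" for u :: "real ^ 'n \<Rightarrow> complex" and K b B
    unfolding set_integrable_def
    using absolutely_integrable_comp[OF \<psi> that] by (subst integrable_completion) (auto dest: borel_measurable_integrable)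
  define U where "U = (\<lambda>z. \<chi> i. \<Sum>l\<in>UNIV. of_real (a i l z) * V l (inv \<psi> z))"
  have "has_weak_gradient (\<lambda>z. v (inv \<psi> z)) U"
    unfolding has_weak_gradient_def
  proof (intro conjI allI impI)
    fix K :: "(real ^ 'n) set" assume K: "compact K"
    show "(\<lambda>z. v (inv \<psi> z)) absolutely_integrable_on K"
      using comp_ai[OF v K, of "\<lambda>_. 1" 1] by simp
    have "(\<lambda>z. \<Sum>l\<in>UNIV. of_real (a i l z) * V l (inv \<psi> z)) absolutely_integrable_on K" for i
      by (intro absolutely_integrable_sum comp_ai[OF V K a_meas a_le]) simp
    then have "(\<lambda>z. axis i (\<Sum>l\<in>UNIV. of_real (a i l z) * V l (inv \<psi> z)) :: complex ^ 'n) absolutely_integrable_on K" for i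
    proof -
      assume *: "\<And>i. (\<lambda>z. \<Sum>l\<in>UNIV. of_real (a i l z) * V l (inv \<psi> z)) absolutely_integrable_on K"
      have "bounded_linear (axis i :: complex \<Rightarrow> complex ^ 'n)"
        by (intro linear_conv_bounded_linear[THEN iffD1] linearI) (auto simp: vec_eq_iff axis_def)
      from absolutely_integrable_linear[OF *[of i] this] show ?thesis by (simp add: o_def)
    qed
    then have "(\<lambda>z. \<Sum>i\<in>UNIV. axis i (\<Sum>l\<in>UNIV. of_real (a i l z) * V l (inv \<psi> z)) :: complex ^ 'n) absolutely_integrable_on K"
      by (intro absolutely_integrable_sum) auto
    moreover have "(\<Sum>i\<in>UNIV. axis i (\<Sum>l\<in>UNIV. of_real (a i l z) * V l (inv \<psi> z)) :: complex ^ 'n) = U z" for z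
      by (simp add: U_def vec_eq_iff axis_def)
    ultimately show "U absolutely_integrable_on K" by simp
  next
    fix \<phi> :: "real ^ 'n \<Rightarrow> real" and i assume \<phi>: "test_function \<phi>"
    note \<phi>' = test_function_partial_deriv[OF \<phi>, of i]
    have [measurable]: "\<phi> \<in> borel_measurable borel" "partial_deriv i \<phi> \<in> borel_measurable borel"
      using \<phi> \<phi>' by (simp_all add: test_function_measurable)
    have classical: "(LINT z|lborel. partial_deriv i \<phi> z *\<^sub>R (of_real 1 * w j (inv \<psi> z)))
        = - (\<Sum>l\<in>UNIV. LINT z|lborel. \<phi> z *\<^sub>R (of_real (a i l z) * W j l (inv \<psi> z)))" for j
    proof -
      obtain L' where L': "L'-lipschitz_on UNIV (w j)" using w_lip by blast
      obtain B where B: "\<And>x. cmod (w j x) \<le> B" using w_bdd by blast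
      have lip: "(L' * L)-lipschitz_on UNIV (\<lambda>z. w j (inv \<psi> z))"
        by (rule lipschitz_on_compose2[OF L lipschitz_on_subset[OF L' subset_UNIV]])
      have der: "((\<lambda>z. w j (inv \<psi> z)) has_derivative
          (\<lambda>e. \<Sum>l\<in>UNIV. of_real (frechet_derivative (inv \<psi>) (at z) e $ l) * W j l (inv \<psi> z))) (at z)" for z
        by (rule has_derivative_compose[OF facts(3) w_der])
      have "(LINT z|lebesgue. partial_deriv i \<phi> z *\<^sub>R w j (inv \<psi> z))
          = - (LINT z|lebesgue. \<phi> z *\<^sub>R (\<Sum>l\<in>UNIV. of_real (a i l z) * W j l (inv \<psi> z)))"
        unfolding a_def by (rule integration_by_parts[OF lip B der \<phi>])
      then have "(LINT z|lborel. partial_deriv i \<phi> z *\<^sub>R w j (inv \<psi> z))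
          = - (LINT z|lborel. \<phi> z *\<^sub>R (\<Sum>l\<in>UNIV. of_real (a i l z) * W j l (inv \<psi> z)))"
        by (subst (asm) (1 2) integral_completion) simp_all
      also have "(LINT z|lborel. \<phi> z *\<^sub>R (\<Sum>l\<in>UNIV. of_real (a i l z) * W j l (inv \<psi> z)))
          = (\<Sum>l\<in>UNIV. LINT z|lborel. \<phi> z *\<^sub>R (of_real (a i l z) * W j l (inv \<psi> z)))"
        unfolding scaleR_sum_right
        by (rule Bochner_Integration.integral_sum)
          (rule integrable_test_comp[OF \<psi> W_loc \<phi> a_meas a_le])
      finally show ?thesis by simp
    qed
    have "(\<lambda>j. LINT z|lborel. partial_deriv i \<phi> z *\<^sub>R (of_real 1 * w j (inv \<psi> z)))
        \<longlonglongrightarrow> (LINT z|lborel. partial_deriv i \<phi> z *\<^sub>R (of_real 1 * v (inv \<psi> z)))"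
      by (rule integral_comp_tendsto[OF \<psi> v w_loc w_conv \<phi>', where A=1]) simp_all
    moreover have "(\<lambda>j. - (\<Sum>l\<in>UNIV. LINT z|lborel. \<phi> z *\<^sub>R (of_real (a i l z) * W j l (inv \<psi> z))))
        \<longlonglongrightarrow> - (\<Sum>l\<in>UNIV. LINT z|lborel. \<phi> z *\<^sub>R (of_real (a i l z) * V l (inv \<psi> z)))"
      by (intro tendsto_minus tendsto_sum integral_comp_tendsto[OF \<psi> V W_loc W_conv \<phi> a_meas a_le])
    ultimately have "(LINT z|lborel. partial_deriv i \<phi> z *\<^sub>R (of_real 1 * v (inv \<psi> z)))
        = - (\<Sum>l\<in>UNIV. LINT z|lborel. \<phi> z *\<^sub>R (of_real (a i l z) * V l (inv \<psi> z)))"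
      unfolding classical by (rule LIMSEQ_unique)
    also have "(\<Sum>l\<in>UNIV. LINT z|lborel. \<phi> z *\<^sub>R (of_real (a i l z) * V l (inv \<psi> z)))
        = (LINT z|lborel. \<phi> z *\<^sub>R U z $ i)"
      unfolding U_def vec_lambda_beta scaleR_sum_right
      by (rule Bochner_Integration.integral_sum[symmetric])
        (rule integrable_test_comp[OF \<psi> V \<phi> a_meas a_le])
    finally have "(LINT z|lborel. partial_deriv i \<phi> z *\<^sub>R v (inv \<psi> z)) = - (LINT z|lborel. \<phi> z *\<^sub>R U z $ i)"
      by simp
    moreover have "(\<lambda>z. U z $ i) \<in> borel_measurable borel" unfolding U_def vec_lambda_beta by measurable
    ultimately show "(LINT z|lebesgue. partial_deriv i \<phi> z *\<^sub>R v (inv \<psi> z)) = - (LINT z|lebesgue. \<phi> z *\<^sub>R U z $ i)"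
      by (subst (1 2) integral_completion) simp_all
  qed
  then show ?thesis by (simp only: U_def a_def pushed_gradient_def [abs_def])
qed

section \<open>Gradients of stationary fields along almost every path\<close>

lemma ennreal_sqrt_mono: "x \<le> y \<Longrightarrow> ennreal_sqrt x \<le> ennreal_sqrt y"
  by (cases x; cases y) (auto simp: ennreal_sqrt_def top_unique)

text \<open>
  Summing the squared multipliers over the coordinate directions gives the square of the weight.
\<close>

lemma energy_identity:
  fixes \<Lambda> :: "real ^ 'n::finite ^ 'm::finite"
  assumes h: "h \<in> L2_torus" and V: "\<And>l. V l \<in> L2_torus"
    and coeff: "\<And>l k. fourier_coeff (V l) k = deriv_coeff \<Lambda> (fourier_coeff h) l k"
  shows "(\<integral>\<^sup>+k. ennreal ((1 + (dual_weight \<Lambda> k)\<^sup>2) * (cmod (fourier_coeff h k))\<^sup>2) \<partial>count_space UNIV)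
    = sq_norm h + (\<Sum>l\<in>UNIV. sq_norm (V l))"
proof -
  have eq: "(1 + (dual_weight \<Lambda> k)\<^sup>2) * (cmod (fourier_coeff h k))\<^sup>2
      = (cmod (fourier_coeff h k))\<^sup>2 + (\<Sum>l\<in>UNIV. (cmod (fourier_coeff (V l) k))\<^sup>2)" for k
  proof -
    have "(dual_weight \<Lambda> k)\<^sup>2 = (\<Sum>l\<in>UNIV. (2 * pi * (frequency \<Lambda> k $ l))\<^sup>2)"
      by (simp add: dual_weight_def frequency_def power_mult_distrib norm_vec_def L2_set_def sum_nonneg sum_distrib_left)
    then show ?thesis
      by (simp add: coeff deriv_coeff_def norm_mult power_mult_distrib distrib_right sum_distrib_right)
  qed
  have "(\<integral>\<^sup>+k. ennreal ((1 + (dual_weight \<Lambda> k)\<^sup>2) * (cmod (fourier_coeff h k))\<^sup>2) \<partial>count_space UNIV)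
     = (\<integral>\<^sup>+k. ennreal ((cmod (fourier_coeff h k))\<^sup>2) + (\<Sum>l\<in>UNIV. ennreal ((cmod (fourier_coeff (V l) k))\<^sup>2)) \<partial>count_space UNIV)"
    unfolding eq by (simp add: ennreal_plus sum_nonneg)
  also have "\<dots> = sq_norm h + (\<Sum>l\<in>UNIV. sq_norm (V l))"
    by (simp add: nn_integral_add nn_integral_sum parseval h V del: sum_ennreal)
  finally show ?thesis .
qed

lemma trig_poly_flow:
  "trig_poly F c (wrap (\<Lambda> *v x) \<omega>) = (\<Sum>k\<in>F. c k * torus_char k \<omega> * torus_char k (\<Lambda> *v x))"
  by (simp add: trig_poly_def torus_char_wrap mult_ac)

lemma has_derivative_trig_poly_flow:
  fixes \<Lambda> :: "real ^ 'n::finite ^ 'm::finite"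
  shows "((\<lambda>x. trig_poly F c (wrap (\<Lambda> *v x) \<omega>)) has_derivative
    (\<lambda>e. \<Sum>l\<in>UNIV. of_real (e $ l) * trig_poly F (deriv_coeff \<Lambda> c l) (wrap (\<Lambda> *v x) \<omega>))) (at x)"
proof -
  have "((\<lambda>x. \<Sum>k\<in>F. c k * torus_char k \<omega> * torus_char k (\<Lambda> *v x)) has_derivative
    (\<lambda>e. \<Sum>k\<in>F. c k * torus_char k \<omega> * (of_real (frequency \<Lambda> k \<bullet> e) * (2 * of_real pi * \<i> * torus_char k (\<Lambda> *v x))))) (at x)"
    by (intro has_derivative_sum has_derivative_mult_right has_derivative_torus_char_flow)
  moreover have "(\<Sum>k\<in>F. c k * torus_char k \<omega> * (of_real (frequency \<Lambda> k \<bullet> e) * (2 * of_real pi * \<i> * torus_char k (\<Lambda> *v x))))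
      = (\<Sum>l\<in>UNIV. of_real (e $ l) * trig_poly F (deriv_coeff \<Lambda> c l) (wrap (\<Lambda> *v x) \<omega>))" for e
  proof -
    have "(\<Sum>l\<in>UNIV. of_real (e $ l) * trig_poly F (deriv_coeff \<Lambda> c l) (wrap (\<Lambda> *v x) \<omega>))
       = (\<Sum>l\<in>UNIV. \<Sum>k\<in>F. of_real (e $ l) * (deriv_coeff \<Lambda> c l k * torus_char k \<omega> * torus_char k (\<Lambda> *v x)))"
      by (simp only: trig_poly_flow sum_distrib_left)
    also have "\<dots> = (\<Sum>k\<in>F. \<Sum>l\<in>UNIV. of_real (e $ l) * (deriv_coeff \<Lambda> c l k * torus_char k \<omega> * torus_char k (\<Lambda> *v x)))"
      by (rule sum.swap)
    also have "\<dots> = (\<Sum>k\<in>F. c k * torus_char k \<omega> * (of_real (frequency \<Lambda> k \<bullet> e) * (2 * of_real pi * \<i> * torus_char k (\<Lambda> *v x))))"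
      by (intro sum.cong refl)
        (simp add: inner_vec_def deriv_coeff_def sum_distrib_left sum_distrib_right mult_ac)
    finally show ?thesis ..
  qed
  ultimately show ?thesis by (simp only: trig_poly_flow)
qed

lemma lipschitz_trig_poly_flow:
  fixes \<Lambda> :: "real ^ 'n::finite ^ 'm::finite"
  shows "\<exists>L. L-lipschitz_on UNIV (\<lambda>x. trig_poly F c (wrap (\<Lambda> *v x) \<omega>))"
proof -
  define B where "B = (\<Sum>l\<in>(UNIV :: 'n set). \<Sum>k\<in>F. cmod (deriv_coeff \<Lambda> c l k))"
  have B: "0 \<le> B" unfolding B_def by (intro sum_nonneg norm_ge_zero)
  have bound: "norm (\<Sum>l\<in>UNIV. of_real (e $ l) * trig_poly F (deriv_coeff \<Lambda> c l) (wrap (\<Lambda> *v x) \<omega>)) \<le> B * norm e" for x e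
  proof -
    have "norm (\<Sum>l\<in>UNIV. of_real (e $ l) * trig_poly F (deriv_coeff \<Lambda> c l) (wrap (\<Lambda> *v x) \<omega>))
        \<le> (\<Sum>l\<in>UNIV. norm e * (\<Sum>k\<in>F. cmod (deriv_coeff \<Lambda> c l k)))"
      by (rule order_trans[OF norm_sum])
        (auto intro!: sum_mono mult_mono component_le_norm_cart norm_trig_poly_le simp: norm_mult)
    then show ?thesis by (simp add: B_def sum_distrib_left mult.commute)
  qed
  have "norm (trig_poly F c (wrap (\<Lambda> *v x) \<omega>) - trig_poly F c (wrap (\<Lambda> *v y) \<omega>)) \<le> B * norm (x - y)" for x y
    by (rule differentiable_bound[OF convex_UNIV has_derivative_trig_poly_flow onorm_le[OF bound]]) simp_all
  then have "B-lipschitz_on UNIV (\<lambda>x. trig_poly F c (wrap (\<Lambda> *v x) \<omega>))"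
    using B by (intro lipschitz_onI) (simp_all add: dist_norm)
  then show ?thesis ..
qed

text \<open>
  Partial sums of the Fourier series of \<open>h\<close> and of the \<open>V l\<close> at rate
  \<open>4\<^sup>-\<^sup>j\<close> satisfy the hypotheses of
  \<open>weak_gradient_composition\<close> for almost every \<open>\<omega>\<close>. The
  exceptional set is independent of \<open>\<psi>\<close>, so \<open>\<psi>\<close> may afterwards
  depend on \<open>\<omega>\<close>.
\<close>

lemma path_gradient:
  fixes \<Lambda> :: "real ^ 'n::finite ^ 'm::finite"
  assumes h [measurable]: "h \<in> borel_measurable borel" and h_L2: "h \<in> L2_torus"
    and fin: "\<And>l. (\<integral>\<^sup>+k. ennreal ((cmod (deriv_coeff \<Lambda> (fourier_coeff h) l k))\<^sup>2) \<partial>count_space UNIV) < \<infinity>"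
  obtains V where "\<And>l. V l \<in> borel_measurable borel" "\<And>l. V l \<in> L2_torus"
    "\<And>l k. fourier_coeff (V l) k = deriv_coeff \<Lambda> (fourier_coeff h) l k"
    "AE \<omega> in torus. \<forall>\<psi>. bilipschitz_diffeo \<psi> \<longrightarrow> has_weak_gradient (\<lambda>z. h (wrap (\<Lambda> *v inv \<psi> z) \<omega>))
      (pushed_gradient (inv \<psi>) (\<lambda>l x. V l (wrap (\<Lambda> *v x) \<omega>)))"
proof -
  define c where "c = deriv_coeff \<Lambda> (fourier_coeff h)"
  have "\<exists>s. s \<in> borel_measurable borel \<and> s \<in> L2_torus \<and> (\<forall>k. fourier_coeff s k = c l k)" for l
    using fin[of l, folded c_def] by (rule riesz_fischer) blast
  then obtain V where V [measurable]: "\<And>l. V l \<in> borel_measurable borel" and V_L2: "\<And>l. V l \<in> L2_torus"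
    and V_coeff: "\<And>l k. fourier_coeff (V l) k = c l k" by metis
  then have V_coeff': "fourier_coeff (V l) = c l" for l by (simp add: fun_eq_iff)
  have "\<exists>n. sq_norm (\<lambda>\<omega>. h \<omega> - trig_poly (block n) (fourier_coeff h) \<omega>) \<le> ennreal ((1/4)^j)
      \<and> (\<forall>l. sq_norm (\<lambda>\<omega>. V l \<omega> - trig_poly (block n) (c l) \<omega>) \<le> ennreal ((1/4)^j))" for j
  proof -
    have "eventually (\<lambda>n. sq_norm (\<lambda>\<omega>. h \<omega> - trig_poly (block n) (fourier_coeff h) \<omega>) < ennreal ((1/4)^j)) sequentially"
      by (rule order_tendstoD[OF trig_poly_approx[OF h_L2]]) simp
    moreover have "eventually (\<lambda>n. \<forall>l. sq_norm (\<lambda>\<omega>. V l \<omega> - trig_poly (block n) (c l) \<omega>) < ennreal ((1/4)^j)) sequentially"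
      by (intro eventually_all_finite order_tendstoD(2)[OF trig_poly_approx[OF V_L2, unfolded V_coeff']]) simp
    ultimately have "eventually (\<lambda>n. sq_norm (\<lambda>\<omega>. h \<omega> - trig_poly (block n) (fourier_coeff h) \<omega>) \<le> ennreal ((1/4)^j)
      \<and> (\<forall>l. sq_norm (\<lambda>\<omega>. V l \<omega> - trig_poly (block n) (c l) \<omega>) \<le> ennreal ((1/4)^j))) sequentially"
      by eventually_elim (auto intro: less_imp_le)
    then show ?thesis by (rule eventually_happens'[rotated]) simp
  qed
  then obtain N where N: "\<And>j. sq_norm (\<lambda>\<omega>. h \<omega> - trig_poly (block (N j)) (fourier_coeff h) \<omega>) \<le> ennreal ((1/4)^j)"
    "\<And>j l. sq_norm (\<lambda>\<omega>. V l \<omega> - trig_poly (block (N j)) (c l) \<omega>) \<le> ennreal ((1/4)^j)" by metis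
  have L1_fin: "(\<integral>\<^sup>+\<omega>. ennreal (cmod (q \<omega>)) \<partial>torus) < \<infinity>" if "q \<in> L2_torus" for q
    using L2_torus_integrable[OF that] by (simp add: integrable_iff_bounded)
  have loc: "AE \<omega> in torus. loc_L1 (\<lambda>x. q (wrap (\<Lambda> *v x) \<omega>))" if [measurable]: "q \<in> borel_measurable borel" and "q \<in> L2_torus" for q
    using path_finite[of "\<lambda>\<omega>. ennreal (cmod (q \<omega>))" \<Lambda>] L1_fin[OF that(2)]
    by (simp add: loc_L1_def)
  have conv: "AE \<omega> in torus. loc_L1_tendsto (\<lambda>j x. q j (wrap (\<Lambda> *v x) \<omega>)) (\<lambda>x. p (wrap (\<Lambda> *v x) \<omega>))"
    if [measurable]: "p \<in> borel_measurable borel" "\<And>j. q j \<in> borel_measurable borel"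
      and "\<And>j. sq_norm (\<lambda>\<omega>. p \<omega> - q j \<omega>) \<le> ennreal ((1/4)^j)" for p q
    using path_converges[of "\<lambda>j \<omega>. p \<omega> - q j \<omega>" \<Lambda>] that(3) by (simp add: loc_L1_tendsto_def norm_minus_commute)
  have V_loc: "AE \<omega> in torus. \<forall>l. loc_L1 (\<lambda>x. V l (wrap (\<Lambda> *v x) \<omega>))"
    by (intro AE_all_countable[THEN iffD2] allI loc V V_L2)
  have V_conv: "AE \<omega> in torus. \<forall>l. loc_L1_tendsto (\<lambda>j x. trig_poly (block (N j)) (c l) (wrap (\<Lambda> *v x) \<omega>)) (\<lambda>x. V l (wrap (\<Lambda> *v x) \<omega>))"
    by (intro AE_all_countable[THEN iffD2] allI conv V measurable_trig_poly N)
  have "AE \<omega> in torus. \<forall>\<psi>. bilipschitz_diffeo \<psi> \<longrightarrow> has_weak_gradient (\<lambda>z. h (wrap (\<Lambda> *v inv \<psi> z) \<omega>))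
      (pushed_gradient (inv \<psi>) (\<lambda>l x. V l (wrap (\<Lambda> *v x) \<omega>)))"
    using loc[OF h h_L2] V_loc conv[OF h measurable_trig_poly N(1)] V_conv
  proof eventually_elim
    case (elim \<omega>)
    show ?case
    proof (intro allI impI)
      fix \<psi> :: "real ^ 'n \<Rightarrow> real ^ 'n" assume \<psi>: "bilipschitz_diffeo \<psi>"
      show "has_weak_gradient (\<lambda>z. h (wrap (\<Lambda> *v inv \<psi> z) \<omega>))
        (pushed_gradient (inv \<psi>) (\<lambda>l x. V l (wrap (\<Lambda> *v x) \<omega>)))"
      proof (rule weak_gradient_composition[OF \<psi>, where v="\<lambda>x. h (wrap (\<Lambda> *v x) \<omega>)" and V="\<lambda>l x. V l (wrap (\<Lambda> *v x) \<omega>)"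
            and w="\<lambda>j x. trig_poly (block (N j)) (fourier_coeff h) (wrap (\<Lambda> *v x) \<omega>)"
            and W="\<lambda>j l x. trig_poly (block (N j)) (c l) (wrap (\<Lambda> *v x) \<omega>)"])
        show "((\<lambda>x. trig_poly (block (N j)) (fourier_coeff h) (wrap (\<Lambda> *v x) \<omega>)) has_derivative
          (\<lambda>e. \<Sum>l\<in>UNIV. of_real (e $ l) * trig_poly (block (N j)) (c l) (wrap (\<Lambda> *v x) \<omega>))) (at x)" for j x
          unfolding c_def by (rule has_derivative_trig_poly_flow)
        show "\<exists>B. \<forall>x. cmod (trig_poly (block (N j)) (fourier_coeff h) (wrap (\<Lambda> *v x) \<omega>)) \<le> B" for j
          using norm_trig_poly_le by blast
        show "\<exists>B. \<forall>x. cmod (trig_poly (block (N j)) (c l) (wrap (\<Lambda> *v x) \<omega>)) \<le> B" for j l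
          using norm_trig_poly_le by blast
        show "(\<lambda>x. trig_poly (block (N j)) (c l) (wrap (\<Lambda> *v x) \<omega>)) \<in> borel_measurable borel" for j l
          by (rule measurable_compose[OF measurable_flow_fst measurable_trig_poly])
      qed (use elim lipschitz_trig_poly_flow in blast)+
    qed
  qed
  with V V_L2 V_coeff show thesis using that unfolding c_def by blast
qed

section \<open>Norm estimates on a single path\<close>

text \<open>
  A differentiable map sends null sets to null sets.
\<close>

lemma AE_comp_inv:
  fixes \<psi> :: "real ^ 'n::finite \<Rightarrow> real ^ 'n"
  assumes \<psi>: "bilipschitz_diffeo \<psi>" and P: "AE y in lborel. P y"
  shows "AE z in lebesgue. P (inv \<psi> z)"
proof -
  note facts = bilipschitz_diffeo_facts[OF \<psi>]
  have "AE y in lebesgue. P y" using P by (simp add: AE_completion_iff)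
  then obtain N where N: "N \<in> null_sets lebesgue" "{y \<in> space lebesgue. \<not> P y} \<subseteq> N"
    unfolding eventually_ae_filter by auto
  have "\<psi> differentiable_on N"
    using \<psi> by (auto simp: bilipschitz_diffeo_def intro: differentiable_on_subset)
  then have "negligible (\<psi> ` N)"
    using N(1) by (intro negligible_differentiable_image_negligible) (auto simp: negligible_iff_null_sets)
  then have "AE z in lebesgue. z \<notin> \<psi> ` N" by (simp add: negligible_iff_null_sets AE_not_in)
  then show ?thesis
  proof eventually_elim
    case (elim z)
    have "inv \<psi> z \<notin> N" using elim facts(9)[of z] by (metis imageI)
    then show ?case using N(2) by auto
  qed
qed

lemma nn_integral_image_cell:
  fixes \<psi> :: "real ^ 'n::finite \<Rightarrow> real ^ 'n"
  assumes \<psi>: "bilipschitz_diffeo \<psi>" and u [measurable]: "u \<in> borel_measurable borel" and nn: "\<And>y. 0 \<le> u y"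
  shows "(\<integral>\<^sup>+z. ennreal (u (inv \<psi> z)) * indicator (\<psi> ` unit_cell) z \<partial>lebesgue)
    = (\<integral>\<^sup>+y. ennreal (\<bar>det (jacobian \<psi> (at y))\<bar>) * (ennreal (u y) * indicator unit_cell y) \<partial>lborel)"
proof -
  note facts = bilipschitz_diffeo_facts[OF \<psi>]
  have "z \<in> \<psi> ` unit_cell \<longleftrightarrow> inv \<psi> z \<in> unit_cell" for z
    using facts(8,9) by (metis image_iff)
  then have "(\<integral>\<^sup>+z. ennreal (u (inv \<psi> z)) * indicator (\<psi> ` unit_cell) z \<partial>lebesgue)
      = (\<integral>\<^sup>+z. ennreal (u (inv \<psi> z) * indicator unit_cell (inv \<psi> z)) \<partial>lborel)"
    by (auto simp: nn_integral_completion indicator_def intro!: nn_integral_cong)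
  also have "\<dots> = (\<integral>\<^sup>+y. ennreal (\<bar>det (matrix (frechet_derivative \<psi> (at y)))\<bar> * (u y * indicator unit_cell y)) \<partial>lborel)"
    by (rule nn_integral_change_of_variables[where u="\<lambda>y. u y * indicator unit_cell y"]) (use facts nn in auto)
  also have "\<dots> = (\<integral>\<^sup>+y. ennreal (\<bar>det (jacobian \<psi> (at y))\<bar>) * (ennreal (u y) * indicator unit_cell y) \<partial>lborel)"
    using nn by (intro nn_integral_cong) (auto simp: jacobian_def ennreal_mult indicator_def)
  finally show ?thesis .
qed

lemma path_L2_estimate:
  fixes \<psi> :: "real ^ 'n::finite \<Rightarrow> real ^ 'n" and F G :: "real ^ 'n \<Rightarrow> complex"
  assumes \<psi>: "bilipschitz_diffeo \<psi>" and M: "AE y in lborel. norm (jacobian \<psi> (at y)) \<le> M"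
    and v [measurable]: "v \<in> borel_measurable borel" and F: "AE y in lborel. F y = v y"
  shows "(\<integral>\<^sup>+z. ennreal ((cmod (F (inv \<psi> z)))\<^sup>2) * indicator (\<psi> ` unit_cell) z \<partial>lebesgue)
    \<le> ennreal (fact CARD('n) * M ^ CARD('n)) * (\<integral>\<^sup>+y. ennreal ((cmod (v y))\<^sup>2) * indicator unit_cell y \<partial>lborel)"
proof -
  have "(\<integral>\<^sup>+z. ennreal ((cmod (F (inv \<psi> z)))\<^sup>2) * indicator (\<psi> ` unit_cell) z \<partial>lebesgue)
      = (\<integral>\<^sup>+z. ennreal ((cmod (v (inv \<psi> z)))\<^sup>2) * indicator (\<psi> ` unit_cell) z \<partial>lebesgue)"
    by (rule nn_integral_cong_AE) (use AE_comp_inv[OF \<psi> F] in eventually_elim, simp)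
  also have "\<dots> = (\<integral>\<^sup>+y. ennreal (\<bar>det (jacobian \<psi> (at y))\<bar>) * (ennreal ((cmod (v y))\<^sup>2) * indicator unit_cell y) \<partial>lborel)"
    by (rule nn_integral_image_cell[OF \<psi>]) simp_all
  also have "\<dots> \<le> (\<integral>\<^sup>+y. ennreal (fact CARD('n) * M ^ CARD('n)) * (ennreal ((cmod (v y))\<^sup>2) * indicator unit_cell y) \<partial>lborel)"
  proof (rule nn_integral_mono_AE, use M in eventually_elim)
    case (elim y)
    have "\<bar>det (jacobian \<psi> (at y))\<bar> \<le> fact CARD('n) * M ^ CARD('n)"
    proof (rule abs_det_le)
      fix i j
      have "\<bar>jacobian \<psi> (at y) $ i $ j\<bar> \<le> norm (jacobian \<psi> (at y) $ i)" by (rule component_le_norm_cart)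
      also have "\<dots> \<le> norm (jacobian \<psi> (at y))" by (rule Finite_Cartesian_Product.norm_nth_le)
      finally show "\<bar>jacobian \<psi> (at y) $ i $ j\<bar> \<le> M" using elim by simp
    qed
    then show ?case by (intro mult_right_mono ennreal_leI) simp_all
  qed
  also have "\<dots> = ennreal (fact CARD('n) * M ^ CARD('n)) * (\<integral>\<^sup>+y. ennreal ((cmod (v y))\<^sup>2) * indicator unit_cell y \<partial>lborel)"
    by (rule nn_integral_cmult) measurable
  finally show ?thesis .
qed

text \<open>
  The derivatives of \<open>\<psi>\<close> and \<open>inv \<psi>\<close> at corresponding points
  are inverse to each other, so \<open>V\<close> is recovered from its push-forward by the
  transposed Jacobian matrix of \<open>\<psi>\<close>.
\<close>

lemma path_gradient_inverse:
  fixes \<psi> :: "real ^ 'n::finite \<Rightarrow> real ^ 'n" and V :: "'n \<Rightarrow> real ^ 'n \<Rightarrow> complex"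
  assumes \<psi>: "bilipschitz_diffeo \<psi>" and M: "norm (jacobian \<psi> (at y)) \<le> M"
  shows "cmod (V l y) \<le> real CARD('n) * M * norm (pushed_gradient (inv \<psi>) V (\<psi> y))"
proof -
  define U where "U = pushed_gradient (inv \<psi>) V"
  note facts = bilipschitz_diffeo_facts[OF \<psi>]
  define A where "A = frechet_derivative \<psi> (at y)"
  define D where "D = frechet_derivative (inv \<psi>) (at (\<psi> y))"
  interpret D: bounded_linear D unfolding D_def using facts(3) by (rule has_derivative_bounded_linear)
  have "((\<lambda>x. inv \<psi> (\<psi> x)) has_derivative (\<lambda>e. D (A e))) (at y)"
    unfolding A_def D_def by (rule has_derivative_compose[OF facts(2) facts(3)])
  then have "((\<lambda>x. x) has_derivative (\<lambda>e. D (A e))) (at y)" by (simp add: facts(8))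
  then have DA: "D (A e) = e" for e
    using has_derivative_unique[OF _ has_derivative_ident] by metis
  have expand: "A (axis l 1) = (\<Sum>i\<in>UNIV. A (axis l 1) $ i *\<^sub>R axis i 1)"
    by (simp add: vec_eq_iff axis_def if_distrib[of "\<lambda>x. _ * x"] cong: if_cong)
  have sum_DA: "(\<Sum>i\<in>UNIV. A (axis l 1) $ i * D (axis i 1) $ j) = (if j = l then 1 else 0)" for j
  proof -
    have "axis l 1 = D (\<Sum>i\<in>UNIV. A (axis l 1) $ i *\<^sub>R axis i 1)"
      using DA[of "axis l 1"] expand by simp
    also have "\<dots> = (\<Sum>i\<in>UNIV. A (axis l 1) $ i *\<^sub>R D (axis i 1))" by (simp only: D.sum D.scaleR)
    finally have "axis l 1 $ j = (\<Sum>i\<in>UNIV. A (axis l 1) $ i *\<^sub>R D (axis i 1)) $ j" by simp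
    then show ?thesis by (simp add: axis_def)
  qed
  have "(\<Sum>i\<in>UNIV. of_real (A (axis l 1) $ i) * U (\<psi> y) $ i)
      = (\<Sum>i\<in>UNIV. \<Sum>j\<in>UNIV. of_real (A (axis l 1) $ i * D (axis i 1) $ j) * V j y)"
    by (simp add: U_def pushed_gradient_def D_def[symmetric] facts(8) sum_distrib_left mult.assoc)
  also have "\<dots> = (\<Sum>j\<in>UNIV. \<Sum>i\<in>UNIV. of_real (A (axis l 1) $ i * D (axis i 1) $ j) * V j y)"
    by (rule sum.swap)
  also have "\<dots> = (\<Sum>j\<in>UNIV. of_real (\<Sum>i\<in>UNIV. A (axis l 1) $ i * D (axis i 1) $ j) * V j y)"
    by (simp only: of_real_sum sum_distrib_right)
  also have "\<dots> = V l y"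
    by (simp only: sum_DA) (simp add: if_distrib[of of_real] if_distrib[of "\<lambda>x. x * _"] cong: if_cong)
  finally have "cmod (V l y) \<le> (\<Sum>i\<in>UNIV. cmod (of_real (A (axis l 1) $ i) * U (\<psi> y) $ i))"
    using norm_sum by metis
  also have "\<dots> \<le> (\<Sum>i\<in>(UNIV :: 'n set). M * norm (U (\<psi> y)))"
  proof (rule sum_mono)
    fix i
    have "\<bar>A (axis l 1) $ i\<bar> = \<bar>jacobian \<psi> (at y) $ i $ l\<bar>" by (simp add: A_def jacobian_def matrix_def)
    also have "\<dots> \<le> norm (jacobian \<psi> (at y) $ i)" by (rule component_le_norm_cart)
    also have "\<dots> \<le> norm (jacobian \<psi> (at y))" by (rule Finite_Cartesian_Product.norm_nth_le)
    finally have "\<bar>A (axis l 1) $ i\<bar> \<le> M" using M by simp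
    then show "cmod (of_real (A (axis l 1) $ i) * U (\<psi> y) $ i) \<le> M * norm (U (\<psi> y))"
      by (simp add: norm_mult mult_mono' Finite_Cartesian_Product.norm_nth_le)
  qed
  finally show ?thesis by (simp add: U_def mult.assoc)
qed

text \<open>
  By uniqueness the weak gradient of the deformed function is the push-forward of
  \<open>V\<close>, which bounds \<open>V\<close> by \<open>path_gradient_inverse\<close>; the
  lower bound on the Jacobian determinant compares the volumes.
\<close>

lemma path_energy_estimate:
  fixes \<psi> :: "real ^ 'n::finite \<Rightarrow> real ^ 'n" and F :: "real ^ 'n \<Rightarrow> complex" and V :: "'n \<Rightarrow> real ^ 'n \<Rightarrow> complex"
  assumes \<psi>: "bilipschitz_diffeo \<psi>" and M: "AE y in lborel. norm (jacobian \<psi> (at y)) \<le> M"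
    and \<nu>: "0 < \<nu>" "AE y in lborel. \<nu> \<le> det (jacobian \<psi> (at y))"
    and v [measurable]: "v \<in> borel_measurable borel" and V [measurable]: "\<And>l. V l \<in> borel_measurable borel"
    and F: "AE y in lborel. F y = v y"
    and weak: "has_weak_gradient (\<lambda>z. v (inv \<psi> z)) (pushed_gradient (inv \<psi>) V)"
  shows "(\<integral>\<^sup>+y. ennreal ((cmod (v y))\<^sup>2 + (\<Sum>l\<in>UNIV. (cmod (V l y))\<^sup>2)) * indicator unit_cell y \<partial>lborel)
    \<le> ennreal ((1 + real CARD('n) ^ 3 * M\<^sup>2) / \<nu>) *
      (\<integral>\<^sup>+z. ennreal ((cmod (F (inv \<psi> z)))\<^sup>2 + (norm (weak_gradient (\<lambda>z. F (inv \<psi> z)) z))\<^sup>2) * indicator (\<psi> ` unit_cell) z \<partial>lebesgue)"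
proof -
  note facts = bilipschitz_diffeo_facts[OF \<psi>]
  have [measurable]: "inv \<psi> \<in> borel_measurable borel" "\<psi> \<in> borel_measurable borel"
    by (intro borel_measurable_continuous_onI facts)+
  define U where "U = pushed_gradient (inv \<psi>) V"
  have U [measurable]: "U \<in> borel_measurable borel"
  proof -
    have [measurable]: "(\<lambda>z. frechet_derivative (inv \<psi>) (at z) (axis i 1) $ l) \<in> borel_measurable borel" for i l
      by (rule borel_measurable_vec_nth[OF borel_measurable_derivative[OF facts(3)]])
    show ?thesis
      unfolding U_def pushed_gradient_def [abs_def] by (intro borel_measurable_vec_lambda) measurable
  qed
  have F_eq: "AE z in lebesgue. v (inv \<psi> z) = F (inv \<psi> z)"
    using AE_comp_inv[OF \<psi> F] by eventually_elim simp
  have "has_weak_gradient (\<lambda>z. F (inv \<psi> z)) U"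
    using has_weak_gradient_cong_AE[OF weak F_eq] by (simp add: U_def)
  moreover from this have "has_weak_gradient (\<lambda>z. F (inv \<psi> z)) (weak_gradient (\<lambda>z. F (inv \<psi> z)))"
    unfolding weak_gradient_def by (rule someI[where P="has_weak_gradient (\<lambda>z. F (inv \<psi> z))"])
  ultimately have grad: "AE z in lebesgue. U z = weak_gradient (\<lambda>z. F (inv \<psi> z)) z"
    by (rule weak_gradient_unique)
  define K where "K = 1 + real CARD('n) ^ 3 * M\<^sup>2"
  have K: "0 < K" unfolding K_def by (intro add_pos_nonneg) auto
  define u where "u = (\<lambda>y. (cmod (v y))\<^sup>2 + (norm (U (\<psi> y)))\<^sup>2)"
  have u [measurable]: "u \<in> borel_measurable borel" unfolding u_def by measurable
  have u_nn: "0 \<le> u y" for y by (simp add: u_def)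
  have "(\<integral>\<^sup>+y. ennreal ((cmod (v y))\<^sup>2 + (\<Sum>l\<in>UNIV. (cmod (V l y))\<^sup>2)) * indicator unit_cell y \<partial>lborel)
      \<le> (\<integral>\<^sup>+y. ennreal (K / \<nu>) * (ennreal \<bar>det (jacobian \<psi> (at y))\<bar> * (ennreal (u y) * indicator unit_cell y)) \<partial>lborel)"
  proof (rule nn_integral_mono_AE, use M \<nu>(2) in eventually_elim)
    case (elim y)
    have V_le: "(cmod (V l y))\<^sup>2 \<le> real CARD('n) ^ 2 * M\<^sup>2 * (norm (U (\<psi> y)))\<^sup>2" for l
    proof -
      have "cmod (V l y) \<le> real CARD('n) * M * norm (U (\<psi> y))"
        unfolding U_def by (rule path_gradient_inverse[OF \<psi> elim(1)])
      then have "(cmod (V l y))\<^sup>2 \<le> (real CARD('n) * M * norm (U (\<psi> y)))\<^sup>2" by (intro power_mono) auto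
      then show ?thesis by (simp add: power_mult_distrib)
    qed
    have "(\<Sum>l\<in>UNIV. (cmod (V l y))\<^sup>2) \<le> (\<Sum>l\<in>(UNIV :: 'n set). real CARD('n) ^ 2 * M\<^sup>2 * (norm (U (\<psi> y)))\<^sup>2)"
      by (intro sum_mono V_le)
    also have "\<dots> = (K - 1) * (norm (U (\<psi> y)))\<^sup>2"
      by (simp add: K_def power3_eq_cube power2_eq_square)
    finally have "(cmod (v y))\<^sup>2 + (\<Sum>l\<in>UNIV. (cmod (V l y))\<^sup>2) \<le> (cmod (v y))\<^sup>2 + (K - 1) * (norm (U (\<psi> y)))\<^sup>2" by simp
    also have "\<dots> \<le> K * (cmod (v y))\<^sup>2 + K * (norm (U (\<psi> y)))\<^sup>2"
    proof (rule add_mono)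
      have "1 \<le> K" by (simp add: K_def)
      then have "1 * (cmod (v y))\<^sup>2 \<le> K * (cmod (v y))\<^sup>2" by (rule mult_right_mono) simp
      then show "(cmod (v y))\<^sup>2 \<le> K * (cmod (v y))\<^sup>2" by simp
      show "(K - 1) * (norm (U (\<psi> y)))\<^sup>2 \<le> K * (norm (U (\<psi> y)))\<^sup>2" by (rule mult_right_mono) simp_all
    qed
    also have "\<dots> = K * u y" by (simp add: u_def distrib_left)
    also have "\<dots> \<le> (K / \<nu>) * (\<bar>det (jacobian \<psi> (at y))\<bar> * u y)"
    proof -
      have "K * u y = (K / \<nu>) * (\<nu> * u y)" using \<nu>(1) by simp
      also have "\<dots> \<le> (K / \<nu>) * (\<bar>det (jacobian \<psi> (at y))\<bar> * u y)"
        using K \<nu>(1) elim(2) u_nn[of y] by (intro mult_left_mono mult_right_mono) auto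
      finally show ?thesis .
    qed
    finally have "ennreal ((cmod (v y))\<^sup>2 + (\<Sum>l\<in>UNIV. (cmod (V l y))\<^sup>2)) \<le> ennreal ((K / \<nu>) * (\<bar>det (jacobian \<psi> (at y))\<bar> * u y))"
      by (rule ennreal_leI)
    also have "\<dots> = ennreal (K / \<nu>) * (ennreal \<bar>det (jacobian \<psi> (at y))\<bar> * ennreal (u y))"
      using K \<nu>(1) u_nn[of y] by (subst ennreal_mult) (simp_all add: ennreal_mult)
    finally show ?case by (auto simp: indicator_def)
  qed
  also have "\<dots> = ennreal (K / \<nu>) * (\<integral>\<^sup>+y. ennreal \<bar>det (jacobian \<psi> (at y))\<bar> * (ennreal (u y) * indicator unit_cell y) \<partial>lborel)"
  proof (rule nn_integral_cmult)
    have [measurable]: "(\<lambda>y. det (jacobian \<psi> (at y))) \<in> borel_measurable borel"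
      unfolding jacobian_def by (rule borel_measurable_det_derivative[OF facts(2)])
    show "(\<lambda>y. ennreal \<bar>det (jacobian \<psi> (at y))\<bar> * (ennreal (u y) * indicator unit_cell y)) \<in> borel_measurable lborel"
      by measurable
  qed
  also have "(\<integral>\<^sup>+y. ennreal \<bar>det (jacobian \<psi> (at y))\<bar> * (ennreal (u y) * indicator unit_cell y) \<partial>lborel)
      = (\<integral>\<^sup>+z. ennreal (u (inv \<psi> z)) * indicator (\<psi> ` unit_cell) z \<partial>lebesgue)"
    by (rule nn_integral_image_cell[OF \<psi> u u_nn, symmetric])
  also have "\<dots> = (\<integral>\<^sup>+z. ennreal ((cmod (F (inv \<psi> z)))\<^sup>2 + (norm (weak_gradient (\<lambda>z. F (inv \<psi> z)) z))\<^sup>2) * indicator (\<psi> ` unit_cell) z \<partial>lebesgue)"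
    by (rule nn_integral_cong_AE) (use F_eq grad in eventually_elim, simp add: u_def facts(9))
  finally show ?thesis unfolding K_def .
qed

section \<open>The compact embeddings\<close>

lemma emeasure_unit_cell: "emeasure lborel (unit_cell :: (real ^ 'n::finite) set) = 1"
  using emeasure_torus_space[where 'm='n] by (simp add: torus_def emeasure_restrict_space)

lemma deformation_facts:
  fixes \<Phi> :: "real ^ 'n::finite \<Rightarrow> real ^ 'm::finite \<Rightarrow> real ^ 'n"
  assumes "stochastic_deformation \<tau> \<Phi>"
  obtains \<nu> M where "0 < \<nu>" "0 < M" "AE \<omega> in torus. bilipschitz_diffeo (\<lambda>y. \<Phi> y \<omega>)"
    "AE \<omega> in torus. AE y in lborel. \<nu> \<le> det (jacobian (\<lambda>y. \<Phi> y \<omega>) (at y))"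
    "AE \<omega> in torus. AE y in lborel. norm (jacobian (\<lambda>y. \<Phi> y \<omega>) (at y)) \<le> M"
proof -
  obtain \<nu> M where *: "0 < \<nu>" "0 < M" "AE \<omega> in torus. bilipschitz_diffeo (\<lambda>y. \<Phi> y \<omega>)"
    "AE p in field_measure. case p of (y, \<omega>) \<Rightarrow> \<nu> \<le> det (field_jacobian \<Phi> y \<omega>)"
    "AE p in field_measure. case p of (y, \<omega>) \<Rightarrow> norm (field_jacobian \<Phi> y \<omega>) \<le> M"
    using assms unfolding stochastic_deformation_def by blast
  show thesis
    using AE_field_measure(1)[OF *(4)] AE_field_measure(1)[OF *(5)] that[OF *(1-3)]
    by (simp add: field_jacobian_def)
qed

text \<open>
  The estimates on single paths are integrated over \<open>\<omega>\<close>; invariance under the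
  flow turns the left-hand sides into the weighted norm of \<open>h\<close>.
\<close>

lemma deformed_energy_estimate:
  fixes \<Phi> :: "real ^ 'n::finite \<Rightarrow> real ^ 'm::finite \<Rightarrow> real ^ 'n" and \<Lambda> :: "real ^ 'n ^ 'm"
  assumes \<nu>: "0 < \<nu>" and bl: "AE \<omega> in torus. bilipschitz_diffeo (\<lambda>y. \<Phi> y \<omega>)"
    and det: "AE \<omega> in torus. AE y in lborel. \<nu> \<le> det (jacobian (\<lambda>y. \<Phi> y \<omega>) (at y))"
    and M: "AE \<omega> in torus. AE y in lborel. norm (jacobian (\<lambda>y. \<Phi> y \<omega>) (at y)) \<le> M"
    and f: "f \<in> H1_loc"
    and h [measurable]: "h \<in> borel_measurable borel" and h_L2: "h \<in> L2_torus"
    and rep: "AE \<omega> in torus. AE x in lborel. f x \<omega> = h (wrap (\<Lambda> *v x) \<omega>)"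
    and bound: "deformed_H1_norm \<Phi> (deformed \<Phi> f) \<le> ennreal D" and D: "0 \<le> D"
  shows "H1_norm (dual_weight \<Lambda>) h \<le> ennreal (sqrt ((1 + real CARD('n) ^ 3 * M\<^sup>2) / \<nu>) * D)"
proof -
  define C where "C = (1 + real CARD('n) ^ 3 * M\<^sup>2) / \<nu>"
  have C: "0 < C" using \<nu> unfolding C_def by (intro divide_pos_pos add_pos_nonneg) auto
  obtain V where V [measurable]: "\<And>l. V l \<in> borel_measurable borel" and V_L2: "\<And>l. V l \<in> L2_torus"
    and V_coeff: "\<And>l k. fourier_coeff (V l) k = deriv_coeff \<Lambda> (fourier_coeff h) l k"
    and V_grad: "AE \<omega> in torus. \<forall>\<psi>. bilipschitz_diffeo \<psi> \<longrightarrow> has_weak_gradient (\<lambda>z. h (wrap (\<Lambda> *v inv \<psi> z) \<omega>))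
      (pushed_gradient (inv \<psi>) (\<lambda>l x. V l (wrap (\<Lambda> *v x) \<omega>)))"
    by (rule path_gradient[OF h h_L2 weak_derivative_coeffs_summable[OF h h_L2 rep f]]) blast
  define q where "q = (\<lambda>\<omega>. ennreal ((cmod (h \<omega>))\<^sup>2 + (\<Sum>l\<in>UNIV. (cmod (V l \<omega>))\<^sup>2)))"
  have [measurable]: "q \<in> borel_measurable borel" unfolding q_def by measurable
  define I where "I = (\<lambda>\<omega>. \<integral>\<^sup>+z. ennreal ((cmod (deformed \<Phi> f z \<omega>))\<^sup>2 + (norm (weak_gradient (\<lambda>z. deformed \<Phi> f z \<omega>) z))\<^sup>2)
      * indicator ((\<lambda>y. \<Phi> y \<omega>) ` unit_cell) z \<partial>lebesgue)"
  have "(\<integral>\<^sup>+k. ennreal ((1 + (dual_weight \<Lambda> k)\<^sup>2) * (cmod (fourier_coeff h k))\<^sup>2) \<partial>count_space UNIV)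
      = sq_norm h + (\<Sum>l\<in>UNIV. sq_norm (V l))"
    by (rule energy_identity[OF h_L2 V_L2 V_coeff])
  also have "\<dots> = (\<integral>\<^sup>+\<omega>. q \<omega> \<partial>torus)"
    unfolding q_def sq_norm_def
    by (simp add: ennreal_plus sum_nonneg nn_integral_add nn_integral_sum measurable_torusI flip: sum_ennreal)
  also have "\<dots> = (\<integral>\<^sup>+\<omega>. \<integral>\<^sup>+y. q (wrap (\<Lambda> *v y) \<omega>) * indicator unit_cell y \<partial>lborel \<partial>torus)"
    by (subst nn_integral_flow) (simp_all add: emeasure_unit_cell)
  also have "\<dots> \<le> ennreal (C * D\<^sup>2)"
  proof -
    \<comment> \<open>The constant is moved to the measurable side, since the integrand on the other side may fail to be measurable in the torus variable.\<close>
    define Y where "Y = (\<lambda>\<omega>. \<integral>\<^sup>+y. q (wrap (\<Lambda> *v y) \<omega>) * indicator unit_cell y \<partial>lborel)"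
    have [measurable]: "Y \<in> borel_measurable torus"
      unfolding Y_def by (rule measurable_nn_integral_flow) measurable
    have cancel: "ennreal (1 / C) * (ennreal C * t) = t" "ennreal C * (ennreal (1 / C) * t) = t" for t
      using C by (simp_all add: mult.assoc[symmetric] ennreal_mult[symmetric])
    have "ennreal (1 / C) * (\<integral>\<^sup>+\<omega>. Y \<omega> \<partial>torus) = (\<integral>\<^sup>+\<omega>. ennreal (1 / C) * Y \<omega> \<partial>torus)"
      by (rule nn_integral_cmult[symmetric]) measurable
    also have "\<dots> \<le> (\<integral>\<^sup>+\<omega>. I \<omega> \<partial>torus)"
    proof (rule nn_integral_mono_AE, use bl det M rep V_grad in eventually_elim)
      case (elim \<omega>)
      have "Y \<omega> \<le> ennreal C * I \<omega>"
        unfolding Y_def q_def I_def deformed_def C_def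
      proof (rule path_energy_estimate[where v="\<lambda>y. h (wrap (\<Lambda> *v y) \<omega>)" and V="\<lambda>l y. V l (wrap (\<Lambda> *v y) \<omega>)"
            and F="\<lambda>y. f y \<omega>", OF elim(1) elim(3) \<nu> elim(2)])
        show "(\<lambda>y. h (wrap (\<Lambda> *v y) \<omega>)) \<in> borel_measurable borel"
          "\<And>l. (\<lambda>y. V l (wrap (\<Lambda> *v y) \<omega>)) \<in> borel_measurable borel"
          by (rule measurable_compose[OF measurable_flow_fst]; simp)+
      qed (use elim in blast)+
      then have "ennreal (1 / C) * Y \<omega> \<le> ennreal (1 / C) * (ennreal C * I \<omega>)" by (rule mult_left_mono) simp
      then show ?case by (simp only: cancel)
    qed
    also have "\<dots> \<le> ennreal (D\<^sup>2)"
      using bound D unfolding deformed_H1_norm_def I_def by (simp add: ennreal_sqrt_le_iff)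
    finally have "ennreal C * (ennreal (1 / C) * (\<integral>\<^sup>+\<omega>. Y \<omega> \<partial>torus)) \<le> ennreal C * ennreal (D\<^sup>2)"
      by (rule mult_left_mono) simp
    then show ?thesis using C by (simp only: cancel Y_def) (simp add: ennreal_mult)
  qed
  also have "C * D\<^sup>2 = (sqrt C * D)\<^sup>2" using C by (simp add: power_mult_distrib)
  finally show ?thesis
    unfolding H1_norm_eq C_def[symmetric] using C D by (subst ennreal_sqrt_le_iff) simp_all
qed

lemma deformed_L2_estimate:
  fixes \<Phi> :: "real ^ 'n::finite \<Rightarrow> real ^ 'm::finite \<Rightarrow> real ^ 'n" and \<Lambda> :: "real ^ 'n ^ 'm"
  assumes bl: "AE \<omega> in torus. bilipschitz_diffeo (\<lambda>y. \<Phi> y \<omega>)"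
    and M: "AE \<omega> in torus. AE y in lborel. norm (jacobian (\<lambda>y. \<Phi> y \<omega>) (at y)) \<le> M"
    and h [measurable]: "h \<in> borel_measurable borel"
    and rep: "AE \<omega> in torus. AE x in lborel. f x \<omega> = h (wrap (\<Lambda> *v x) \<omega>)"
  shows "deformed_L2_norm \<Phi> (deformed \<Phi> f) \<le> ennreal_sqrt (ennreal (fact CARD('n) * M ^ CARD('n)) * sq_norm h)"
proof -
  define C where "C = ennreal (fact CARD('n) * M ^ CARD('n))"
  define q where "q = (\<lambda>\<omega>. ennreal ((cmod (h \<omega>))\<^sup>2))"
  have [measurable]: "q \<in> borel_measurable borel" unfolding q_def by measurable
  define I where "I = (\<lambda>\<omega>. \<integral>\<^sup>+z. ennreal ((cmod (deformed \<Phi> f z \<omega>))\<^sup>2) * indicator ((\<lambda>y. \<Phi> y \<omega>) ` unit_cell) z \<partial>lebesgue)"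
  have "(\<integral>\<^sup>+\<omega>. I \<omega> \<partial>torus) \<le> (\<integral>\<^sup>+\<omega>. C * (\<integral>\<^sup>+y. q (wrap (\<Lambda> *v y) \<omega>) * indicator unit_cell y \<partial>lborel) \<partial>torus)"
  proof (rule nn_integral_mono_AE, use bl M rep in eventually_elim)
    case (elim \<omega>)
    have "(\<lambda>y. h (wrap (\<Lambda> *v y) \<omega>)) \<in> borel_measurable borel"
      by (rule measurable_compose[OF measurable_flow_fst]) simp
    from path_L2_estimate[OF elim(1,2) this elim(3)]
    show ?case unfolding q_def I_def deformed_def C_def .
  qed
  also have "\<dots> = C * (\<integral>\<^sup>+\<omega>. \<integral>\<^sup>+y. q (wrap (\<Lambda> *v y) \<omega>) * indicator unit_cell y \<partial>lborel \<partial>torus)"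
    by (intro nn_integral_cmult measurable_nn_integral_flow) measurable
  also have "\<dots> = C * sq_norm h"
    by (subst nn_integral_flow) (simp_all add: emeasure_unit_cell q_def sq_norm_def)
  finally have "(\<integral>\<^sup>+\<omega>. I \<omega> \<partial>torus) \<le> C * sq_norm h" .
  then show ?thesis
    unfolding deformed_L2_norm_def C_def[symmetric] I_def by (rule ennreal_sqrt_mono)
qed

lemma flow_extension:
  fixes l :: "real ^ 'm::finite \<Rightarrow> complex" and \<Lambda> :: "real ^ 'n::finite ^ 'm"
  assumes l [measurable]: "l \<in> borel_measurable borel" and l_L2: "l \<in> L2_torus"
  shows "stationary (torus_flow \<Lambda>) (\<lambda>x \<omega>. l (wrap (\<Lambda> *v x) \<omega>))" and "(\<lambda>x \<omega>. l (wrap (\<Lambda> *v x) \<omega>)) \<in> L2_loc"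
proof -
  have "(\<lambda>p. l (wrap (\<Lambda> *v fst p) (snd p))) \<in> borel_measurable borel" by measurable
  then have meas: "case_prod (\<lambda>x \<omega>. l (wrap (\<Lambda> *v x) \<omega>)) \<in> borel_measurable field_measure"
    unfolding field_measure_def
    by (intro measurable_restrict_space1 measurable_completion) (simp add: case_prod_beta')
  then show "stationary (torus_flow \<Lambda>) (\<lambda>x \<omega>. l (wrap (\<Lambda> *v x) \<omega>))"
    by (simp add: stationary_def torus_flow_eq_wrap wrap_wrap matrix_vector_right_distrib)
  have "(\<integral>\<^sup>+x. (\<integral>\<^sup>+\<omega>. ennreal ((norm (l (wrap (\<Lambda> *v x) \<omega>)))\<^sup>2) \<partial>torus) * indicator K x \<partial>lebesgue) < \<infinity>"
    if K: "compact K" for K :: "(real ^ 'n) set"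
  proof -
    have "(\<integral>\<^sup>+\<omega>. ennreal ((norm (l (wrap (\<Lambda> *v x) \<omega>)))\<^sup>2) \<partial>torus) = sq_norm l" for x
      unfolding sq_norm_def by (rule nn_integral_wrap) measurable
    moreover have "K \<in> sets borel" "emeasure lborel K < \<infinity>"
      using borel_compact[OF K] emeasure_bounded_finite[OF compact_imp_bounded[OF K]] by simp_all
    ultimately show ?thesis
      using l_L2 by (simp add: nn_integral_completion nn_integral_cmult_indicator L2_torus_iff ennreal_mult_less_top)
  qed
  with meas show "(\<lambda>x \<omega>. l (wrap (\<Lambda> *v x) \<omega>)) \<in> L2_loc"
    by (simp add: L2_loc_def)
qed

theorem torus_compact_embedding:
  fixes \<gamma> :: "int ^ 'm::finite \<Rightarrow> real"
  assumes fin: "\<And>d. d > 0 \<Longrightarrow> finite {k. \<bar>\<gamma> k\<bar> \<le> d}"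
  shows "compactly_embedded (H1_torus \<gamma>) (H1_norm \<gamma>) L2_torus L2_norm"
  unfolding compactly_embedded_def
proof (intro conjI allI impI)
  show "H1_torus \<gamma> \<subseteq> L2_torus" by (auto simp: H1_torus_def)
  fix u :: "nat \<Rightarrow> real ^ 'm \<Rightarrow> complex"
  assume u: "(\<forall>j. u j \<in> H1_torus \<gamma>) \<and> (\<exists>C::real. \<forall>j. H1_norm \<gamma> (u j) \<le> ennreal C)"
  then obtain C where C: "\<And>j. H1_norm \<gamma> (u j) \<le> ennreal C" by blast
  have u_L2: "\<And>j. u j \<in> L2_torus" using u by (simp add: H1_torus_def)
  obtain r l where r: "strict_mono (r :: nat \<Rightarrow> nat)" "l \<in> L2_torus"
    "(\<lambda>j. sq_norm (\<lambda>\<omega>. u (r j) \<omega> - l \<omega>)) \<longlonglongrightarrow> 0"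
    by (rule H1_compact_sequence[where \<gamma>=\<gamma>, OF fin u_L2 C]) blast+
  have "(\<lambda>j. L2_norm (u (r j) - l)) \<longlonglongrightarrow> 0"
    using tendsto_ennreal_sqrt_0[OF r(3)] by (simp add: L2_norm_def sq_norm_def)
  then show "\<exists>r l. strict_mono (r :: nat \<Rightarrow> nat) \<and> l \<in> L2_torus \<and> (\<lambda>j. L2_norm (u (r j) - l)) \<longlonglongrightarrow> 0"
    using r by blast
qed

theorem deformed_compact_embedding:
  fixes \<Phi> :: "real ^ 'n::finite \<Rightarrow> real ^ 'm::finite \<Rightarrow> real ^ 'n" and \<Lambda> :: "real ^ 'n ^ 'm"
  assumes fin: "\<And>d. d > 0 \<Longrightarrow> finite {k. \<bar>dual_weight \<Lambda> k\<bar> \<le> d}"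
    and \<Phi>: "stochastic_deformation (torus_flow \<Lambda>) \<Phi>"
  shows "compactly_embedded (deformed_H1 (torus_flow \<Lambda>) \<Phi>) (deformed_H1_norm \<Phi>)
         (deformed_L2 (torus_flow \<Lambda>) \<Phi>) (deformed_L2_norm \<Phi>)"
  unfolding compactly_embedded_def
proof (intro conjI allI impI)
  show "deformed_H1 (torus_flow \<Lambda>) \<Phi> \<subseteq> deformed_L2 (torus_flow \<Lambda>) \<Phi>"
    by (auto simp: deformed_H1_def deformed_L2_def H1_loc_def)
  fix u :: "nat \<Rightarrow> real ^ 'n \<Rightarrow> real ^ 'm \<Rightarrow> complex"
  assume u: "(\<forall>j. u j \<in> deformed_H1 (torus_flow \<Lambda>) \<Phi>) \<and> (\<exists>C::real. \<forall>j. deformed_H1_norm \<Phi> (u j) \<le> ennreal C)"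
  then obtain D0 where D0: "\<And>j. deformed_H1_norm \<Phi> (u j) \<le> ennreal D0" by blast
  define D where "D = max D0 0"
  have D: "deformed_H1_norm \<Phi> (u j) \<le> ennreal D" for j
    using order_trans[OF D0[of j] ennreal_leI[of D0 D]] by (simp add: D_def)
  have "\<forall>j. \<exists>f. f \<in> H1_loc \<and> stationary (torus_flow \<Lambda>) f \<and> u j = deformed \<Phi> f"
    using u unfolding deformed_H1_def by blast
  then obtain f where f: "\<And>j. f j \<in> H1_loc" "\<And>j. stationary (torus_flow \<Lambda>) (f j)" "\<And>j. u j = deformed \<Phi> (f j)"
    by metis
  have "\<forall>j. \<exists>h. h \<in> borel_measurable borel \<and> h \<in> L2_torus \<and> (AE \<omega> in torus. AE x in lborel. f j x \<omega> = h (wrap (\<Lambda> *v x) \<omega>))"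
  proof
    fix j
    obtain h where h: "h \<in> borel_measurable borel" "\<And>x. AE \<omega> in torus. f j x \<omega> = h (wrap (\<Lambda> *v x) \<omega>)"
      "AE \<omega> in torus. AE x in lborel. f j x \<omega> = h (wrap (\<Lambda> *v x) \<omega>)"
      by (rule stationary_representation[OF f(2)]) blast
    moreover have "h \<in> L2_torus"
      by (rule representative_L2[OF _ h(1,2)]) (use f(1)[of j] in \<open>simp add: H1_loc_def\<close>)
    ultimately show "\<exists>h. h \<in> borel_measurable borel \<and> h \<in> L2_torus \<and> (AE \<omega> in torus. AE x in lborel. f j x \<omega> = h (wrap (\<Lambda> *v x) \<omega>))"
      by blast
  qed
  from choice[OF this] obtain h where h: "\<And>j. h j \<in> borel_measurable borel" "\<And>j. h j \<in> L2_torus"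
    "\<And>j. AE \<omega> in torus. AE x in lborel. f j x \<omega> = h j (wrap (\<Lambda> *v x) \<omega>)" by blast
  obtain \<nu> M where def: "0 < \<nu>" "AE \<omega> in torus. bilipschitz_diffeo (\<lambda>y. \<Phi> y \<omega>)"
    "AE \<omega> in torus. AE y in lborel. \<nu> \<le> det (jacobian (\<lambda>y. \<Phi> y \<omega>) (at y))"
    "AE \<omega> in torus. AE y in lborel. norm (jacobian (\<lambda>y. \<Phi> y \<omega>) (at y)) \<le> M"
    by (rule deformation_facts[OF \<Phi>]) blast
  have H1_bound: "H1_norm (dual_weight \<Lambda>) (h j) \<le> ennreal (sqrt ((1 + real CARD('n) ^ 3 * M\<^sup>2) / \<nu>) * D)" for j
    by (rule deformed_energy_estimate[OF def f(1) h(1-3)]) (use D[of j] f(3) in \<open>simp_all add: D_def\<close>)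
  obtain r l where r: "strict_mono (r :: nat \<Rightarrow> nat)" and l: "l \<in> borel_measurable borel" "l \<in> L2_torus"
    and lim: "(\<lambda>j. sq_norm (\<lambda>\<omega>. h (r j) \<omega> - l \<omega>)) \<longlonglongrightarrow> 0"
    by (rule H1_compact_sequence[where \<gamma>="dual_weight \<Lambda>", OF fin h(2) H1_bound]) blast+
  define g where "g = (\<lambda>x \<omega>. l (wrap (\<Lambda> *v x) \<omega>))"
  have g: "deformed \<Phi> g \<in> deformed_L2 (torus_flow \<Lambda>) \<Phi>"
    using flow_extension[OF l] unfolding g_def deformed_L2_def by blast
  define C where "C = fact CARD('n) * M ^ CARD('n)"
  have le: "deformed_L2_norm \<Phi> (u (r j) - deformed \<Phi> g) \<le> ennreal_sqrt (ennreal C * sq_norm (\<lambda>\<omega>. h (r j) \<omega> - l \<omega>))" for j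
  proof -
    have "u (r j) - deformed \<Phi> g = deformed \<Phi> (\<lambda>x \<omega>. f (r j) x \<omega> - g x \<omega>)"
      by (simp add: f(3) deformed_def fun_eq_iff)
    moreover have "AE \<omega> in torus. AE x in lborel. f (r j) x \<omega> - g x \<omega> = h (r j) (wrap (\<Lambda> *v x) \<omega>) - l (wrap (\<Lambda> *v x) \<omega>)"
      using h(3)[of "r j"] by eventually_elim (auto simp: g_def elim: eventually_mono)
    ultimately show ?thesis
      using deformed_L2_estimate[OF def(2) def(4), of "\<lambda>\<omega>. h (r j) \<omega> - l \<omega>" "\<lambda>x \<omega>. f (r j) x \<omega> - g x \<omega>" \<Lambda>] h(1) l(1)
      by (simp add: C_def)
  qed
  have "(\<lambda>j. ennreal C * sq_norm (\<lambda>\<omega>. h (r j) \<omega> - l \<omega>)) \<longlonglongrightarrow> ennreal C * 0"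
    by (intro ennreal_tendsto_cmult lim) simp
  then have "(\<lambda>j. ennreal_sqrt (ennreal C * sq_norm (\<lambda>\<omega>. h (r j) \<omega> - l \<omega>))) \<longlonglongrightarrow> 0"
    by (intro tendsto_ennreal_sqrt_0) simp
  then have "(\<lambda>j. deformed_L2_norm \<Phi> (u (r j) - deformed \<Phi> g)) \<longlonglongrightarrow> 0"
    by (rule tendsto_sandwich[OF _ _ tendsto_const, rotated 2]) (use le in auto)
  then show "\<exists>r l. strict_mono (r :: nat \<Rightarrow> nat) \<and> l \<in> deformed_L2 (torus_flow \<Lambda>) \<Phi> \<and> (\<lambda>j. deformed_L2_norm \<Phi> (u (r j) - l)) \<longlonglongrightarrow> 0"
    using r g by blast
qed

theorem mainTheorem6:
  fixes \<Lambda> :: "real ^ 'n::finite ^ 'm::finite"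
  assumes "\<forall>k :: int ^ 'm. (\<Sum>i\<in>UNIV. of_int (k $ i) *\<^sub>R row i \<Lambda>) = 0 \<longrightarrow> k = 0"
    and "\<forall>d>0. finite {k :: int ^ 'm. norm (transpose \<Lambda> *v real_vec k) \<le> d}"
  shows "compactly_embedded (H1_torus (dual_weight \<Lambda>)) (H1_norm (dual_weight \<Lambda>)) L2_torus L2_norm \<and>
    (\<forall>\<Phi> :: real ^ 'n \<Rightarrow> real ^ 'm \<Rightarrow> real ^ 'n. stochastic_deformation (torus_flow \<Lambda>) \<Phi> \<longrightarrow>
       compactly_embedded (deformed_H1 (torus_flow \<Lambda>) \<Phi>) (deformed_H1_norm \<Phi>)
         (deformed_L2 (torus_flow \<Lambda>) \<Phi>) (deformed_L2_norm \<Phi>))"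
proof -
  have "finite {k. \<bar>dual_weight \<Lambda> k\<bar> \<le> d}" if "d > 0" for d
  proof -
    have "{k. \<bar>dual_weight \<Lambda> k\<bar> \<le> d} = {k. norm (transpose \<Lambda> *v real_vec k) \<le> d / (2 * pi)}"
      by (auto simp: dual_weight_def abs_mult field_simps)
    then show ?thesis using assms(2) that by simp
  qed
  then show ?thesis
    using torus_compact_embedding deformed_compact_embedding by blast
qed

end
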